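(* Let $\rho>0$, $\mu>0$ and $\gamma>0$, and let $E^{\gamma}_{\rho,\mu}$ be the three-parametric Mittag-Leffler function. Let $f$ be the threshold function on $[1,2]$ defined in the context. (I) $E^{\gamma}_{\rho,\mu}(z)$ takes negative values on the negative half line if any of the following conditions holds: (1) $\rho>2$; (2) $\mu<\gamma\rho$; (3) $\rho=2$ and $\mu<3\gamma$; (4) $1<\rho\leq 2$, $\gamma\geq 1$ and $\mu<\gamma\rho+f(\rho)-\rho$. (II) $E^{\gamma}_{\rho,\mu}(z)$ is non-negative on the real line if any of the following conditions holds: (1) $\rho\leq 1$ and $\mu\geq\rho\gamma$; (2) $1<\rho\leq 2$, $\gamma\leq 1$ and $\mu\geq\gamma\rho+f(\rho)-\rho$; (3) $1<\rho\leq 2$, $2\mu\geq 3\gamma\rho$ and $2\left(\frac{\mu}{\rho}-\gamma\right)\left(\frac{\mu}{\rho}-\gamma+\frac12\right)\geq\gamma$.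
   Context: Three-parametric Mittag-Leffler function: for $\rho,\mu,\gamma>0$ and $z\in\mathbb{C}$, $E^{\gamma}_{\rho,\mu}(z)=\sum_{n\geq 0}\frac{\Gamma(\gamma+n)}{\Gamma(\gamma)\Gamma(1+n)\Gamma(\mu+\rho n)}z^n$. Two-parametric Mittag-Leffler function: $E_{\rho,\mu}(z)=\sum_{n\geq 0}\frac{z^n}{\Gamma(\mu+\rho n)}$. The function $f$: it is a known fact (Popov and Sedletskii) that there is an increasing function $f:[1,2]\to\mathbb{R}$ with $f(1)=1$, $f(2)=3$, such that the set $\mathcal{D}=\{(\rho,\mu): \rho,\mu>0,\ E_{\rho,\mu}(-t)\geq 0 \text{ for all } t>0\}$ equals $\{0<\rho\leq 1,\ \mu\geq\rho\}\cup\{1<\rho\leq 2,\ \mu\geq f(\rho)\}$. Thus, for $1<\rho\leq 2$ and $\mu>0$, one has $E_{\rho,\mu}(-t)\ge 0$ for all $t>0$ if and only if $\mu\geq f(\rho)$, which determines $f$ on $(1,2]$. It is also known that $\rho<L(\rho)<f(\rho)<U(\rho)<3\rho/2$ for $1<\rho<2$, where $L(\rho)=\rho+\exp(-\pi\cot(\pi(1-1/\rho)))$ for $1<\rho<3/2$, $L(\rho)=3(\rho-1)+0.7(2-\rho)^2$ for $3/2\leq\rho<2$, $U(\rho)=4\rho/3$ for $1<\rho<3/2$, and $U(\rho)=2\rho-1$ for $3/2\leq\rho<2$. *)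

theory Defs
  imports "HOL-Analysis.Analysis"
begin

text \<open>
  Both Mittag-Leffler functions are generic in the type of the argument, so that they can be used
  at type \<^typ>\<open>complex\<close> as well as at type \<^typ>\<open>real\<close>; the two instances agree on the real axis
  (lemma \<open>mittag_leffler3_of_real\<close> below). All parameters are meant to be positive.
\<close>

definition mittag_leffler2 :: "real \<Rightarrow> real \<Rightarrow> 'a \<Rightarrow> 'a :: {real_normed_field, banach}" where
  "mittag_leffler2 \<rho> \<mu> z = (\<Sum>n. z ^ n / of_real (Gamma (\<mu> + \<rho> * real n)))"

definition mittag_leffler3 :: "real \<Rightarrow> real \<Rightarrow> real \<Rightarrow> 'a \<Rightarrow> 'a :: {real_normed_field, banach}" where
  "mittag_leffler3 \<gamma> \<rho> \<mu> z =
     (\<Sum>n. of_real (Gamma (\<gamma> + real n) /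
             (Gamma \<gamma> * Gamma (1 + real n) * Gamma (\<mu> + \<rho> * real n))) * z ^ n)"

text \<open>
  The threshold function of Popov and Sedletskii: for \<open>1 < \<rho> \<le> 2\<close> there is exactly one real \<open>c\<close>
  such that, for all \<open>\<mu> > 0\<close>, the function \<open>E\<^bsub>\<rho>,\<mu>\<^esub>\<close> is non-negative on the negative
  half line if and only if \<open>\<mu> \<ge> c\<close>. The definition carries no information outside the range
  of \<open>\<rho>\<close> in which such a unique \<open>c\<close> exists.
\<close>

definition ml_threshold :: "real \<Rightarrow> real" where
  "ml_threshold \<rho> =
     (THE c. \<forall>\<mu>>0. (\<forall>t::real. t > 0 \<longrightarrow> mittag_leffler2 \<rho> \<mu> (- t) \<ge> 0) \<longleftrightarrow> \<mu> \<ge> c)"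


lemma Gamma_real_ge_powr:
  fixes x M :: real
  assumes "x \<ge> 1" "M > 0"
  shows "Gamma x \<ge> M powr (x - 1) / exp (M + 1)"
proof -
  have "((\<lambda>t. M powr (x - 1) / exp (M + 1)) has_integral
          measure lborel (cbox M (M + 1)) *\<^sub>R (M powr (x - 1) / exp (M + 1))) (cbox M (M + 1))"
    by (rule has_integral_const)
  hence const: "((\<lambda>t. M powr (x - 1) / exp (M + 1)) has_integral M powr (x - 1) / exp (M + 1)) {M..M+1}"
    by simp
  have whole: "((\<lambda>t. t powr (x - 1) / exp t) has_integral Gamma x) {0..}"
    using assms by (intro Gamma_integral_real) auto
  have "(\<lambda>t. if t \<in> {M..M+1} then M powr (x - 1) / exp (M + 1) else 0) t \<le> t powr (x - 1) / exp t"
    if "t \<in> {0..}" for t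
    using that assms by (auto intro!: frac_le powr_mono2)
  moreover have "((\<lambda>t. if t \<in> {M..M+1} then M powr (x - 1) / exp (M + 1) else 0)
       has_integral M powr (x - 1) / exp (M + 1)) {0..}"
    using const assms by (subst has_integral_restrict) auto
  ultimately show ?thesis
    using whole by (meson has_integral_le)
qed

lemma pochhammer_over_fact_le:
  fixes \<gamma> :: real
  assumes "\<gamma> > 0"
  shows "pochhammer \<gamma> n / fact n \<le> (1 + \<gamma>) ^ n"
proof (induction n)
  case (Suc n)
  have "pochhammer \<gamma> (Suc n) / fact (Suc n) = (pochhammer \<gamma> n / fact n) * ((\<gamma> + n) / (1 + n))"
    by (simp add: pochhammer_Suc field_simps)
  also have "\<dots> \<le> (1 + \<gamma>) ^ n * (1 + \<gamma>)"
    using assms Suc by (intro mult_mono) (auto simp: field_simps intro!: divide_nonneg_nonneg)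
  finally show ?case by (simp add: mult.commute)
qed auto

lemma mittag_leffler3_coeff:
  assumes "\<gamma> > 0"
  shows "Gamma (\<gamma> + real n) / (Gamma \<gamma> * Gamma (1 + real n) * Gamma (\<mu> + \<rho> * real n)) =
         (pochhammer \<gamma> n / fact n) / Gamma (\<mu> + \<rho> * real n)"
proof -
  have "\<gamma> \<notin> \<int>\<^sub>\<le>\<^sub>0" using assms by (auto elim!: nonpos_Ints_cases)
  moreover have "Gamma (1 + real n) = fact n"
    using Gamma_fact[of n, where ?'a = real] by (simp add: add.commute)
  ultimately show ?thesis by (simp add: pochhammer_Gamma)
qed

lemma mittag_leffler3_summable:
  fixes z :: "'a :: {real_normed_field, banach}"
  assumes "\<gamma> > 0" "\<rho> > 0" "\<mu> > 0"
  shows "summable (\<lambda>n. of_real (Gamma (\<gamma> + real n) /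
           (Gamma \<gamma> * Gamma (1 + real n) * Gamma (\<mu> + \<rho> * real n))) * z ^ n)"
proof -
  define R where "R = 2 * ((1 + \<gamma>) * norm z + 1)"
  define M where "M = R powr (1 / \<rho>)"
  define C where "C = exp (M + 1) / M powr (\<mu> - 1)"
  have "R > 0" using assms by (auto simp: R_def intro!: add_nonneg_pos)
  hence M: "M > 0" "M powr \<rho> = R" using assms by (auto simp: M_def powr_powr)
  have "eventually (\<lambda>n. real n \<ge> 1 / \<rho>) sequentially"
    using filterlim_real_sequentially by (auto simp: filterlim_at_top)
  hence "eventually (\<lambda>n. norm (of_real (Gamma (\<gamma> + real n) /
           (Gamma \<gamma> * Gamma (1 + real n) * Gamma (\<mu> + \<rho> * real n))) * z ^ n) \<le> C * (1 / 2) ^ n)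
           sequentially"
  proof eventually_elim
    case (elim n)
    let ?x = "\<mu> + \<rho> * real n"
    have x: "?x \<ge> 1" using elim assms by (simp add: field_simps)
    have "M powr (?x - 1) = M powr (\<mu> - 1) * (M powr \<rho>) powr real n"
      unfolding powr_powr powr_add [symmetric] by (simp add: algebra_simps)
    also have "\<dots> = M powr (\<mu> - 1) * R ^ n"
      using M \<open>R > 0\<close> by (simp add: powr_realpow)
    finally have "Gamma ?x \<ge> R ^ n / C"
      using Gamma_real_ge_powr[OF x M(1)] by (simp add: C_def field_simps)
    moreover have "C > 0" using M by (simp add: C_def)
    ultimately have G: "1 / Gamma ?x \<le> C / R ^ n" "Gamma ?x > 0"
      using \<open>R > 0\<close> x by (auto simp: field_simps intro: Gamma_real_pos)
    have p: "pochhammer \<gamma> n / fact n \<ge> 0"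
      using assms by (auto intro!: divide_nonneg_pos pochhammer_nonneg)
    have "norm (of_real ((pochhammer \<gamma> n / fact n) / Gamma ?x) * z ^ n) =
            (pochhammer \<gamma> n / fact n) * (1 / Gamma ?x) * norm z ^ n"
      using G(2) divide_nonneg_pos[OF p G(2)] unfolding norm_mult norm_power norm_of_real
      by (subst abs_of_nonneg) auto
    also have "\<dots> \<le> (1 + \<gamma>) ^ n * (C / R ^ n) * norm z ^ n"
      using G p \<open>C > 0\<close> \<open>R > 0\<close> assms pochhammer_over_fact_le[OF assms(1)]
      by (intro mult_right_mono mult_mono) auto
    also have "\<dots> = C * ((1 + \<gamma>) * norm z / R) ^ n"
      by (simp add: power_mult_distrib power_divide)
    also have "\<dots> \<le> C * (1 / 2) ^ n"
      using \<open>C > 0\<close> \<open>R > 0\<close> assms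
      by (intro mult_left_mono power_mono) (auto simp: R_def field_simps)
    finally show ?case using mittag_leffler3_coeff[OF assms(1), of n \<mu> \<rho>] by simp
  qed
  thus ?thesis
    by (rule summable_comparison_test_ev) (auto intro!: summable_mult summable_geometric)
qed

lemma mittag_leffler3_of_real:
  assumes "\<gamma> > 0" "\<rho> > 0" "\<mu> > 0"
  shows "mittag_leffler3 \<gamma> \<rho> \<mu> (of_real x) =
           (of_real (mittag_leffler3 \<gamma> \<rho> \<mu> x) :: 'a :: {real_normed_field, banach})"
proof -
  have "(of_real (mittag_leffler3 \<gamma> \<rho> \<mu> x) :: 'a) =
     (\<Sum>n. of_real (Gamma (\<gamma> + real n) /
       (Gamma \<gamma> * Gamma (1 + real n) * Gamma (\<mu> + \<rho> * real n)) * x ^ n))"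
    using bounded_linear.suminf[OF bounded_linear_of_real mittag_leffler3_summable[OF assms, of x]]
    unfolding mittag_leffler3_def of_real_eq_id id_apply .
  thus ?thesis unfolding mittag_leffler3_def of_real_mult of_real_power by simp
qed

lemma mittag_leffler3_1: "mittag_leffler3 1 \<rho> \<mu> z = mittag_leffler2 \<rho> \<mu> z"
proof -
  have "Gamma (1 + real n) \<noteq> 0" for n
    using Gamma_real_pos[of "1 + real n"] by linarith
  thus ?thesis by (simp add: mittag_leffler2_def mittag_leffler3_def divide_simps)
qed

end

theory Submission
  imports Defs "HOL-Complex_Analysis.Complex_Analysis"
begin

text \<open>
  The sign of a Mittag-Leffler function on the negative half line is read off from a Laplace transform.
  Put \<open>a = \<mu> - \<rho>\<gamma>\<close> and let \<open>E\<close> be the three-parametric function. For \<open>s > 1\<close> the density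
  \<open>x powr (\<mu> - 1) * E (- x powr \<rho>)\<close> on \<open>(0, \<infinity>)\<close> has the Laplace transform
  \<open>s powr - a * (1 + s powr \<rho>) powr - \<gamma>\<close>, called the symbol below. The key fact is that, for
  \<open>0 < \<rho> \<le> 2\<close>, the function \<open>E\<close> is non-negative on the negative half line if and only if the symbol is
  completely monotone on \<open>(0, \<infinity>)\<close>.

  If the symbol is completely monotone, then all moments of the exponentially damped density
  are non-negative, and testing against kernels that concentrate at one point (as in the
  Post-Widder inversion formula) gives the sign of the density there
  (\<open>nonneg_if_completely_monotone_symbol\<close>). Conversely, if the density is non-negative, then its
  Laplace integral is, around a point \<open>s\<^sub>0 > 1\<close>, a power series in \<open>s\<^sub>0 - s\<close> with non-negative
  coefficients. The symbol extends holomorphically to the right half plane, so that the series converges in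
  the disc of radius \<open>s\<^sub>0\<close>; this is Landau's argument (\<open>landau_expansion\<close>) and it gives
  \<open>completely_monotone_symbol_if_nonneg\<close>. A power series with non-negative coefficients is
  moreover dominated on a circle by its value at the positive real point of that circle. This rules out that the
  symbol is singular at a complex boundary point of the disc unless it is at least as singular at the real
  one, which settles \<open>\<rho> > 2\<close> and \<open>\<rho> = 2, \<mu> < 3\<gamma>\<close>.

  The remaining cases become statements about the symbol. A completely monotone function
  decreases, so \<open>a \<ge> 0\<close> is necessary. Multiplication by \<open>s powr - c\<close> raises \<open>\<mu>\<close> with \<open>\<rho>\<close> and \<open>\<gamma>\<close> fixed.
  Composition with \<open>s powr \<alpha>\<close>, where \<open>\<alpha> \<le> 1\<close>, preserves complete monotonicity and replaces
  \<open>\<rho>\<close> by \<open>\<alpha>\<rho>\<close>; this settles \<open>\<rho> \<le> 1\<close> and reduces the last condition to \<open>\<rho> = 2\<close>. A Beta integral of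
  \<open>(s powr \<rho> + y) powr - \<gamma>\<close> over \<open>y > 1\<close> lowers \<open>\<gamma>\<close> with \<open>a\<close> fixed
  (\<open>completely_monotone_symbol_decrease_gamma\<close>); it transports the threshold, which belongs to
  \<open>\<gamma> = 1\<close>, to other values of \<open>\<gamma>\<close>.

  For \<open>\<rho> = 2\<close> and \<open>a = 2b\<close>, the inequalities \<open>2b \<ge> \<gamma>\<close> and \<open>b(2b + 1) \<ge> \<gamma>\<close> suffice. It is enough to treat the
  smallest such \<open>b\<close>. There \<open>E (- x\<^sup>2)\<close> is a series in the squares \<open>(J\<^bsub>\<nu>+n\<^esub> (x / 2))\<^sup>2\<close> of Bessel functions,
  divided by a power of \<open>x\<close>, as in Gasper's work on positive integrals of Bessel functions.
  Its coefficients satisfy a recursion with non-negative terms, hence are non-negative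
  (\<open>square_coeffs_exist\<close>, \<open>sum_of_squares_nonneg\<close>).
\<close>

section \<open>Complete monotonicity through power series\<close>

text \<open>
  By Bernstein's theorem on absolutely monotone functions these are the completely monotone functions
  on \<open>(0, \<infinity>)\<close>. Expanding at a point to the right, instead of asking for signs of derivatives, makes products and
  compositions a matter of rearranging non-negative series, and fits the moments of a Laplace integral.
  Points \<open>s\<^sub>0 > 1\<close> are enough because the intervals \<open>(0, s\<^sub>0)\<close> exhaust \<open>(0, \<infinity>)\<close>, and the Laplace
  integrals below are a priori known to converge only to the right of 1.
\<close>

definition completely_monotone :: "(real \<Rightarrow> real) \<Rightarrow> bool" where
  "completely_monotone f \<longleftrightarrow> (\<forall>s0>1. \<exists>h. (\<forall>k. h k \<ge> 0) \<and>
     (\<forall>z. 0 \<le> z \<and> z < s0 \<longrightarrow> (\<lambda>k. h k * z ^ k) sums f (s0 - z)))"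

lemma completely_monotone_I:
  assumes "\<And>s0. s0 > 1 \<Longrightarrow> \<exists>h. (\<forall>k. h k \<ge> 0) \<and> (\<forall>z. 0 \<le> z \<and> z < s0 \<longrightarrow> (\<lambda>k. h k * z ^ k) sums f (s0 - z))"
  shows "completely_monotone f"
  unfolding completely_monotone_def by (intro allI impI assms)

lemma completely_monotone_E:
  assumes "completely_monotone f" "s0 > 1"
  obtains h where "\<And>k. h k \<ge> 0" "\<And>z. 0 \<le> z \<Longrightarrow> z < s0 \<Longrightarrow> (\<lambda>k. h k * z ^ k) sums f (s0 - z)"
proof -
  have "\<exists>h. (\<forall>k. h k \<ge> 0) \<and> (\<forall>z. 0 \<le> z \<and> z < s0 \<longrightarrow> (\<lambda>k. h k * z ^ k) sums f (s0 - z))"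
    by (rule assms(1)[unfolded completely_monotone_def, rule_format, OF assms(2)])
  then obtain h where h: "(\<forall>k. h k \<ge> 0) \<and> (\<forall>z. 0 \<le> z \<and> z < s0 \<longrightarrow> (\<lambda>k. h k * z ^ k) sums f (s0 - z))" ..
  show thesis by (rule that[of h]) (use h in \<open>simp_all\<close>)
qed

lemma completely_monotone_cong:
  assumes "\<And>s. s > 0 \<Longrightarrow> f s = g s" "completely_monotone f"
  shows "completely_monotone g"
proof (rule completely_monotone_I)
  fix s0 :: real assume "s0 > 1"
  then obtain h where
    h: "\<And>k. h k \<ge> 0" "\<And>z. 0 \<le> z \<Longrightarrow> z < s0 \<Longrightarrow> (\<lambda>k. h k * z ^ k) sums f (s0 - z)"
    by (rule completely_monotone_E[OF assms(2)]) blast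
  show "\<exists>h. (\<forall>k. h k \<ge> 0) \<and> (\<forall>z. 0 \<le> z \<and> z < s0 \<longrightarrow> (\<lambda>k. h k * z ^ k) sums g (s0 - z))"
  proof (intro exI[of _ h] conjI allI impI)
    fix z assume z: "0 \<le> z \<and> z < s0"
    show "(\<lambda>k. h k * z ^ k) sums g (s0 - z)"
      using h(2)[of z] assms(1)[of "s0 - z"] z by simp
  qed (rule h)
qed

lemma completely_monotone_scale:
  assumes "c \<ge> 0" "completely_monotone f"
  shows "completely_monotone (\<lambda>s. c * f s)"
proof (rule completely_monotone_I)
  fix s0 :: real assume s0: "s0 > 1"
  obtain h where h: "\<And>k. h k \<ge> 0" "\<And>z. 0 \<le> z \<Longrightarrow> z < s0 \<Longrightarrow> (\<lambda>k. h k * z ^ k) sums f (s0 - z)"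
    by (rule completely_monotone_E[OF assms(2) s0]) blast
  show "\<exists>h. (\<forall>k. h k \<ge> 0) \<and> (\<forall>z. 0 \<le> z \<and> z < s0 \<longrightarrow> (\<lambda>k. h k * z ^ k) sums (c * f (s0 - z)))"
  proof (intro exI[of _ "\<lambda>k. c * h k"] conjI allI impI)
    fix z assume "0 \<le> z \<and> z < s0"
    thus "(\<lambda>k. c * h k * z ^ k) sums (c * f (s0 - z))"
      unfolding mult.assoc by (intro sums_mult h) auto
  qed (use h assms(1) in simp)
qed

lemma completely_monotone_mult:
  assumes "completely_monotone f" "completely_monotone g"
  shows "completely_monotone (\<lambda>s. f s * g s)"
proof (rule completely_monotone_I)
  fix s0 :: real assume s0: "s0 > 1"
  obtain h where h: "\<And>k. h k \<ge> 0" "\<And>z. 0 \<le> z \<Longrightarrow> z < s0 \<Longrightarrow> (\<lambda>k. h k * z ^ k) sums f (s0 - z)"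
    by (rule completely_monotone_E[OF assms(1) s0]) blast
  obtain l where l: "\<And>k. l k \<ge> 0" "\<And>z. 0 \<le> z \<Longrightarrow> z < s0 \<Longrightarrow> (\<lambda>k. l k * z ^ k) sums g (s0 - z)"
    by (rule completely_monotone_E[OF assms(2) s0]) blast
  show "\<exists>h. (\<forall>k. h k \<ge> 0) \<and> (\<forall>z. 0 \<le> z \<and> z < s0 \<longrightarrow> (\<lambda>k. h k * z ^ k) sums (f (s0 - z) * g (s0 - z)))"
  proof (intro exI[of _ "\<lambda>k. \<Sum>i\<le>k. h i * l (k - i)"] conjI allI impI)
    show "(\<Sum>i\<le>k. h i * l (k - i)) \<ge> 0" for k using h l by (intro sum_nonneg) auto
    fix z assume z: "0 \<le> z \<and> z < s0"
    have "(\<lambda>k. \<Sum>i\<le>k. (h i * z ^ i) * (l (k - i) * z ^ (k - i))) sums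
            ((\<Sum>k. h k * z ^ k) * (\<Sum>k. l k * z ^ k))"
      using h l z by (intro Cauchy_product_sums) (auto simp: abs_mult sums_iff)
    moreover have "(\<Sum>i\<le>k. (h i * z ^ i) * (l (k - i) * z ^ (k - i))) = (\<Sum>i\<le>k. h i * l (k - i)) * z ^ k" for k
      unfolding sum_distrib_right
    proof (rule sum.cong)
      fix i assume "i \<in> {..k}"
      hence "z ^ k = z ^ i * z ^ (k - i)" by (simp flip: power_add)
      thus "(h i * z ^ i) * (l (k - i) * z ^ (k - i)) = h i * l (k - i) * z ^ k" by simp
    qed auto
    ultimately show "(\<lambda>k. (\<Sum>i\<le>k. h i * l (k - i)) * z ^ k) sums (f (s0 - z) * g (s0 - z))"
      using h(2)[of z] l(2)[of z] z by (simp add: sums_iff)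
  qed
qed

lemma neg_powr_binomial:
  fixes x z b :: real
  assumes "0 \<le> z" "z < x"
  shows "(\<lambda>n. (pochhammer b n / fact n * x powr (- b - real n)) * z ^ n) sums (x - z) powr (- b)"
proof -
  have "(\<lambda>n. (- b gchoose n) * x powr (- b - real n) * (- z) ^ n) sums (x + (- z)) powr (- b)"
    by (rule gen_binomial_real'') (use assms in auto)
  moreover have "(- b gchoose n) * x powr (- b - real n) * (- z) ^ n =
                   (pochhammer b n / fact n * x powr (- b - real n)) * z ^ n" for n
    by (subst power_minus[of z]) (simp add: gbinomial_pochhammer)
  ultimately show ?thesis by simp
qed

lemma pochhammer_real_nonneg: "(b::real) \<ge> 0 \<Longrightarrow> pochhammer b n \<ge> 0"
  unfolding pochhammer_prod by (intro prod_nonneg) auto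

lemma completely_monotone_powr_neg:
  assumes "b \<ge> 0"
  shows "completely_monotone (\<lambda>s. s powr (- b))"
proof (rule completely_monotone_I)
  fix s0 :: real assume "s0 > 1"
  show "\<exists>h. (\<forall>k. h k \<ge> 0) \<and> (\<forall>z. 0 \<le> z \<and> z < s0 \<longrightarrow> (\<lambda>k. h k * z ^ k) sums ((s0 - z) powr (- b)))"
  proof (intro exI[of _ "\<lambda>n. pochhammer b n / fact n * s0 powr (- b - real n)"] conjI allI impI)
    show "0 \<le> pochhammer b n / fact n * s0 powr (- b - real n)" for n
      using pochhammer_real_nonneg[OF assms] by simp
  qed (rule neg_powr_binomial, simp_all)
qed

lemma completely_monotone_one_plus_powr_neg:
  assumes "b \<ge> 0"
  shows "completely_monotone (\<lambda>s. (1 + s) powr (- b))"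
proof (rule completely_monotone_I)
  fix s0 :: real assume s0: "s0 > 1"
  show "\<exists>h. (\<forall>k. h k \<ge> 0) \<and> (\<forall>z. 0 \<le> z \<and> z < s0 \<longrightarrow> (\<lambda>k. h k * z ^ k) sums ((1 + (s0 - z)) powr (- b)))"
  proof (intro exI[of _ "\<lambda>n. pochhammer b n / fact n * (1 + s0) powr (- b - real n)"] conjI allI impI)
    show "0 \<le> pochhammer b n / fact n * (1 + s0) powr (- b - real n)" for n
      using pochhammer_real_nonneg[OF assms] by simp
    fix z assume "0 \<le> z \<and> z < s0"
    thus "(\<lambda>n. pochhammer b n / fact n * (1 + s0) powr (- b - real n) * z ^ n) sums (1 + (s0 - z)) powr (- b)"
      unfolding add_diff_eq by (intro neg_powr_binomial) auto
  qed
qed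

lemma suminf_swap_ennreal:
  fixes f :: "nat \<Rightarrow> nat \<Rightarrow> ennreal"
  shows "(\<Sum>i. \<Sum>j. f i j) = (\<Sum>j. \<Sum>i. f i j)"
proof -
  have "(\<Sum>i. \<Sum>j. f i j) = (\<integral>\<^sup>+i. (\<Sum>j. f i j) \<partial>count_space UNIV)"
    by (rule nn_integral_count_space_nat [symmetric])
  also have "\<dots> = (\<Sum>j. \<integral>\<^sup>+i. f i j \<partial>count_space UNIV)"
    by (rule nn_integral_suminf) auto
  finally show ?thesis by (simp add: nn_integral_count_space_nat)
qed

text \<open>
  Tonelli's theorem for double series. The collected coefficients are finite since
  the sum is finite at the one point \<open>w > 0\<close>.
\<close>

lemma suminf_power_series_collect:
  fixes P :: "nat \<Rightarrow> nat \<Rightarrow> real"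
  assumes P: "\<And>j k. P j k \<ge> 0"
    and w: "0 < w" "w < r"
    and in1: "\<And>j z. 0 \<le> z \<Longrightarrow> z < r \<Longrightarrow> (\<lambda>k. P j k * z ^ k) sums y j z"
    and out: "\<And>z. 0 \<le> z \<Longrightarrow> z < r \<Longrightarrow> (\<lambda>j. y j z) sums S z"
  shows "\<exists>c. (\<forall>k. c k \<ge> 0) \<and> (\<forall>z. 0 \<le> z \<and> z < r \<longrightarrow> (\<lambda>k. c k * z ^ k) sums S z)"
proof -
  define C where "C = (\<lambda>k. \<Sum>j. ennreal (P j k))"
  have C: "(\<Sum>k. C k * ennreal (z ^ k)) = ennreal (S z)" and S0: "S z \<ge> 0" if z: "0 \<le> z" "z < r" for z
  proof -
    have y0: "y j z \<ge> 0" for j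
      using in1[OF z, of j] P z by (intro sums_le[OF _ sums_zero in1[OF z]]) auto
    have "(\<Sum>k. C k * ennreal (z ^ k)) = (\<Sum>k. \<Sum>j. ennreal (P j k * z ^ k))"
      unfolding C_def using P z by (simp add: ennreal_mult)
    also have "\<dots> = (\<Sum>j. \<Sum>k. ennreal (P j k * z ^ k))" by (rule suminf_swap_ennreal)
    also have "\<dots> = (\<Sum>j. ennreal (y j z))"
      using P z in1[OF z] by (intro suminf_cong suminf_ennreal_eq) auto
    also have "\<dots> = ennreal (S z)" using y0 out[OF z] by (intro suminf_ennreal_eq) auto
    finally show "(\<Sum>k. C k * ennreal (z ^ k)) = ennreal (S z)" .
    show "S z \<ge> 0" using y0 by (intro sums_le[OF _ sums_zero out[OF z]]) auto
  qed
  have fin: "C k \<noteq> top" for k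
  proof
    assume "C k = top"
    hence "C k * ennreal (w ^ k) = top" using w by (simp add: ennreal_top_mult ennreal_eq_0_iff not_le)
    moreover have "C k * ennreal (w ^ k) \<le> (\<Sum>k. C k * ennreal (w ^ k))"
      by (rule sum_le_suminf[of _ "{k}", simplified]) auto
    ultimately show False using C[of w] w by (simp add: top_unique)
  qed
  show ?thesis
  proof (intro exI[of _ "\<lambda>k. enn2real (C k)"] conjI allI impI)
    fix z assume z: "0 \<le> z \<and> z < r"
    have "(\<Sum>k. ennreal (enn2real (C k) * z ^ k)) = ennreal (S z)"
      using C[of z] z fin by (simp add: ennreal_mult less_top)
    moreover have "(\<lambda>k. ennreal (enn2real (C k) * z ^ k)) sums (\<Sum>k. ennreal (enn2real (C k) * z ^ k))"
      by (intro summable_sums) auto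
    ultimately have "(\<lambda>k. ennreal (enn2real (C k) * z ^ k)) sums ennreal (S z)" by simp
    thus "(\<lambda>k. enn2real (C k) * z ^ k) sums S z"
      by (rule sums_ennreal[THEN iffD1, rotated -1]) (use z S0 in auto)
  qed auto
qed

text \<open>
  One sequence of coefficients of the power has to serve for all arguments, which is why the argument is
  quantified inside the existential statement.
\<close>

lemma power_series_power:
  fixes p :: "nat \<Rightarrow> real"
  assumes p: "\<And>k. p k \<ge> 0"
  shows "\<exists>P. (\<forall>k. P k \<ge> 0) \<and>
           (\<forall>z y. z \<ge> 0 \<longrightarrow> (\<lambda>k. p k * z ^ k) sums y \<longrightarrow> (\<lambda>k. P k * z ^ k) sums y ^ j)"
proof (induction j)
  case 0
  have "(\<lambda>k. (if k = 0 then 1 else 0) * z ^ k) sums 1" for z :: real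
    using sums_If_finite_set'[of "\<lambda>_. 0" 0 "{0::nat}" 1 "\<lambda>_. 1"]
      powser_sums_zero_iff[of "\<lambda>k. if k = 0 then 1 else 0"] sums_If_finite_set[of "{0::nat}" "\<lambda>k. z ^ k"]
    by (simp add: if_distrib if_distribR cong: if_cong)
  thus ?case by (intro exI[of _ "\<lambda>k. if k = 0 then 1 else 0"]) auto
next
  case (Suc j)
  then obtain P where P: "\<And>k. P k \<ge> 0"
    "\<And>z y. z \<ge> 0 \<Longrightarrow> (\<lambda>k. p k * z ^ k) sums y \<Longrightarrow> (\<lambda>k. P k * z ^ k) sums y ^ j" by blast
  show ?case
  proof (intro exI[of _ "\<lambda>k. \<Sum>i\<le>k. p i * P (k - i)"] conjI allI impI)
    show "(\<Sum>i\<le>k. p i * P (k - i)) \<ge> 0" for k using p P by (intro sum_nonneg) auto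
    fix z y :: real assume z: "z \<ge> 0" and y: "(\<lambda>k. p k * z ^ k) sums y"
    note Py = P(2)[OF z y]
    have "(\<lambda>k. \<Sum>i\<le>k. (p i * z ^ i) * (P (k - i) * z ^ (k - i))) sums
            ((\<Sum>k. p k * z ^ k) * (\<Sum>k. P k * z ^ k))"
      using p P(1) z y Py by (intro Cauchy_product_sums) (auto simp: abs_mult sums_iff)
    moreover have "(\<Sum>i\<le>k. (p i * z ^ i) * (P (k - i) * z ^ (k - i))) = (\<Sum>i\<le>k. p i * P (k - i)) * z ^ k" for k
      unfolding sum_distrib_right
    proof (rule sum.cong)
      fix i assume "i \<in> {..k}"
      hence "z ^ k = z ^ i * z ^ (k - i)" by (simp flip: power_add)
      thus "(p i * z ^ i) * (P (k - i) * z ^ (k - i)) = p i * P (k - i) * z ^ k" by simp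
    qed auto
    ultimately show "(\<lambda>k. (\<Sum>i\<le>k. p i * P (k - i)) * z ^ k) sums (y ^ Suc j)"
      using y Py by (simp add: sums_iff)
  qed
qed

text \<open>
  The reason is that \<open>s powr \<alpha>\<close> is a Bernstein function: \<open>s0 powr \<alpha> - (s0 - z) powr \<alpha>\<close> is a power series in \<open>z\<close> with
  non-negative coefficients, and it is substituted into the series of \<open>f\<close> at \<open>s0 powr \<alpha>\<close>.
\<close>

lemma completely_monotone_compose_powr:
  assumes f: "completely_monotone f" and \<alpha>: "0 < \<alpha>" "\<alpha> \<le> 1"
  shows "completely_monotone (\<lambda>s. f (s powr \<alpha>))"
proof (rule completely_monotone_I)
  fix s0 :: real assume s0: "s0 > 1"
  define S where "S = s0 powr \<alpha>"
  have S: "S > 1" unfolding S_def using s0 \<alpha> by simp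
  obtain h where h: "\<And>k. h k \<ge> 0" "\<And>z. 0 \<le> z \<Longrightarrow> z < S \<Longrightarrow> (\<lambda>k. h k * z ^ k) sums f (S - z)"
    by (rule completely_monotone_E[OF f S]) blast
  define p where "p = (\<lambda>k. if k = 0 then 0 else - (pochhammer (- \<alpha>) k / fact k * s0 powr (\<alpha> - real k)))"
  have p: "p k \<ge> 0" for k
  proof (cases k)
    case (Suc n)
    have "pochhammer (- \<alpha>) (Suc n) = (- \<alpha>) * pochhammer (1 - \<alpha>) n"
      by (simp add: pochhammer_rec)
    also have "\<dots> \<le> 0" using \<alpha> by (intro mult_nonpos_nonneg pochhammer_real_nonneg) auto
    finally have "pochhammer (- \<alpha>) (Suc n) / fact (Suc n) \<le> 0" by (intro divide_nonpos_pos) auto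
    hence "pochhammer (- \<alpha>) (Suc n) / fact (Suc n) * s0 powr (\<alpha> - real (Suc n)) \<le> 0"
      by (intro mult_nonpos_nonneg) auto
    thus ?thesis unfolding p_def Suc by (simp only: if_False neg_0_le_iff_le nat.distinct)
  qed (simp add: p_def)
  have y: "(\<lambda>k. p k * z ^ k) sums (S - (s0 - z) powr \<alpha>)" if z: "0 \<le> z" "z < s0" for z
  proof -
    have "(\<lambda>n. (pochhammer (- \<alpha>) n / fact n * s0 powr (\<alpha> - real n)) * z ^ n) sums (s0 - z) powr \<alpha>"
      using neg_powr_binomial[OF z, of "- \<alpha>"] by simp
    hence "(\<lambda>n. (if n = 0 then S else 0) - (pochhammer (- \<alpha>) n / fact n * s0 powr (\<alpha> - real n)) * z ^ n) sums
              (S - (s0 - z) powr \<alpha>)"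
      by (intro sums_diff) (use sums_If_finite_set[of "{0::nat}" "\<lambda>_. S"] in simp)
    moreover have "(if n = 0 then S else 0) - (pochhammer (- \<alpha>) n / fact n * s0 powr (\<alpha> - real n)) * z ^ n = p n * z ^ n" for n
      by (simp add: p_def S_def)
    ultimately show ?thesis by simp
  qed
  have "\<forall>j. \<exists>P. (\<forall>k. P k \<ge> 0) \<and>
           (\<forall>z y. z \<ge> 0 \<longrightarrow> (\<lambda>k. p k * z ^ k) sums y \<longrightarrow> (\<lambda>k. P k * z ^ k) sums y ^ j)"
    by (intro allI power_series_power p)
  from choice[OF this] obtain P where PP: "\<forall>j. (\<forall>k. P j k \<ge> 0) \<and>
      (\<forall>z y. z \<ge> 0 \<longrightarrow> (\<lambda>k. p k * z ^ k) sums y \<longrightarrow> (\<lambda>k. P j k * z ^ k) sums y ^ j)" ..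
  have P: "P j k \<ge> 0" "z \<ge> 0 \<Longrightarrow> (\<lambda>k. p k * z ^ k) sums y \<Longrightarrow> (\<lambda>k. P j k * z ^ k) sums y ^ j" for j k z y
    using PP by simp_all
  show "\<exists>c. (\<forall>k. c k \<ge> 0) \<and> (\<forall>z. 0 \<le> z \<and> z < s0 \<longrightarrow> (\<lambda>k. c k * z ^ k) sums f ((s0 - z) powr \<alpha>))"
  proof (rule suminf_power_series_collect[where w = 1 and P = "\<lambda>j k. h j * P j k" and
           y = "\<lambda>j z. h j * (S - (s0 - z) powr \<alpha>) ^ j"])
    fix j z assume z: "0 \<le> z" "z < s0"
    show "(\<lambda>k. h j * P j k * z ^ k) sums (h j * (S - (s0 - z) powr \<alpha>) ^ j)"
      unfolding mult.assoc by (intro sums_mult P z y)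
  next
    fix z assume z: "0 \<le> z" "z < s0"
    have "(s0 - z) powr \<alpha> \<le> S" unfolding S_def using z \<alpha> by (intro powr_mono2) auto
    moreover have "(s0 - z) powr \<alpha> > 0" using z by simp
    ultimately show "(\<lambda>j. h j * (S - (s0 - z) powr \<alpha>) ^ j) sums f ((s0 - z) powr \<alpha>)"
      using h(2)[of "S - (s0 - z) powr \<alpha>"] by simp
  qed (use h P s0 in auto)
qed

lemma completely_monotone_antimono:
  assumes f: "completely_monotone f" and s: "0 < s" "s \<le> s'"
  shows "f s' \<le> f s"
proof -
  obtain h where h: "\<And>k. h k \<ge> 0" "\<And>z. 0 \<le> z \<Longrightarrow> z < s' + 1 \<Longrightarrow> (\<lambda>k. h k * z ^ k) sums f (s' + 1 - z)"
    by (rule completely_monotone_E[OF f, of "s' + 1"]) (use s in auto)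
  have "(\<lambda>k. h k * 1 ^ k) sums f s'" using h(2)[of 1] s by simp
  moreover have "(\<lambda>k. h k * (s' + 1 - s) ^ k) sums f s" using h(2)[of "s' + 1 - s"] s by simp
  ultimately show ?thesis
  proof (rule sums_le[rotated])
    show "h k * 1 ^ k \<le> h k * (s' + 1 - s) ^ k" for k
      using h(1)[of k] s by (intro mult_left_mono power_mono) auto
  qed
qed


section \<open>Laplace integrals\<close>

definition laplace :: "(real \<Rightarrow> ennreal) \<Rightarrow> real \<Rightarrow> ennreal" where
  "laplace H s = (\<integral>\<^sup>+x. ennreal (exp (- (s * x))) * H x \<partial>lborel)"

lemma laplace_expand:
  assumes [measurable]: "H \<in> borel_measurable borel" and supp: "\<And>x. x \<le> 0 \<Longrightarrow> H x = 0" and z: "z \<ge> 0"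
  shows "laplace H (s - z) = (\<Sum>k. (\<integral>\<^sup>+x. ennreal (x ^ k / fact k * exp (- (s * x))) * H x \<partial>lborel) * ennreal (z ^ k))"
proof -
  have "ennreal (exp (- ((s - z) * x))) * H x =
          (\<Sum>k. ennreal (x ^ k / fact k * exp (- (s * x))) * H x * ennreal (z ^ k))" for x
  proof (cases "x > 0")
    case True
    have "(\<lambda>k. (z * x) ^ k / fact k) sums exp (z * x)"
      using exp_converges[of "z * x"] by (simp add: field_simps)
    from sums_mult2[OF this, of "exp (- (s * x))"]
    have "(\<lambda>k. (z * x) ^ k / fact k * exp (- (s * x))) sums exp (- ((s - z) * x))"
      by (simp add: algebra_simps flip: exp_add)
    hence "ennreal (exp (- ((s - z) * x))) = (\<Sum>k. ennreal ((z * x) ^ k / fact k * exp (- (s * x))))"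
      using z True by (intro suminf_ennreal_eq [symmetric]) auto
    also have "\<dots> * H x = (\<Sum>k. ennreal ((z * x) ^ k / fact k * exp (- (s * x))) * H x)" by simp
    also have "\<dots> = (\<Sum>k. ennreal (x ^ k / fact k * exp (- (s * x))) * H x * ennreal (z ^ k))"
    proof (rule suminf_cong)
      fix k
      have "ennreal ((z * x) ^ k / fact k * exp (- (s * x))) =
              ennreal (x ^ k / fact k * exp (- (s * x))) * ennreal (z ^ k)"
        using z True by (subst ennreal_mult [symmetric]) (auto simp: power_mult_distrib field_simps)
      thus "ennreal ((z * x) ^ k / fact k * exp (- (s * x))) * H x =
              ennreal (x ^ k / fact k * exp (- (s * x))) * H x * ennreal (z ^ k)"
        by (simp only: mult_ac)
    qed
    finally show ?thesis .
  qed (auto simp: supp)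
  hence "laplace H (s - z) =
      (\<integral>\<^sup>+x. (\<Sum>k. ennreal (x ^ k / fact k * exp (- (s * x))) * H x * ennreal (z ^ k)) \<partial>lborel)"
    unfolding laplace_def by (intro nn_integral_cong) auto
  also have "\<dots> = (\<Sum>k. \<integral>\<^sup>+x. ennreal (x ^ k / fact k * exp (- (s * x))) * H x * ennreal (z ^ k) \<partial>lborel)"
    by (rule nn_integral_suminf) auto
  finally show ?thesis by (simp add: nn_integral_multc)
qed

text \<open>
  The coefficients are the moments of the measure \<open>exp (- s0 x) H x dx\<close>, divided by factorials. The last clause holds
  for all \<open>z \<ge> 0\<close>, with both sides possibly infinite: once convergence of the series is known in
  a larger disc, it carries over to the integral.
\<close>

lemma laplace_power_series:
  assumes [measurable]: "H \<in> borel_measurable borel" and supp: "\<And>x. x \<le> 0 \<Longrightarrow> H x = 0"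
    and f: "\<And>s. s > \<sigma> \<Longrightarrow> laplace H s = ennreal (f s)" "\<And>s. s > \<sigma> \<Longrightarrow> f s \<ge> 0" and s0: "s0 > \<sigma>"
  shows "\<exists>h. (\<forall>k. h k \<ge> 0) \<and> (\<forall>z. 0 \<le> z \<and> z < s0 - \<sigma> \<longrightarrow> (\<lambda>k. h k * z ^ k) sums f (s0 - z)) \<and>
           (\<forall>z\<ge>0. laplace H (s0 - z) = (\<Sum>k. ennreal (h k * z ^ k)))"
proof -
  define C where "C = (\<lambda>k. \<integral>\<^sup>+x. ennreal (x ^ k / fact k * exp (- (s0 * x))) * H x \<partial>lborel)"
  have C: "laplace H (s0 - z) = (\<Sum>k. C k * ennreal (z ^ k))" if "z \<ge> 0" for z
    unfolding C_def by (rule laplace_expand) (use that supp in auto)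
  define w where "w = (s0 - \<sigma>) / 2"
  have w: "w > 0" "s0 - w > \<sigma>" using s0 by (auto simp: w_def field_simps)
  have fin: "C k \<noteq> top" for k
  proof
    assume "C k = top"
    hence "C k * ennreal (w ^ k) = top" using w by (simp add: ennreal_top_mult ennreal_eq_0_iff not_le)
    moreover have "C k * ennreal (w ^ k) \<le> (\<Sum>k. C k * ennreal (w ^ k))"
      by (rule sum_le_suminf[of _ "{k}", simplified]) auto
    ultimately show False using C[of w] f(1)[OF w(2)] w by (simp add: top_unique)
  qed
  have C': "(\<Sum>k. ennreal (enn2real (C k) * z ^ k)) = laplace H (s0 - z)" if "z \<ge> 0" for z
    using C[OF that] fin that by (simp add: ennreal_mult less_top)
  show ?thesis
  proof (intro exI[of _ "\<lambda>k. enn2real (C k)"] conjI allI impI)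
    fix z assume z: "0 \<le> z \<and> z < s0 - \<sigma>"
    have pos: "0 \<le> z" "s0 - z > \<sigma>" using z by auto
    have "(\<Sum>k. ennreal (enn2real (C k) * z ^ k)) = ennreal (f (s0 - z))"
      by (rule trans[OF C'[OF pos(1)] f(1)[OF pos(2)]])
    moreover have "(\<lambda>k. ennreal (enn2real (C k) * z ^ k)) sums (\<Sum>k. ennreal (enn2real (C k) * z ^ k))"
      by (intro summable_sums summableI)
    ultimately have "(\<lambda>k. ennreal (enn2real (C k) * z ^ k)) sums ennreal (f (s0 - z))" by (simp only:)
    thus "(\<lambda>k. enn2real (C k) * z ^ k) sums f (s0 - z)"
      using pos(1) f(2)[OF pos(2)] by (subst (asm) sums_ennreal) simp_all
  next
    show "laplace H (s0 - z) = (\<Sum>k. ennreal (enn2real (C k) * z ^ k))" if "z \<ge> 0" for z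
      by (rule C'[OF that, symmetric])
  qed simp
qed

lemma completely_monotone_laplace:
  assumes "H \<in> borel_measurable borel" and "\<And>x. x \<le> 0 \<Longrightarrow> H x = 0"
    and "\<And>s. s > 0 \<Longrightarrow> laplace H s = ennreal (f s)" "\<And>s. s > 0 \<Longrightarrow> f s \<ge> 0"
  shows "completely_monotone f"
proof (rule completely_monotone_I)
  fix s0 :: real assume s0: "s0 > 1"
  have "\<exists>h. (\<forall>k. h k \<ge> 0) \<and> (\<forall>z. 0 \<le> z \<and> z < s0 - 0 \<longrightarrow> (\<lambda>k. h k * z ^ k) sums f (s0 - z)) \<and>
           (\<forall>z\<ge>0. laplace H (s0 - z) = (\<Sum>k. ennreal (h k * z ^ k)))"
    by (rule laplace_power_series) (use assms s0 in simp_all)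
  then obtain h where "(\<forall>k. h k \<ge> 0) \<and> (\<forall>z. 0 \<le> z \<and> z < s0 - 0 \<longrightarrow> (\<lambda>k. h k * z ^ k) sums f (s0 - z)) \<and>
           (\<forall>z\<ge>0. laplace H (s0 - z) = (\<Sum>k. ennreal (h k * z ^ k)))" ..
  thus "\<exists>h. (\<forall>k. h k \<ge> 0) \<and> (\<forall>z. 0 \<le> z \<and> z < s0 \<longrightarrow> (\<lambda>k. h k * z ^ k) sums f (s0 - z))"
    by (intro exI[of _ h]) simp
qed

lemma has_bochner_integral_Gamma:
  assumes p: "p > 0" and s: "s > 0"
  shows "has_bochner_integral lborel (\<lambda>x. indicator {0<..} x * (x powr (p - 1) * exp (- (s * x)))) (Gamma p * s powr (- p) :: real)"
proof (rule has_bochner_integral_nn_integral)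
  have "ennreal (Gamma p) = (\<integral>\<^sup>+t. ennreal (indicator {0..} t * t powr (p - 1) / exp t) \<partial>lborel)"
    by (rule Gamma_conv_nn_integral_real[OF p])
  also have "\<dots> = ennreal \<bar>s\<bar> * (\<integral>\<^sup>+x. ennreal (indicator {0..} (0 + s * x) * (0 + s * x) powr (p - 1) / exp (0 + s * x)) \<partial>lborel)"
    by (rule nn_integral_real_affine) (use s in auto)
  also have "(\<integral>\<^sup>+x. ennreal (indicator {0..} (0 + s * x) * (0 + s * x) powr (p - 1) / exp (0 + s * x)) \<partial>lborel) =
      (\<integral>\<^sup>+x. ennreal (s powr (p - 1)) * ennreal (indicator {0<..} x * (x powr (p - 1) * exp (- (s * x)))) \<partial>lborel)"
  proof (intro nn_integral_cong)
    fix x :: real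
    have "indicator {0..} (0 + s * x) * (0 + s * x) powr (p - 1) / exp (0 + s * x) =
            s powr (p - 1) * (indicator {0<..} x * (x powr (p - 1) * exp (- (s * x))))"
      using s by (cases "x > 0") (auto simp: indicator_def powr_mult exp_minus field_simps zero_le_mult_iff)
    thus "ennreal (indicator {0..} (0 + s * x) * (0 + s * x) powr (p - 1) / exp (0 + s * x)) =
        ennreal (s powr (p - 1)) * ennreal (indicator {0<..} x * (x powr (p - 1) * exp (- (s * x))))"
      by (simp only: ennreal_mult' powr_ge_zero)
  qed
  also have "\<dots> = ennreal (s powr (p - 1)) * (\<integral>\<^sup>+x. ennreal (indicator {0<..} x * (x powr (p - 1) * exp (- (s * x)))) \<partial>lborel)"
    by (rule nn_integral_cmult) auto
  finally have eq: "ennreal (Gamma p) = ennreal (s powr p) * (\<integral>\<^sup>+x. ennreal (indicator {0<..} x * (x powr (p - 1) * exp (- (s * x)))) \<partial>lborel)"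
    using s by (simp add: mult.assoc [symmetric] powr_diff flip: ennreal_mult)
  have "ennreal (Gamma p * s powr (- p)) = ennreal (s powr (- p)) * ennreal (Gamma p)"
    using p by (subst ennreal_mult [symmetric]) (auto simp: mult_ac)
  also have "\<dots> = (\<integral>\<^sup>+x. ennreal (indicator {0<..} x * (x powr (p - 1) * exp (- (s * x)))) \<partial>lborel)"
    unfolding eq using s by (simp add: mult.assoc [symmetric] flip: ennreal_mult powr_add)
  finally show "(\<integral>\<^sup>+x. ennreal (indicator {0<..} x * (x powr (p - 1) * exp (- (s * x)))) \<partial>lborel) =
      ennreal (Gamma p * s powr (- p))" ..
qed (use p s in \<open>auto simp: indicator_def\<close>)

text \<open>
  The analogue for densities without a sign, under absolute convergence.
\<close>

lemma exponential_moment_series: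
  fixes F :: "real \<Rightarrow> real"
  assumes [measurable]: "F \<in> borel_measurable borel" and supp: "\<And>x. x \<le> 0 \<Longrightarrow> F x = 0" and z: "z \<ge> 0"
    and int: "integrable lborel (\<lambda>x. exp (- ((s - z) * x)) * F x)"
  shows "(\<lambda>k. (\<integral>x. x ^ k / fact k * exp (- (s * x)) * F x \<partial>lborel) * z ^ k) sums (\<integral>x. exp (- ((s - z) * x)) * F x \<partial>lborel)"
proof -
  define f where "f = (\<lambda>k x. (z * x) ^ k / fact k * exp (- (s * x)) * F x)"
  have [measurable]: "f k \<in> borel_measurable borel" for k unfolding f_def by measurable
  have sums: "(\<lambda>k. f k x) sums (exp (- ((s - z) * x)) * F x)"
       "(\<lambda>k. norm (f k x)) sums norm (exp (- ((s - z) * x)) * F x)" for x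
  proof -
    have *: "(\<lambda>k. (z * x) ^ k / fact k * exp (- (s * x))) sums exp (- ((s - z) * x))"
    proof -
      have "(\<lambda>k. (z * x) ^ k / fact k) sums exp (z * x)"
        using exp_converges[of "z * x"] by (simp add: field_simps)
      from sums_mult2[OF this, of "exp (- (s * x))"] show ?thesis
        by (simp add: algebra_simps flip: exp_add)
    qed
    show "(\<lambda>k. f k x) sums (exp (- ((s - z) * x)) * F x)" unfolding f_def by (rule sums_mult2[OF *])
    show "(\<lambda>k. norm (f k x)) sums norm (exp (- ((s - z) * x)) * F x)"
    proof (cases "x \<ge> 0")
      case True
      thus ?thesis using sums_mult2[OF *, of "norm (F x)"] z by (simp add: f_def norm_mult abs_mult)
    qed (simp add: supp f_def)
  qed
  have bound: "(\<Sum>k\<in>A. norm (f k x)) \<le> norm (exp (- ((s - z) * x)) * F x)" if "finite A" for A x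
    using sum_le_suminf[OF sums_summable[OF sums(2)[of x]] that] sums_unique[OF sums(2)[of x]] by auto
  have int_f: "integrable lborel (f k)" for k
    by (rule Bochner_Integration.integrable_bound[OF int]) (use bound[of "{k}"] in auto)
  have "(\<lambda>k. integral\<^sup>L lborel (f k)) sums (\<integral>x. (\<Sum>k. f k x) \<partial>lborel)"
  proof (rule sums_integral)
    show "AE x in lborel. summable (\<lambda>k. norm (f k x))" using sums(2) by (auto simp: sums_iff)
    show "summable (\<lambda>k. \<integral>x. norm (f k x) \<partial>lborel)"
    proof (rule summableI_nonneg_bounded)
      fix n
      have "(\<Sum>k<n. \<integral>x. norm (f k x) \<partial>lborel) = (\<integral>x. (\<Sum>k<n. norm (f k x)) \<partial>lborel)"
        using int_f by (intro Bochner_Integration.integral_sum [symmetric]) auto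
      also have "\<dots> \<le> (\<integral>x. norm (exp (- ((s - z) * x)) * F x) \<partial>lborel)"
        using int_f int bound by (intro integral_mono) (auto simp del: real_norm_def)
      finally show "(\<Sum>k<n. \<integral>x. norm (f k x) \<partial>lborel) \<le> (\<integral>x. norm (exp (- ((s - z) * x)) * F x) \<partial>lborel)" .
    qed auto
  qed (rule int_f)
  moreover have "integral\<^sup>L lborel (f k) = (\<integral>x. x ^ k / fact k * exp (- (s * x)) * F x \<partial>lborel) * z ^ k" for k
    unfolding f_def
    by (subst Bochner_Integration.integral_mult_left_zero [symmetric]) (simp add: power_mult_distrib mult_ac)
  ultimately show ?thesis using sums_unique[OF sums(1)] by simp
qed

text \<open>
  The moment kernel \<open>x ^ k * exp (- k x / a)\<close> is, up to a factor, the \<open>k\<close>-th power of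
  \<open>x / a * exp (1 - x / a)\<close>, which has a strict maximum at \<open>a\<close>. For large \<open>k\<close> its mass concentrates at \<open>a\<close>,
  so a negative value of \<open>F\<close> at \<open>a\<close> would make a moment negative.
\<close>

lemma post_widder_nonneg:
  fixes F :: "real \<Rightarrow> real"
  assumes [measurable]: "F \<in> borel_measurable borel" and supp: "\<And>x. x \<le> 0 \<Longrightarrow> F x = 0"
    and int: "\<And>k s. s > 1 \<Longrightarrow> integrable lborel (\<lambda>x. x ^ k * exp (- (s * x)) * F x)"
    and nonneg: "\<And>k s. s > 1 \<Longrightarrow> (\<integral>x. x ^ k * exp (- (s * x)) * F x \<partial>lborel) \<ge> 0"
    and cont: "isCont F a" and a: "a > 0"
  shows "F a \<ge> 0"
proof (rule ccontr)
  assume "\<not> F a \<ge> 0"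
  define \<eta> where "\<eta> = - F a / 2"
  have \<eta>: "\<eta> > 0" using \<open>\<not> F a \<ge> 0\<close> by (simp add: \<eta>_def)
  have "eventually (\<lambda>x. F x < - \<eta>) (at a)"
    using cont \<eta> unfolding isCont_def by (intro order_tendstoD(2)[of F "F a"]) (auto simp: \<eta>_def)
  then obtain d0 where d0: "d0 > 0" "\<And>x. x \<noteq> a \<Longrightarrow> dist x a < d0 \<Longrightarrow> F x < - \<eta>"
    unfolding eventually_at by auto
  have d0': "F x < - \<eta>" if "\<bar>x - a\<bar> < d0" for x
    using d0(2)[of x] that \<eta> by (cases "x = a") (auto simp: dist_real_def \<eta>_def)
  define d where "d = min d0 a / 2"
  have d: "d > 0" "d < d0" "d < a" using d0 a by (auto simp: d_def)
  define \<phi> where "\<phi> = (\<lambda>x::real. x / a * exp (1 - x / a))"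
  have \<phi>_der: "(\<phi> has_real_derivative ((1 - x / a) * exp (1 - x / a) / a)) (at x)" for x
    unfolding \<phi>_def using a by (auto intro!: derivative_eq_intros simp: field_simps)
  have \<phi>_cont: "continuous_on A \<phi>" for A
    unfolding \<phi>_def using a by (intro continuous_intros) auto
  have \<phi>_inc: "\<phi> x < \<phi> y" if "x < y" "y \<le> a" for x y
  proof (rule DERIV_pos_imp_increasing_open[OF that(1)])
    fix t assume "x < t" "t < y"
    thus "\<exists>D. (\<phi> has_real_derivative D) (at t) \<and> D > 0"
      using \<phi>_der[of t] that a by (intro exI[of _ "(1 - t / a) * exp (1 - t / a) / a"]) auto
  qed (rule \<phi>_cont)
  have \<phi>_dec: "\<phi> y < \<phi> x" if "x < y" "a \<le> x" for x y
  proof (rule DERIV_neg_imp_decreasing_open[OF that(1)])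
    fix t assume "x < t" "t < y"
    thus "\<exists>D. (\<phi> has_real_derivative D) (at t) \<and> D < 0"
      using \<phi>_der[of t] that a
      by (intro exI[of _ "(1 - t / a) * exp (1 - t / a) / a"]) (auto simp: divide_less_0_iff mult_less_0_iff)
  qed (rule \<phi>_cont)
  have \<phi>a: "\<phi> a = 1" using a by (simp add: \<phi>_def)
  \<comment> \<open>outside the neighbourhood on which \<open>F < - \<eta>\<close>, the kernel stays below \<open>q\<close>; close to \<open>a\<close> it exceeds \<open>Q > q\<close>\<close>
  define q where "q = max (\<phi> (a - d)) (\<phi> (a + d))"
  have q: "q > 0" "q < 1"
    using \<phi>_inc[of "a - d" a] \<phi>_dec[of a "a + d"] d a \<phi>a by (auto simp: q_def \<phi>_def less_max_iff_disj)
  have \<phi>q: "\<phi> x \<le> q" if "\<bar>x - a\<bar> \<ge> d" for x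
  proof (cases "x \<le> a")
    case True
    hence "x \<le> a - d" using that d by auto
    hence "\<phi> x \<le> \<phi> (a - d)" using \<phi>_inc[of x "a - d"] d by (cases "x = a - d") auto
    thus ?thesis by (simp add: q_def)
  next
    case False
    hence "x \<ge> a + d" using that d by auto
    hence "\<phi> x \<le> \<phi> (a + d)" using \<phi>_dec[of "a + d" x] d by (cases "x = a + d") auto
    thus ?thesis by (simp add: q_def)
  qed
  have \<phi>0: "\<phi> x \<ge> 0" if "x \<ge> 0" for x using that a by (simp add: \<phi>_def)
  define Q where "Q = (1 + q) / 2"
  have Q: "Q > q" "Q < 1" "Q > 0" using q by (auto simp: Q_def)
  have "isCont \<phi> a" using \<phi>_der DERIV_isCont by blast
  hence "eventually (\<lambda>x. \<phi> x > Q) (at a)"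
    unfolding isCont_def using Q \<phi>a by (intro order_tendstoD(1)[of \<phi> "\<phi> a"]) auto
  then obtain d1 where d1: "d1 > 0" "\<And>x. x \<noteq> a \<Longrightarrow> dist x a < d1 \<Longrightarrow> \<phi> x > Q"
    unfolding eventually_at by auto
  define \<delta> where "\<delta> = min d1 d"
  have \<delta>: "\<delta> > 0" "\<delta> \<le> d" using d1 d by (auto simp: \<delta>_def)
  have \<phi>Q: "\<phi> x \<ge> Q" if "\<bar>x - a\<bar> < \<delta>" for x
    using d1(2)[of x] that Q \<phi>a by (cases "x = a") (auto simp: dist_real_def \<delta>_def)
  \<comment> \<open>\<open>k > a\<close> ensures that the exponential weight \<open>k / a\<close> lies in the range \<open>s > 1\<close> of the hypotheses\<close>
  obtain k0 :: nat where k0: "real k0 > a" using reals_Archimedean2 by blast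
  have \<phi>k: "\<phi> x ^ k * F x = (exp 1 / a) ^ k * (x ^ k * exp (- (real k / a * x)) * F x)" for k x
  proof -
    have "\<phi> x = (exp 1 / a) * (x * exp (- x / a))" by (simp add: \<phi>_def exp_diff exp_minus field_simps)
    hence "\<phi> x ^ k = (exp 1 / a) ^ k * (x ^ k * exp (- x / a) ^ k)" by (simp only: power_mult_distrib)
    also have "exp (- x / a) ^ k = exp (- (real k / a * x))" by (simp flip: exp_of_nat_mult)
    finally show ?thesis by simp
  qed
  have int\<phi>: "integrable lborel (\<lambda>x. \<phi> x ^ k * F x)" if "k \<ge> k0" for k
  proof -
    have "real k / a > 1" using that k0 a by (simp add: field_simps)
    from int[OF this, of k] show ?thesis unfolding \<phi>k by simp
  qed
  have I: "(\<integral>x. \<phi> x ^ k * F x \<partial>lborel) \<ge> 0" if "k \<ge> k0" for k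
  proof -
    have "real k / a > 1" using that k0 a by (simp add: field_simps)
    from nonneg[OF this, of k] show ?thesis unfolding \<phi>k using a by simp
  qed
  define C where "C = (\<integral>x. norm (\<phi> x ^ k0 * F x) \<partial>lborel)"
  have main: "2 * \<delta> * \<eta> * Q ^ (j + k0) \<le> q ^ j * C" for j
  proof -
    let ?I = "indicator {a - \<delta><..<a + \<delta>} :: real \<Rightarrow> real"
    have pt: "\<phi> x ^ (j + k0) * F x \<le> q ^ j * norm (\<phi> x ^ k0 * F x) - \<eta> * Q ^ (j + k0) * ?I x" for x
    proof (cases "x \<le> 0")
      case True
      thus ?thesis using supp[of x] \<delta> d by (auto simp: indicator_def)
    next
      case False
      hence \<phi>x: "\<phi> x \<ge> 0" using \<phi>0 by simp
      show ?thesis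
      proof (cases "\<bar>x - a\<bar> < d")
        case True
        hence Fx: "F x < - \<eta>" using d0'[of x] d by simp
        show ?thesis
        proof (cases "\<bar>x - a\<bar> < \<delta>")
          case True
          have "\<eta> * Q ^ (j + k0) \<le> (- F x) * \<phi> x ^ (j + k0)"
            using Fx \<eta> Q \<phi>Q[OF True] by (intro mult_mono power_mono) auto
          hence "\<phi> x ^ (j + k0) * F x \<le> - (\<eta> * Q ^ (j + k0))" by (simp add: mult_ac)
          also have "\<dots> \<le> q ^ j * norm (\<phi> x ^ k0 * F x) - \<eta> * Q ^ (j + k0) * ?I x"
            using q True by (auto simp: indicator_def)
          finally show ?thesis .
        next
          case False
          have "\<phi> x ^ (j + k0) * F x \<le> 0" using \<phi>x Fx \<eta> by (intro mult_nonneg_nonpos) auto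
          also have "0 \<le> q ^ j * norm (\<phi> x ^ k0 * F x) - \<eta> * Q ^ (j + k0) * ?I x"
            using q False by (auto simp: indicator_def)
          finally show ?thesis .
        qed
      next
        case False
        have "\<phi> x ^ (j + k0) * F x \<le> \<phi> x ^ j * norm (\<phi> x ^ k0 * F x)"
          using \<phi>x by (simp add: power_add abs_mult mult.assoc mult_left_mono)
        also have "\<dots> \<le> q ^ j * norm (\<phi> x ^ k0 * F x)"
          using \<phi>x \<phi>q[of x] False by (intro mult_right_mono power_mono) auto
        finally show ?thesis using False \<delta> by (auto simp: indicator_def)
      qed
    qed
    have int1: "integrable lborel (\<lambda>x. q ^ j * norm (\<phi> x ^ k0 * F x))"
      using int\<phi>[of k0] by (intro integrable_mult_right integrable_norm) auto
    have int2: "integrable lborel (\<lambda>x. \<eta> * Q ^ (j + k0) * ?I x)"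
      using \<delta> by (intro integrable_mult_right integrable_real_indicator) (auto simp: emeasure_lborel_Ioo)
    have "0 \<le> (\<integral>x. \<phi> x ^ (j + k0) * F x \<partial>lborel)" by (rule I) auto
    also have "\<dots> \<le> (\<integral>x. q ^ j * norm (\<phi> x ^ k0 * F x) - \<eta> * Q ^ (j + k0) * ?I x \<partial>lborel)"
      using int\<phi>[of "j + k0"] int1 int2 pt by (intro integral_mono) auto
    also have "\<dots> = q ^ j * C - \<eta> * Q ^ (j + k0) * (2 * \<delta>)"
      using \<delta> int1 int2 by (subst Bochner_Integration.integral_diff) (auto simp: C_def)
    finally show ?thesis by (simp add: mult_ac)
  qed
  have "2 * \<delta> * \<eta> * Q ^ k0 \<le> (q / Q) ^ j * C" for j
    using main[of j] Q by (simp add: power_divide power_add field_simps)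
  moreover have "(\<lambda>j. (q / Q) ^ j * C) \<longlonglongrightarrow> 0 * C"
    using q Q by (intro tendsto_mult LIMSEQ_power_zero tendsto_const) auto
  ultimately have "2 * \<delta> * \<eta> * Q ^ k0 \<le> 0 * C"
    by (intro tendsto_lowerbound[where F = sequentially]) auto
  moreover have "2 * \<delta> * \<eta> * Q ^ k0 > 0" using \<delta> \<eta> Q by simp
  ultimately show False by simp
qed


section \<open>The symbol of a Mittag-Leffler function\<close>

text \<open>
  Equality on a real segment suffices; for complex coefficients this is how a series obtained from
  a real integral is identified with the Taylor series of a holomorphic function.
\<close>

lemma power_series_unique:
  fixes h l :: "nat \<Rightarrow> 'a :: {real_normed_field, banach}"
  assumes \<delta>: "\<delta> > 0"
    and h: "\<And>z. 0 \<le> z \<Longrightarrow> z < \<delta> \<Longrightarrow> (\<lambda>k. h k * of_real z ^ k) sums f z"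
    and l: "\<And>z. 0 \<le> z \<Longrightarrow> z < \<delta> \<Longrightarrow> (\<lambda>k. l k * of_real z ^ k) sums f z"
  shows "h = l"
proof (rule ccontr)
  assume "h \<noteq> l"
  then obtain m where m: "h m - l m \<noteq> 0" by (auto simp: fun_eq_iff)
  define d where "d = (\<lambda>k. h k - l k)"
  define F where "F = (\<lambda>x. \<Sum>k. d k * x ^ k)"
  have d: "(\<lambda>k. d k * of_real z ^ k) sums 0" if "0 \<le> z" "z < \<delta>" for z
    using sums_diff[OF h[OF that] l[OF that]] by (simp add: d_def algebra_simps)
  have F: "(\<lambda>k. d k * (x - 0) ^ k) sums F x" if "norm (x - 0) < \<delta> / 2" for x
  proof -
    have "summable (\<lambda>k. d k * of_real (\<delta> / 2) ^ k)" using d[of "\<delta> / 2"] \<delta> by (auto simp: sums_iff)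
    hence "summable (\<lambda>k. d k * x ^ k)"
      by (rule powser_inside) (use that \<delta> in auto)
    thus ?thesis by (simp add: F_def summable_sums)
  qed
  have d0: "d 0 = 0"
  proof -
    have "(\<lambda>k. d k * 0 ^ k) sums 0" using d[of 0] \<delta> by simp
    from sums_unique2[OF powser_sums_zero this] show ?thesis .
  qed
  hence "m > 0" using m by (intro Nat.gr0I) (auto simp: d_def)
  moreover have "F 0 = 0" using d0 by (simp add: F_def powser_zero)
  moreover have "d m \<noteq> 0" using m by (simp add: d_def)
  moreover have "\<delta> / 2 > 0" using \<delta> by simp
  ultimately obtain s where s: "s > 0" "\<And>z. z \<in> cball 0 s - {0} \<Longrightarrow> F z \<noteq> 0"
    using powser_0_nonzero[of "\<delta> / 2" 0 d F m] F by blast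
  define z where "z = min s (\<delta> / 4)"
  have z: "0 < z" "z < \<delta>" "z \<le> s" using s \<delta> by (auto simp: z_def)
  have "F (of_real z) = 0" using d[of z] z by (simp add: F_def sums_iff)
  moreover have "of_real z \<in> cball (0::'a) s - {0}" using z by auto
  ultimately show False using s by blast
qed

definition ml_density :: "real \<Rightarrow> real \<Rightarrow> real \<Rightarrow> real \<Rightarrow> real" where
  "ml_density \<gamma> \<rho> \<mu> x = (if x > 0 then x powr (\<mu> - 1) * mittag_leffler3 \<gamma> \<rho> \<mu> (- (x powr \<rho>)) else 0)"

lemma ml_density_supp: "x \<le> 0 \<Longrightarrow> ml_density \<gamma> \<rho> \<mu> x = 0"
  by (simp add: ml_density_def)

text \<open>
  The Laplace transform of \<open>ml_density \<gamma> \<rho> \<mu>\<close> at \<open>s\<close> when \<open>a = \<mu> - \<rho>\<gamma>\<close>. Parametrising by \<open>a\<close> keeps the factor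
  \<open>s powr - a\<close> unchanged when \<open>\<gamma>\<close> varies.
\<close>

definition ml_symbol :: "real \<Rightarrow> real \<Rightarrow> real \<Rightarrow> real \<Rightarrow> real" where
  "ml_symbol \<gamma> \<rho> a s = s powr (- a) * (1 + s powr \<rho>) powr (- \<gamma>)"

lemma mittag_leffler3_real_def:
  assumes "\<gamma> > 0"
  shows "mittag_leffler3 \<gamma> \<rho> \<mu> (t::real) = (\<Sum>n. pochhammer \<gamma> n / fact n / Gamma (\<mu> + \<rho> * real n) * t ^ n)"
  unfolding mittag_leffler3_def mittag_leffler3_coeff[OF assms] by simp

lemma mittag_leffler3_real_summable:
  assumes "\<gamma> > 0" "\<rho> > 0" "\<mu> > 0"
  shows "summable (\<lambda>n. pochhammer \<gamma> n / fact n / Gamma (\<mu> + \<rho> * real n) * (t::real) ^ n)"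
  using mittag_leffler3_summable[OF assms, of t] unfolding mittag_leffler3_coeff[OF assms(1)] by simp

lemma isCont_mittag_leffler3:
  assumes "\<gamma> > 0" "\<rho> > 0" "\<mu> > 0"
  shows "isCont (mittag_leffler3 \<gamma> \<rho> \<mu>) (t::real)"
  using isCont_powser_converges_everywhere[of "\<lambda>n. pochhammer \<gamma> n / fact n / Gamma (\<mu> + \<rho> * real n)" t]
    mittag_leffler3_real_summable[OF assms] mittag_leffler3_real_def[OF assms(1), of \<rho> \<mu>]
  by (simp add: fun_eq_iff[symmetric] mittag_leffler3_real_def[OF assms(1), abs_def])

lemma measurable_ml_density [measurable]:
  assumes "\<gamma> > 0" "\<rho> > 0" "\<mu> > 0"
  shows "ml_density \<gamma> \<rho> \<mu> \<in> borel_measurable borel"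
proof -
  have [measurable]: "(mittag_leffler3 \<gamma> \<rho> \<mu> :: real \<Rightarrow> real) \<in> borel_measurable borel"
    by (intro borel_measurable_continuous_onI continuous_at_imp_continuous_on ballI isCont_mittag_leffler3 assms)
  show ?thesis unfolding ml_density_def [abs_def] by measurable
qed

lemma isCont_ml_density:
  assumes "\<gamma> > 0" "\<rho> > 0" "\<mu> > 0" and x: "x > 0"
  shows "isCont (ml_density \<gamma> \<rho> \<mu>) x"
proof -
  have "isCont (\<lambda>x. x powr (\<mu> - 1) * mittag_leffler3 \<gamma> \<rho> \<mu> (- (x powr \<rho>))) x"
    using x by (intro continuous_intros isCont_o2[OF _ isCont_mittag_leffler3] assms) auto
  moreover have "eventually (\<lambda>y. ml_density \<gamma> \<rho> \<mu> y = y powr (\<mu> - 1) * mittag_leffler3 \<gamma> \<rho> \<mu> (- (y powr \<rho>))) (nhds x)"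
    using eventually_nhds_in_open[of "{0<..}" x] x by (auto elim!: eventually_mono simp: ml_density_def)
  ultimately show ?thesis by (simp add: isCont_cong)
qed

lemma ml_density_nonneg_iff:
  assumes "\<rho> > 0"
  shows "(\<forall>x>0. ml_density \<gamma> \<rho> \<mu> x \<ge> 0) \<longleftrightarrow> (\<forall>t>0. mittag_leffler3 \<gamma> \<rho> \<mu> (- t :: real) \<ge> 0)"
proof safe
  fix t :: real assume *: "\<forall>x>0. ml_density \<gamma> \<rho> \<mu> x \<ge> 0" and t: "t > 0"
  from *[rule_format, of "t powr (1 / \<rho>)"] show "mittag_leffler3 \<gamma> \<rho> \<mu> (- t) \<ge> 0"
    using t assms by (simp add: ml_density_def powr_powr zero_le_mult_iff)
qed (auto simp: ml_density_def)

text \<open>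
  Termwise integration turns \<open>1 / Gamma (\<mu> + \<rho> n)\<close> into \<open>s powr - (\<mu> + \<rho> n)\<close> and leaves a binomial series in
  \<open>s powr - \<rho>\<close>. That series converges absolutely only for \<open>s > 1\<close>, whence the restriction on \<open>s\<close>.
\<close>

lemma ml_density_laplace:
  assumes g: "\<gamma> > 0" "\<rho> > 0" "\<mu> > 0" and s: "s > 1"
  shows "integrable lborel (\<lambda>x. exp (- (s * x)) * ml_density \<gamma> \<rho> \<mu> x)"
    and "(\<integral>x. exp (- (s * x)) * ml_density \<gamma> \<rho> \<mu> x \<partial>lborel) = ml_symbol \<gamma> \<rho> (\<mu> - \<rho> * \<gamma>) s"
proof -
  define p where "p = (\<lambda>n. pochhammer \<gamma> n / fact n :: real)"
  have p: "p n \<ge> 0" for n using g by (auto simp: p_def intro!: divide_nonneg_pos pochhammer_nonneg)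
  define q where "q = (\<lambda>n. \<mu> + \<rho> * real n)"
  have q: "q n > 0" for n using g by (auto simp: q_def intro!: add_pos_nonneg)
  define f where "f = (\<lambda>n x. indicator {0<..} x * (x powr (q n - 1) * exp (- (s * x))) * ((-1) ^ n * (p n / Gamma (q n))) :: real)"
  define w where "w = s powr (- \<rho>)"
  have w: "0 < w" "w < 1" using s g by (auto simp: w_def powr_less_one)
  have int: "has_bochner_integral lborel (f n) (s powr (- \<mu>) * (p n * (- w) ^ n))" for n
  proof -
    have "Gamma (q n) * s powr - q n * ((-1) ^ n * (p n / Gamma (q n))) = s powr (- \<mu>) * (p n * (- w) ^ n)"
    proof -
      have "s powr (- q n) = s powr (- \<mu>) * s powr (- \<rho> * real n)" by (simp add: q_def powr_diff powr_minus divide_inverse)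
      also have "s powr (- \<rho> * real n) = w ^ n"
        unfolding powr_realpow[OF w(1), symmetric] by (simp add: w_def powr_powr)
      finally show ?thesis using Gamma_real_pos[OF q[of n]] by (simp add: power_minus[of w])
    qed
    moreover have "has_bochner_integral lborel (f n) (Gamma (q n) * s powr - q n * ((-1) ^ n * (p n / Gamma (q n))))"
      unfolding f_def by (intro has_bochner_integral_mult_left has_bochner_integral_Gamma q) (use s in simp)
    ultimately show ?thesis by simp
  qed
  have norm_f: "norm (f n x) = indicator {0<..} x * (x powr (q n - 1) * exp (- (s * x))) * (p n / Gamma (q n))" for n x
    using p[of n] Gamma_real_pos[OF q[of n]] by (simp add: f_def abs_mult indicator_def)
  have intn: "(\<integral>x. norm (f n x) \<partial>lborel) = s powr (- \<mu>) * (p n * w ^ n)" for n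
  proof -
    have "norm (f n x) = f n x * (-1) ^ n" for x
      by (subst norm_f, subst f_def) (simp add: mult.assoc flip: power_mult_distrib)
    hence "(\<integral>x. norm (f n x) \<partial>lborel) = (\<integral>x. f n x \<partial>lborel) * (-1) ^ n" by simp
    also have "\<dots> = s powr (- \<mu>) * (p n * w ^ n)"
      using has_bochner_integral_integral_eq[OF int[of n]] by (simp add: power_minus[of w])
    finally show ?thesis .
  qed
  have f_eq: "f n x = exp (- (s * x)) * (x powr (\<mu> - 1)) * (pochhammer \<gamma> n / fact n / Gamma (\<mu> + \<rho> * real n) * (- (x powr \<rho>)) ^ n)"
    if "x > 0" for n x
  proof -
    have "x powr (q n - 1) = x powr (\<mu> - 1) * x powr (\<rho> * real n)"
      by (simp add: q_def flip: powr_add) (simp add: algebra_simps)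
    also have "x powr (\<rho> * real n) = (x powr \<rho>) ^ n"       using that by (subst powr_realpow[symmetric]) (simp_all add: powr_powr)
    finally show ?thesis using that by (simp add: f_def p_def q_def power_minus[of "x powr \<rho>"])
  qed
  have sums: "(\<lambda>n. f n x) sums (exp (- (s * x)) * ml_density \<gamma> \<rho> \<mu> x)" for x
  proof (cases "x > 0")
    case True
    have "(\<lambda>n. exp (- (s * x)) * (x powr (\<mu> - 1)) * (pochhammer \<gamma> n / fact n / Gamma (\<mu> + \<rho> * real n) * (- (x powr \<rho>)) ^ n)) sums
        (exp (- (s * x)) * (x powr (\<mu> - 1)) * mittag_leffler3 \<gamma> \<rho> \<mu> (- (x powr \<rho>)))"
      unfolding mittag_leffler3_real_def[OF g(1)] by (intro sums_mult summable_sums mittag_leffler3_real_summable g)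
    moreover have "exp (- (s * x)) * ml_density \<gamma> \<rho> \<mu> x = exp (- (s * x)) * (x powr (\<mu> - 1)) * mittag_leffler3 \<gamma> \<rho> \<mu> (- (x powr \<rho>))"
      using True by (simp add: ml_density_def)
    ultimately show ?thesis by (simp only: f_eq[OF True])
  qed (simp add: f_def ml_density_def)
  have summ: "summable (\<lambda>n. norm (f n x))" for x
  proof (cases "x > 0")
    case True
    have "norm (f n x) = exp (- (s * x)) * (x powr (\<mu> - 1)) * (pochhammer \<gamma> n / fact n / Gamma (\<mu> + \<rho> * real n) * (x powr \<rho>) ^ n)" for n
      unfolding f_eq[OF True] using pochhammer_nonneg[OF g(1), of n] Gamma_real_pos[OF q[of n], unfolded q_def]
      by (simp add: abs_mult power_abs)
    thus ?thesis by (simp only:) (intro summable_mult mittag_leffler3_real_summable g)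
  qed (simp add: f_def)
  have sum_int: "summable (\<lambda>n. \<integral>x. norm (f n x) \<partial>lborel)"
    unfolding intn using neg_powr_binomial[of w 1 \<gamma>] w by (intro summable_mult) (simp add: p_def sums_iff)
  show "integrable lborel (\<lambda>x. exp (- (s * x)) * ml_density \<gamma> \<rho> \<mu> x)"
    using integrable_suminf[of lborel f] summ sum_int int sums
    by (simp add: sums_iff has_bochner_integral_iff)
  have "(\<lambda>n. integral\<^sup>L lborel (f n)) sums (\<integral>x. (\<Sum>n. f n x) \<partial>lborel)"
    using summ sum_int int by (intro sums_integral) (auto simp: has_bochner_integral_iff)
  moreover have "integral\<^sup>L lborel (f n) = s powr (- \<mu>) * (p n * (- w) ^ n)" for n
    using int[of n] by (simp add: has_bochner_integral_iff)
  ultimately have "(\<lambda>n. s powr (- \<mu>) * (p n * (- w) ^ n)) sums (\<integral>x. exp (- (s * x)) * ml_density \<gamma> \<rho> \<mu> x \<partial>lborel)"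
    using sums by (simp add: sums_iff)
  moreover have "(\<lambda>n. s powr (- \<mu>) * (p n * (- w) ^ n)) sums (s powr (- \<mu>) * (1 + w) powr (- \<gamma>))"
  proof (intro sums_mult)
    have "(\<lambda>n. (- \<gamma> gchoose n) * w ^ n) sums (1 + w) powr (- \<gamma>)"
      by (rule gen_binomial_real) (use w in auto)
    moreover have "(- \<gamma> gchoose n) * w ^ n = p n * (- w) ^ n" for n
      by (simp add: p_def gbinomial_pochhammer power_minus[of w])
    ultimately show "(\<lambda>n. p n * (- w) ^ n) sums (1 + w) powr (- \<gamma>)" by simp
  qed
  ultimately have "(\<integral>x. exp (- (s * x)) * ml_density \<gamma> \<rho> \<mu> x \<partial>lborel) = s powr (- \<mu>) * (1 + w) powr (- \<gamma>)"
    by (rule sums_unique2)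
  also have "1 + w = s powr (- \<rho>) * (1 + s powr \<rho>)"
    using s by (simp add: w_def distrib_left flip: powr_add)
  also have "s powr (- \<mu>) * (s powr (- \<rho>) * (1 + s powr \<rho>)) powr (- \<gamma>) = ml_symbol \<gamma> \<rho> (\<mu> - \<rho> * \<gamma>) s"
    using s by (simp add: ml_symbol_def powr_mult powr_powr mult.assoc[symmetric] add_pos_nonneg flip: powr_add)
  finally show "(\<integral>x. exp (- (s * x)) * ml_density \<gamma> \<rho> \<mu> x \<partial>lborel) = ml_symbol \<gamma> \<rho> (\<mu> - \<rho> * \<gamma>) s" .
qed

lemma ml_density_moment_integrable:
  assumes g: "\<gamma> > 0" "\<rho> > 0" "\<mu> > 0" and s: "s > 1"
  shows "integrable lborel (\<lambda>x. x ^ k * exp (- (s * x)) * ml_density \<gamma> \<rho> \<mu> x)"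
proof -
  note [measurable] = measurable_ml_density[OF g]
  define z where "z = (s - 1) / 2"
  have z: "z > 0" "s - z > 1" using s by (auto simp: z_def field_simps)
  have "integrable lborel (\<lambda>x. fact k / z ^ k * (exp (- ((s - z) * x)) * ml_density \<gamma> \<rho> \<mu> x))"
    by (intro integrable_mult_right ml_density_laplace g z)
  thus ?thesis
  proof (rule Bochner_Integration.integrable_bound)
    show "AE x in lborel. norm (x ^ k * exp (- (s * x)) * ml_density \<gamma> \<rho> \<mu> x) \<le>
        norm (fact k / z ^ k * (exp (- ((s - z) * x)) * ml_density \<gamma> \<rho> \<mu> x))"
    proof (intro always_eventually allI)
      fix x
      show "norm (x ^ k * exp (- (s * x)) * ml_density \<gamma> \<rho> \<mu> x) \<le>
        norm (fact k / z ^ k * (exp (- ((s - z) * x)) * ml_density \<gamma> \<rho> \<mu> x))"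
      proof (cases "x > 0")
        case True
        have "(z * x) ^ k / fact k \<le> exp (z * x)"
        proof -
          have "(\<lambda>k. (z * x) ^ k / fact k) sums exp (z * x)"
            using exp_converges[of "z * x"] by (simp add: field_simps)
          from sum_le_suminf[OF sums_summable[OF this], of "{k}"] sums_unique[OF this] True z
          show ?thesis by auto
        qed
        hence "x ^ k \<le> fact k / z ^ k * exp (z * x)" using z by (simp add: power_mult_distrib field_simps)
        hence "x ^ k * exp (- (s * x)) \<le> fact k / z ^ k * exp (z * x) * exp (- (s * x))"
          by (intro mult_right_mono) auto
        also have "\<dots> = fact k / z ^ k * exp (- ((s - z) * x))"
          by (simp add: algebra_simps flip: exp_add)
        finally have "x ^ k * exp (- (s * x)) * \<bar>ml_density \<gamma> \<rho> \<mu> x\<bar> \<le>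
            fact k / z ^ k * exp (- ((s - z) * x)) * \<bar>ml_density \<gamma> \<rho> \<mu> x\<bar>"
          by (intro mult_right_mono) auto
        thus ?thesis using True z by (simp add: abs_mult mult_ac)
      qed (simp add: ml_density_def)
    qed
  qed measurable
qed

text \<open>
  Near \<open>s\<close> the symbol has two power series in \<open>z\<close>: one with the moments of the density as coefficients, and the
  one with non-negative coefficients given by complete monotonicity. They agree, so that the moments are non-negative.
\<close>

theorem nonneg_if_completely_monotone_symbol:
  assumes g: "\<gamma> > 0" "\<rho> > 0" "\<mu> > 0" and CM: "completely_monotone (ml_symbol \<gamma> \<rho> (\<mu> - \<rho> * \<gamma>))" and t: "t > 0"
  shows "mittag_leffler3 \<gamma> \<rho> \<mu> (- t :: real) \<ge> 0"
proof -
  note [measurable] = measurable_ml_density[OF g]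
  have "ml_density \<gamma> \<rho> \<mu> x \<ge> 0" if x: "x > 0" for x
  proof (rule post_widder_nonneg[where F = "ml_density \<gamma> \<rho> \<mu>"])
    fix k :: nat and s :: real assume s: "s > 1"
    show "integrable lborel (\<lambda>x. x ^ k * exp (- (s * x)) * ml_density \<gamma> \<rho> \<mu> x)"
      by (rule ml_density_moment_integrable[OF g s])
    obtain h where h: "\<And>k. h k \<ge> 0" "\<And>z. 0 \<le> z \<Longrightarrow> z < s \<Longrightarrow> (\<lambda>k. h k * z ^ k) sums ml_symbol \<gamma> \<rho> (\<mu> - \<rho> * \<gamma>) (s - z)"
      by (rule completely_monotone_E[OF CM s]) blast
    have "(\<lambda>k. (\<integral>x. x ^ k / fact k * exp (- (s * x)) * ml_density \<gamma> \<rho> \<mu> x \<partial>lborel)) = h"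
    proof (rule power_series_unique[where f = "\<lambda>z. ml_symbol \<gamma> \<rho> (\<mu> - \<rho> * \<gamma>) (s - z)" and \<delta> = "s - 1"])
      fix z assume z: "0 \<le> z" "z < s - 1"
      have "s - z > 1" using z by simp
      note L = ml_density_laplace[OF g this]
      show "(\<lambda>k. (\<integral>x. x ^ k / fact k * exp (- (s * x)) * ml_density \<gamma> \<rho> \<mu> x \<partial>lborel) * of_real z ^ k) sums
              ml_symbol \<gamma> \<rho> (\<mu> - \<rho> * \<gamma>) (s - z)"
        using exponential_moment_series[OF measurable_ml_density[OF g] ml_density_supp z(1) L(1)]
        unfolding L(2) of_real_eq_id id_apply .
      show "(\<lambda>k. h k * of_real z ^ k) sums ml_symbol \<gamma> \<rho> (\<mu> - \<rho> * \<gamma>) (s - z)"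
        using h(2)[of z] z by simp
    qed (use s in auto)
    hence "(\<integral>x. x ^ k / fact k * exp (- (s * x)) * ml_density \<gamma> \<rho> \<mu> x \<partial>lborel) \<ge> 0"
      using h(1)[of k] by (auto simp: fun_eq_iff)
    thus "(\<integral>x. x ^ k * exp (- (s * x)) * ml_density \<gamma> \<rho> \<mu> x \<partial>lborel) \<ge> 0"
      using not_le[THEN iffD2, OF fact_gt_zero[of k, where 'a = real]] by (simp add: zero_le_divide_iff)
  qed (use x isCont_ml_density[OF g] in \<open>auto simp: ml_density_def\<close>)
  thus ?thesis using ml_density_nonneg_iff[OF g(2)] t by blast
qed


section \<open>Landau's argument\<close>

text \<open>
  A power series with coefficients that are moments of a non-negative density equals the Taylor series of any
  holomorphic extension \<open>L\<close> of the symbol, and therefore converges in the largest disc in which \<open>L\<close> is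
  holomorphic. The disc is a parameter because the nearest singularities of the symbol depend on \<open>\<rho>\<close>.
\<close>

lemma landau_expansion:
  assumes g: "\<gamma> > 0" "\<rho> > 0" "\<mu> > 0"
    and nonneg: "\<And>t::real. t > 0 \<Longrightarrow> mittag_leffler3 \<gamma> \<rho> \<mu> (- t) \<ge> 0"
    and s0: "s0 > 1" and r: "r > 0"
    and hol: "L holomorphic_on ball (complex_of_real s0) r"
    and L: "\<And>s. 1 < s \<Longrightarrow> L (complex_of_real s) = of_real (ml_symbol \<gamma> \<rho> (\<mu> - \<rho> * \<gamma>) s)"
  shows "\<exists>h. (\<forall>k. h k \<ge> 0) \<and>
     (\<forall>z. norm z < r \<longrightarrow> (\<lambda>k. of_real (h k) * z ^ k) sums L (of_real s0 - z)) \<and>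
     (\<forall>z\<ge>0. laplace (\<lambda>x. ennreal (ml_density \<gamma> \<rho> \<mu> x)) (s0 - z) = (\<Sum>k. ennreal (h k * z ^ k)))"
proof -
  note [measurable] = measurable_ml_density[OF g]
  let ?f = "ml_symbol \<gamma> \<rho> (\<mu> - \<rho> * \<gamma>)"
  have dens: "ml_density \<gamma> \<rho> \<mu> x \<ge> 0" for x
    using ml_density_nonneg_iff[OF g(2), of \<gamma> \<mu>] nonneg by (cases "x > 0") (auto simp: ml_density_supp)
  have f0: "?f s \<ge> 0" for s by (simp add: ml_symbol_def)
  have lap: "laplace (\<lambda>x. ennreal (ml_density \<gamma> \<rho> \<mu> x)) s = ennreal (?f s)" if "s > 1" for s
  proof -
    note LL = ml_density_laplace[OF g that]
    have "laplace (\<lambda>x. ennreal (ml_density \<gamma> \<rho> \<mu> x)) s = (\<integral>\<^sup>+x. ennreal (exp (- (s * x)) * ml_density \<gamma> \<rho> \<mu> x) \<partial>lborel)"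
      unfolding laplace_def using dens by (simp add: ennreal_mult)
    also have "\<dots> = ennreal (?f s)"
      unfolding LL(2) [symmetric] using dens by (intro nn_integral_eq_integral LL(1)) auto
    finally show ?thesis .
  qed
  have "\<exists>h. (\<forall>k. h k \<ge> 0) \<and> (\<forall>z. 0 \<le> z \<and> z < s0 - 1 \<longrightarrow> (\<lambda>k. h k * z ^ k) sums ?f (s0 - z)) \<and>
           (\<forall>z\<ge>0. laplace (\<lambda>x. ennreal (ml_density \<gamma> \<rho> \<mu> x)) (s0 - z) = (\<Sum>k. ennreal (h k * z ^ k)))"
    by (rule laplace_power_series) (use lap f0 s0 in \<open>simp_all add: ml_density_supp\<close>)
  then obtain h where h: "(\<forall>k. h k \<ge> 0) \<and> (\<forall>z. 0 \<le> z \<and> z < s0 - 1 \<longrightarrow> (\<lambda>k. h k * z ^ k) sums ?f (s0 - z)) \<and>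
           (\<forall>z\<ge>0. laplace (\<lambda>x. ennreal (ml_density \<gamma> \<rho> \<mu> x)) (s0 - z) = (\<Sum>k. ennreal (h k * z ^ k)))" ..
  define G where "G = (\<lambda>z. L (of_real s0 - z))"
  have "G holomorphic_on ball 0 r"
  proof -
    have "(\<lambda>z. of_real s0 - z) holomorphic_on ball 0 r" by (intro holomorphic_intros)
    moreover have "(\<lambda>z. of_real s0 - z) ` ball 0 r \<subseteq> ball (complex_of_real s0) r" by (auto simp: dist_norm)
    ultimately show ?thesis
      using holomorphic_on_compose_gen[OF _ hol] unfolding G_def o_def by blast
  qed
  from holomorphic_power_series[OF this]
  have G: "(\<lambda>k. (deriv ^^ k) G 0 / fact k * z ^ k) sums G z" if "norm z < r" for z
    using that by (simp add: dist_norm)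
  define \<delta> where "\<delta> = min r (s0 - 1)"
  have "(\<lambda>k. (deriv ^^ k) G 0 / fact k) = (\<lambda>k. of_real (h k))"
  proof (rule power_series_unique[where f = "\<lambda>z. G (of_real z)" and \<delta> = \<delta>])
    fix z :: real assume z: "0 \<le> z" "z < \<delta>"
    show "(\<lambda>k. (deriv ^^ k) G 0 / fact k * of_real z ^ k) sums G (of_real z)"
      by (rule G) (use z in \<open>auto simp: \<delta>_def\<close>)
    have "(\<lambda>k. complex_of_real (h k * z ^ k)) sums of_real (?f (s0 - z))"
      by (intro sums_of_real) (use h z in \<open>auto simp: \<delta>_def\<close>)
    moreover have "G (of_real z) = of_real (?f (s0 - z))"
      using L[of "s0 - z"] z by (simp add: G_def \<delta>_def)
    ultimately show "(\<lambda>k. of_real (h k) * of_real z ^ k) sums G (of_real z)" by simp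
  qed (use r s0 in \<open>auto simp: \<delta>_def\<close>)
  hence "(\<lambda>k. of_real (h k) * z ^ k) sums G z" if "norm z < r" for z
    using G[OF that] by (simp add: fun_eq_iff)
  thus ?thesis using h by (intro exI[of _ h]) (simp add: G_def)
qed

definition ml_symbol_complex :: "real \<Rightarrow> real \<Rightarrow> real \<Rightarrow> complex \<Rightarrow> complex" where
  "ml_symbol_complex \<gamma> \<rho> a s = s powr (of_real (- a)) * (1 + s powr (of_real \<rho>)) powr (of_real (- \<gamma>))"

lemma ml_symbol_complex_of_real:
  "s > 0 \<Longrightarrow> ml_symbol_complex \<gamma> \<rho> a (of_real s) = of_real (ml_symbol \<gamma> \<rho> a s)"
proof -
  assume s: "s > 0"
  have "of_real s powr complex_of_real \<rho> = of_real (s powr \<rho>)" using s by (intro powr_of_real) auto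
  hence "1 + of_real s powr complex_of_real \<rho> = of_real (1 + s powr \<rho>)" by simp
  thus ?thesis using s unfolding ml_symbol_complex_def ml_symbol_def
    by (simp only: of_real_mult powr_of_real less_imp_le add_nonneg_nonneg powr_ge_zero zero_le_one)
qed

text \<open>
  In the sector \<open>\<bar>arg s\<bar> < \<pi> / \<rho>\<close> the power \<open>s powr \<rho>\<close> avoids the negative half line, so that the principal
  branches give a holomorphic symbol. The sector contains the right half plane precisely for \<open>\<rho> \<le> 2\<close>.
\<close>

lemma one_plus_powr_not_nonpos:
  assumes s: "s \<notin> \<real>\<^sub>\<le>\<^sub>0" and sector: "\<bar>\<rho> * Im (Ln s)\<bar> < pi"
  shows "1 + s powr (complex_of_real \<rho>) \<notin> \<real>\<^sub>\<le>\<^sub>0"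
proof
  have "s \<noteq> 0" using s by auto
  hence pw: "s powr (complex_of_real \<rho>) = exp (of_real \<rho> * Ln s)" by (simp add: powr_def)
  assume "1 + s powr (complex_of_real \<rho>) \<in> \<real>\<^sub>\<le>\<^sub>0"
  hence *: "Im (exp (of_real \<rho> * Ln s)) = 0" "Re (exp (of_real \<rho> * Ln s)) \<le> - 1"
    unfolding pw by (auto simp: complex_nonpos_Reals_iff)
  from *(1) have "sin (\<rho> * Im (Ln s)) = 0" by (simp add: Im_exp)
  hence "\<rho> * Im (Ln s) = 0" using sector sin_eq_0_pi[of "\<rho> * Im (Ln s)"] by (auto simp: abs_less_iff)
  hence "cos (\<rho> * Im (Ln s)) = 1" by (simp only: cos_zero)
  hence "Re (exp (of_real \<rho> * Ln s)) > 0" by (simp add: Re_exp)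
  with *(2) show False by simp
qed

lemma ml_symbol_complex_holomorphic:
  assumes nz: "\<And>s. s \<in> A \<Longrightarrow> s \<notin> \<real>\<^sub>\<le>\<^sub>0" and sector: "\<And>s. s \<in> A \<Longrightarrow> \<bar>\<rho> * Im (Ln s)\<bar> < pi"
  shows "ml_symbol_complex \<gamma> \<rho> a holomorphic_on A"
proof -
  have nz': "s \<noteq> 0" if "s \<in> A" for s using nz[OF that] by auto
  have cut: "1 + exp (of_real \<rho> * Ln s) \<notin> \<real>\<^sub>\<le>\<^sub>0" if s: "s \<in> A" for s
    using one_plus_powr_not_nonpos[OF nz[OF s] sector[OF s]] nz'[OF s] by (simp add: powr_def)
  have "(\<lambda>s. exp (of_real (- a) * Ln s) * exp (of_real (- \<gamma>) * Ln (1 + exp (of_real \<rho> * Ln s)))) holomorphic_on A"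
    using nz cut by (intro holomorphic_intros) auto
  thus ?thesis
  proof (rule holomorphic_transform)
    fix s assume s: "s \<in> A"
    have "1 + exp (of_real \<rho> * Ln s) \<noteq> 0" using cut[OF s] by auto
    thus "exp (of_real (- a) * Ln s) * exp (of_real (- \<gamma>) * Ln (1 + exp (of_real \<rho> * Ln s))) = ml_symbol_complex \<gamma> \<rho> a s"
      using nz'[OF s] by (simp add: ml_symbol_complex_def powr_def)
  qed
qed

lemma ml_symbol_complex_holomorphic_half_plane:
  assumes "0 < \<rho>" "\<rho> \<le> 2" "s0 > 0"
  shows "ml_symbol_complex \<gamma> \<rho> a holomorphic_on ball (of_real s0) s0"
proof (rule ml_symbol_complex_holomorphic)
  fix s assume s: "s \<in> ball (complex_of_real s0) s0"
  have "\<bar>Re (of_real s0 - s)\<bar> < s0" using s abs_Re_le_cmod[of "of_real s0 - s"] by (simp add: dist_norm)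
  hence Re: "Re s > 0" by simp
  thus "s \<notin> \<real>\<^sub>\<le>\<^sub>0" by (auto simp: complex_nonpos_Reals_iff)
  have "\<bar>Im (Ln s)\<bar> < pi / 2" by (rule Re_Ln_pos_lt_imp[OF Re])
  hence "\<rho> * \<bar>Im (Ln s)\<bar> < 2 * (pi / 2)" using assms by (intro mult_le_less_imp_less) auto
  thus "\<bar>\<rho> * Im (Ln s)\<bar> < pi" using assms by (simp add: abs_mult)
qed

lemma landau_half_plane:
  assumes g: "\<gamma> > 0" "\<rho> > 0" "\<mu> > 0" and \<rho>: "\<rho> \<le> 2"
    and nonneg: "\<And>t::real. t > 0 \<Longrightarrow> mittag_leffler3 \<gamma> \<rho> \<mu> (- t) \<ge> 0"
    and s0: "s0 > 1"
  obtains h where "\<And>k. h k \<ge> 0"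
     "\<And>z. norm z < s0 \<Longrightarrow> (\<lambda>k. of_real (h k) * z ^ k) sums ml_symbol_complex \<gamma> \<rho> (\<mu> - \<rho> * \<gamma>) (of_real s0 - z)"
     "\<And>z. 0 \<le> z \<Longrightarrow> z < s0 \<Longrightarrow> (\<lambda>k. h k * z ^ k) sums ml_symbol \<gamma> \<rho> (\<mu> - \<rho> * \<gamma>) (s0 - z)"
     "\<And>z. z \<ge> 0 \<Longrightarrow> laplace (\<lambda>x. ennreal (ml_density \<gamma> \<rho> \<mu> x)) (s0 - z) = (\<Sum>k. ennreal (h k * z ^ k))"
proof -
  have "\<exists>h. (\<forall>k. h k \<ge> 0) \<and>
     (\<forall>z. norm z < s0 \<longrightarrow> (\<lambda>k. of_real (h k) * z ^ k) sums ml_symbol_complex \<gamma> \<rho> (\<mu> - \<rho> * \<gamma>) (of_real s0 - z)) \<and>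
     (\<forall>z\<ge>0. laplace (\<lambda>x. ennreal (ml_density \<gamma> \<rho> \<mu> x)) (s0 - z) = (\<Sum>k. ennreal (h k * z ^ k)))"
    using s0 by (intro landau_expansion g nonneg ml_symbol_complex_holomorphic_half_plane \<rho> ml_symbol_complex_of_real) auto
  then obtain h where h: "(\<forall>k. h k \<ge> 0) \<and>
     (\<forall>z. norm z < s0 \<longrightarrow> (\<lambda>k. of_real (h k) * z ^ k) sums ml_symbol_complex \<gamma> \<rho> (\<mu> - \<rho> * \<gamma>) (of_real s0 - z)) \<and>
     (\<forall>z\<ge>0. laplace (\<lambda>x. ennreal (ml_density \<gamma> \<rho> \<mu> x)) (s0 - z) = (\<Sum>k. ennreal (h k * z ^ k)))" ..
  show thesis
  proof (rule that[of h])
    fix z assume z: "0 \<le> z" "z < s0"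
    have "(\<lambda>k. of_real (h k) * complex_of_real z ^ k) sums ml_symbol_complex \<gamma> \<rho> (\<mu> - \<rho> * \<gamma>) (of_real s0 - of_real z)"
      using h z by simp
    also have "of_real s0 - of_real z = complex_of_real (s0 - z)" by simp
    also have "ml_symbol_complex \<gamma> \<rho> (\<mu> - \<rho> * \<gamma>) (of_real (s0 - z)) = of_real (ml_symbol \<gamma> \<rho> (\<mu> - \<rho> * \<gamma>) (s0 - z))"
      by (rule ml_symbol_complex_of_real) (use z in simp)
    also have "(\<lambda>k. of_real (h k) * complex_of_real z ^ k) = (\<lambda>k. of_real (h k * z ^ k))" by simp
    finally show "(\<lambda>k. h k * z ^ k) sums ml_symbol \<gamma> \<rho> (\<mu> - \<rho> * \<gamma>) (s0 - z)"
      by (simp only: sums_of_real_iff)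
  qed (use h in simp_all)
qed

text \<open>
  The second claim extends the Laplace integral from \<open>s > 1\<close> to all \<open>s > 0\<close>.
\<close>

theorem completely_monotone_symbol_if_nonneg:
  assumes g: "\<gamma> > 0" "\<rho> > 0" "\<mu> > 0" and \<rho>: "\<rho> \<le> 2"
    and nonneg: "\<And>t::real. t > 0 \<Longrightarrow> mittag_leffler3 \<gamma> \<rho> \<mu> (- t) \<ge> 0"
  shows "completely_monotone (ml_symbol \<gamma> \<rho> (\<mu> - \<rho> * \<gamma>))"
    and "s > 0 \<Longrightarrow> laplace (\<lambda>x. ennreal (ml_density \<gamma> \<rho> \<mu> x)) s = ennreal (ml_symbol \<gamma> \<rho> (\<mu> - \<rho> * \<gamma>) s)"
proof -
  show "completely_monotone (ml_symbol \<gamma> \<rho> (\<mu> - \<rho> * \<gamma>))"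
  proof (rule completely_monotone_I)
    fix s0 :: real assume s0: "s0 > 1"
    obtain h where h: "\<And>k. h k \<ge> 0"
     "\<And>z. 0 \<le> z \<Longrightarrow> z < s0 \<Longrightarrow> (\<lambda>k. h k * z ^ k) sums ml_symbol \<gamma> \<rho> (\<mu> - \<rho> * \<gamma>) (s0 - z)"
      by (rule landau_half_plane[OF g \<rho> nonneg s0]) auto
    show "\<exists>h. (\<forall>k. h k \<ge> 0) \<and> (\<forall>z. 0 \<le> z \<and> z < s0 \<longrightarrow> (\<lambda>k. h k * z ^ k) sums ml_symbol \<gamma> \<rho> (\<mu> - \<rho> * \<gamma>) (s0 - z))"
      by (intro exI[of _ h]) (use h in simp)
  qed
  assume s: "s > 0"
  hence s2: "s + 2 > 1" by simp
  obtain h where h: "\<And>k. h k \<ge> 0"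
     "\<And>z. 0 \<le> z \<Longrightarrow> z < s + 2 \<Longrightarrow> (\<lambda>k. h k * z ^ k) sums ml_symbol \<gamma> \<rho> (\<mu> - \<rho> * \<gamma>) (s + 2 - z)"
     "\<And>z. z \<ge> 0 \<Longrightarrow> laplace (\<lambda>x. ennreal (ml_density \<gamma> \<rho> \<mu> x)) (s + 2 - z) = (\<Sum>k. ennreal (h k * z ^ k))"
    by (rule landau_half_plane[OF g \<rho> nonneg s2]) auto
  have "(\<Sum>k. ennreal (h k * 2 ^ k)) = ennreal (ml_symbol \<gamma> \<rho> (\<mu> - \<rho> * \<gamma>) s)"
    by (rule suminf_ennreal_eq) (use h(1) h(2)[of 2] s in auto)
  thus "laplace (\<lambda>x. ennreal (ml_density \<gamma> \<rho> \<mu> x)) s = ennreal (ml_symbol \<gamma> \<rho> (\<mu> - \<rho> * \<gamma>) s)"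
    using h(3)[of 2] by simp
qed


section \<open>Sums of squares of Bessel functions\<close>

lemma strong_recursion_exists:
  fixes \<Phi> :: "nat \<Rightarrow> (nat \<Rightarrow> 'a) \<Rightarrow> 'a"
  assumes cong: "\<And>n f g. (\<And>k. k < n \<Longrightarrow> f k = g k) \<Longrightarrow> \<Phi> n f = \<Phi> n g"
  shows "\<exists>c. \<forall>n. c n = \<Phi> n c"
proof -
  define c where "c = wfrec less_than (\<lambda>f n. \<Phi> n f)"
  have "c n = \<Phi> n c" for n
  proof -
    have "c n = \<Phi> n (cut c less_than n)"
      unfolding c_def by (subst wfrec) auto
    also have "\<dots> = \<Phi> n c"
      by (rule cong) (simp add: cut_apply)
    finally show ?thesis .
  qed
  thus ?thesis by blast
qed

lemma gbinomial_Gamma: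
  fixes a :: real
  assumes "a - real k + 1 > 0"
  shows "a gchoose k = Gamma (a + 1) / (fact k * Gamma (a - real k + 1))"
proof -
  have "a - real k + 1 \<notin> \<int>\<^sub>\<le>\<^sub>0" using assms by (auto elim!: nonpos_Ints_cases)
  from pochhammer_Gamma[OF this, of k] show ?thesis
    by (simp add: gbinomial_pochhammer')
qed

text \<open>
  The Bessel function without its power: \<open>J\<^bsub>\<alpha>\<^esub> (2 \<surd>v) = v powr (\<alpha> / 2) * bessel_series \<alpha> v\<close>.
\<close>

definition bessel_series :: "real \<Rightarrow> real \<Rightarrow> real" where
  "bessel_series \<alpha> v = (\<Sum>k. (- v) ^ k / (fact k * Gamma (\<alpha> + real k + 1)))"

lemma Gamma_ge_const:
  fixes \<alpha> :: real
  assumes "\<alpha> > - 1"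
  shows "\<exists>d>0. \<forall>k::nat. Gamma (\<alpha> + real k + 1) \<ge> d"
proof -
  have pos: "Gamma (\<alpha> + real k + 1) > 0" for k using assms by (intro Gamma_real_pos) linarith
  define d where "d = min (Gamma (\<alpha> + 1)) (Gamma (\<alpha> + 2))"
  have "d > 0" using pos[of 0] pos[of 1] by (simp add: d_def add.assoc)
  moreover have "Gamma (\<alpha> + real k + 1) \<ge> d" for k
  proof (induction k)
    case (Suc k)
    show ?case
    proof (cases "k = 0")
      case False
      have "\<alpha> + real k + 1 \<notin> \<int>\<^sub>\<le>\<^sub>0" using assms by (auto elim!: nonpos_Ints_cases)
      from Gamma_plus1[OF this]
      have "Gamma (\<alpha> + real (Suc k) + 1) = (\<alpha> + real k + 1) * Gamma (\<alpha> + real k + 1)"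
        by (simp add: algebra_simps)
      also have "\<dots> \<ge> 1 * Gamma (\<alpha> + real k + 1)"
        using False assms pos[of k] by (intro mult_right_mono) auto
      finally show ?thesis using Suc by simp
    qed (simp add: d_def add.commute)
  qed (simp add: d_def)
  ultimately show ?thesis by blast
qed

lemma bessel_series_summable:
  assumes "\<alpha> > - 1"
  shows "summable (\<lambda>k. norm ((- v) ^ k / (fact k * Gamma (\<alpha> + real k + 1)) :: real))"
proof -
  obtain d where d: "d > 0" "\<And>k::nat. Gamma (\<alpha> + real k + 1) \<ge> d"
    using Gamma_ge_const[OF assms] by blast
  have "summable (\<lambda>k. 1 / d * (inverse (fact k) * \<bar>v\<bar> ^ k))"
    by (intro summable_mult summable_exp)
  moreover have "norm (norm ((- v) ^ k / (fact k * Gamma (\<alpha> + real k + 1)))) \<le>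
                   1 / d * (inverse (fact k) * \<bar>v\<bar> ^ k)" for k
  proof -
    have "norm (norm ((- v) ^ k / (fact k * Gamma (\<alpha> + real k + 1)))) =
            \<bar>v\<bar> ^ k / fact k / Gamma (\<alpha> + real k + 1)"
      using d(1) d(2)[of k] by (simp add: norm_power abs_mult field_simps power_abs)
    also have "\<dots> \<le> \<bar>v\<bar> ^ k / fact k / d"
      using d(1) d(2)[of k] by (intro divide_left_mono) auto
    finally show ?thesis by (simp add: field_simps)
  qed
  ultimately show ?thesis
    by (rule summable_comparison_test'[where N = 0])
qed

text \<open>
  The Cauchy product is evaluated by the Vandermonde identity.
\<close>

lemma bessel_series_square:
  assumes "\<alpha> > - 1 / 2"
  shows "(\<lambda>k. (- v) ^ k * Gamma (2 * \<alpha> + 2 * real k + 1) /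
             (fact k * Gamma (2 * \<alpha> + real k + 1) * Gamma (\<alpha> + real k + 1) ^ 2))
         sums (bessel_series \<alpha> v) ^ 2"
proof -
  let ?a = "\<lambda>k. (- v) ^ k / (fact k * Gamma (\<alpha> + real k + 1))"
  have "(\<lambda>k. \<Sum>i\<le>k. ?a i * ?a (k - i)) sums ((\<Sum>k. ?a k) * (\<Sum>k. ?a k))"
    using assms by (intro Cauchy_product_sums bessel_series_summable) auto
  moreover have "(\<Sum>i\<le>k. ?a i * ?a (k - i)) =
        (- v) ^ k * Gamma (2 * \<alpha> + 2 * real k + 1) /
             (fact k * Gamma (2 * \<alpha> + real k + 1) * Gamma (\<alpha> + real k + 1) ^ 2)" for k
  proof -
    let ?G = "Gamma (\<alpha> + real k + 1)"
    have G: "?G > 0" using assms by (intro Gamma_real_pos) linarith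
    have "(\<Sum>i\<le>k. ?a i * ?a (k - i)) =
          (\<Sum>i\<le>k. (- v) ^ k / ?G ^ 2 * (((\<alpha> + real k) gchoose i) * ((\<alpha> + real k) gchoose (k - i))))"
    proof (rule sum.cong)
      fix i assume "i \<in> {..k}"
      hence i: "i \<le> k" by simp
      have 1: "(\<alpha> + real k) gchoose i = ?G / (fact i * Gamma (\<alpha> + real (k - i) + 1))"
        using assms i by (subst gbinomial_Gamma) (auto simp: of_nat_diff algebra_simps)
      have 2: "(\<alpha> + real k) gchoose (k - i) = ?G / (fact (k - i) * Gamma (\<alpha> + real i + 1))"
        using assms i by (subst gbinomial_Gamma) (auto simp: of_nat_diff algebra_simps)
      have "(- v) ^ k = (- v) ^ i * (- v) ^ (k - i)"
        using i by (simp flip: power_add)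
      thus "?a i * ?a (k - i) = (- v) ^ k / ?G ^ 2 *
              (((\<alpha> + real k) gchoose i) * ((\<alpha> + real k) gchoose (k - i)))"
        unfolding 1 2 using G by (simp add: power2_eq_square)
    qed auto
    also have "\<dots> = (- v) ^ k / ?G ^ 2 * ((2 * \<alpha> + 2 * real k) gchoose k)"
      using gbinomial_Vandermonde[of "\<alpha> + real k" "\<alpha> + real k" k]
      unfolding sum_distrib_left [symmetric] atLeast0AtMost by (simp add: algebra_simps)
    also have "(2 * \<alpha> + 2 * real k) gchoose k =
        Gamma (2 * \<alpha> + 2 * real k + 1) / (fact k * Gamma (2 * \<alpha> + real k + 1))"
      using assms by (subst gbinomial_Gamma) (auto simp: algebra_simps)
    finally show ?thesis by (simp add: field_simps)
  qed
  ultimately show ?thesis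
    by (simp add: bessel_series_def power2_eq_square)
qed

text \<open>
  This factor and \<open>block_scale\<close> split the coefficient of \<open>v ^ m\<close> in the \<open>n\<close>-th block
  \<open>v ^ n * (bessel_series (\<nu> + n) v) ^ 2\<close>, a multiple of \<open>J\<^bsub>\<nu>+n\<^esub> (2 \<surd>v) ^ 2 / v powr \<nu>\<close>, into a part that depends
  on both indices and a part that depends on \<open>m\<close> only.
\<close>

definition block_factor :: "real \<Rightarrow> nat \<Rightarrow> nat \<Rightarrow> real" where
  "block_factor \<nu> n m = (if n \<le> m then 1 / (fact (m - n) * Gamma (2 * \<nu> + real n + real m + 1)) else 0)"

definition block_scale :: "real \<Rightarrow> nat \<Rightarrow> real" where
  "block_scale \<nu> m = Gamma (2 * \<nu> + 2 * real m + 1) / Gamma (\<nu> + real m + 1) ^ 2"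

lemma square_block_sums:
  assumes "\<nu> > - 1 / 2"
  shows "(\<lambda>m. (-1) ^ (m + n) * block_scale \<nu> m * block_factor \<nu> n m * v ^ m) sums
           (v ^ n * (bessel_series (\<nu> + real n) v) ^ 2)"
proof (subst sums_zero_iff_shift [of n, symmetric])
  show "(-1) ^ (i + n) * block_scale \<nu> i * block_factor \<nu> n i * v ^ i = 0" if "i < n" for i
    using that by (simp add: block_factor_def)
  have "(\<lambda>k. v ^ n * ((- v) ^ k * Gamma (2 * (\<nu> + real n) + 2 * real k + 1) /
             (fact k * Gamma (2 * (\<nu> + real n) + real k + 1) * Gamma ((\<nu> + real n) + real k + 1) ^ 2)))
         sums (v ^ n * (bessel_series (\<nu> + real n) v) ^ 2)"
    using assms by (intro sums_mult bessel_series_square) auto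
  moreover have "(-1) ^ (k + n + n) * block_scale \<nu> (k + n) * block_factor \<nu> n (k + n) * v ^ (k + n) =
      v ^ n * ((- v) ^ k * Gamma (2 * (\<nu> + real n) + 2 * real k + 1) /
             (fact k * Gamma (2 * (\<nu> + real n) + real k + 1) * Gamma ((\<nu> + real n) + real k + 1) ^ 2))" for k
  proof -
    have 1: "(- 1) ^ (k + n + n) * v ^ (k + n) = v ^ n * (- v) ^ k"
    proof -
      have "(- 1 :: real) ^ (k + n + n) = (- 1) ^ k"
        unfolding add.assoc mult_2 [symmetric] by (simp add: power_add)
      thus ?thesis by (subst power_minus[of v]) (simp add: power_add)
    qed
    have 2: "block_scale \<nu> (k + n) * block_factor \<nu> n (k + n) = Gamma (2 * (\<nu> + real n) + 2 * real k + 1) /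
             (fact k * Gamma (2 * (\<nu> + real n) + real k + 1) * Gamma ((\<nu> + real n) + real k + 1) ^ 2)"
      by (simp add: block_scale_def block_factor_def add_ac distrib_left)
    have "(-1) ^ (k + n + n) * block_scale \<nu> (k + n) * block_factor \<nu> n (k + n) * v ^ (k + n) =
            ((- 1) ^ (k + n + n) * v ^ (k + n)) * (block_scale \<nu> (k + n) * block_factor \<nu> n (k + n))"
      by (simp only: mult_ac)
    also have "\<dots> = v ^ n * ((- v) ^ k * Gamma (2 * (\<nu> + real n) + 2 * real k + 1) /
             (fact k * Gamma (2 * (\<nu> + real n) + real k + 1) * Gamma ((\<nu> + real n) + real k + 1) ^ 2))"
      unfolding 1 2 by simp
    finally show ?thesis .
  qed
  ultimately show "(\<lambda>i. (-1) ^ (i + n + n) * block_scale \<nu> (i + n) * block_factor \<nu> n (i + n) * v ^ (i + n)) sums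
          (v ^ n * (bessel_series (\<nu> + real n) v) ^ 2)"
    by (simp only:)
qed

lemma block_factor_Suc:
  assumes "\<nu> > - 1 / 2"
  shows "(2 * \<nu> + real n + real m + 1) * block_factor \<nu> (Suc n) m = (real m - real n) * block_factor \<nu> n m"
proof (cases "Suc n \<le> m")
  case True
  have "2 * \<nu> + real n + real m + 1 \<notin> \<int>\<^sub>\<le>\<^sub>0" using assms by (auto elim!: nonpos_Ints_cases)
  from Gamma_plus1[OF this]
  have G: "Gamma (2 * \<nu> + real n + real m + 2) =
      (2 * \<nu> + real n + real m + 1) * Gamma (2 * \<nu> + real n + real m + 1)"
    by (simp add: algebra_simps)
  have pos: "2 * \<nu> + real n + real m + 1 > 0" using assms by linarith
  hence Gp: "Gamma (2 * \<nu> + real n + real m + 1) > 0" by (rule Gamma_real_pos)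
  define G0 F0 where "G0 = Gamma (2 * \<nu> + real n + real m + 1)" and "F0 = (fact (m - Suc n) :: real)"
  have F: "fact (m - n) = (real m - real n) * F0"
    using True unfolding F0_def by (subst fact_reduce) (auto simp: of_nat_diff)
  have "block_factor \<nu> (Suc n) m = 1 / (F0 * ((2 * \<nu> + real n + real m + 1) * G0))"
  proof -
    have "2 * \<nu> + real (Suc n) + real m + 1 = 2 * \<nu> + real n + real m + 2" by simp
    thus ?thesis using True unfolding block_factor_def F0_def G0_def G [symmetric] by (simp only: if_True)
  qed
  moreover have "block_factor \<nu> n m = 1 / (((real m - real n) * F0) * G0)"
    using True unfolding F [symmetric] by (simp add: block_factor_def G0_def)
  moreover have "F0 \<noteq> 0" "G0 \<noteq> 0" "real m - real n \<noteq> 0" using True Gp by (auto simp: F0_def G0_def)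
  ultimately show ?thesis using pos by simp
qed (auto simp: block_factor_def not_less_eq_eq)

lemma block_factor_pred:
  assumes "\<nu> > - 1 / 2"
  shows "block_factor \<nu> n m = (real (Suc m) - real n) * (real (Suc m) + real n + 2 * \<nu>) * block_factor \<nu> n (Suc m)"
proof (cases "n \<le> m")
  case True
  have "2 * \<nu> + real n + real m + 1 \<notin> \<int>\<^sub>\<le>\<^sub>0" using assms by (auto elim!: nonpos_Ints_cases)
  from Gamma_plus1[OF this]
  have G: "Gamma (2 * \<nu> + real n + real m + 2) =
      (2 * \<nu> + real n + real m + 1) * Gamma (2 * \<nu> + real n + real m + 1)"
    by (simp add: algebra_simps)
  have pos: "2 * \<nu> + real n + real m + 1 > 0" using assms by linarith
  hence Gp: "Gamma (2 * \<nu> + real n + real m + 1) > 0" by (rule Gamma_real_pos)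
  have F: "fact (Suc m - n) = (real (Suc m) - real n) * fact (m - n)"
    using True by (simp add: Suc_diff_le of_nat_diff)
  define G0 F0 where "G0 = Gamma (2 * \<nu> + real n + real m + 1)" and "F0 = (fact (m - n) :: real)"
  have "block_factor \<nu> n (Suc m) = 1 / ((real (Suc m) - real n) * F0 * ((2 * \<nu> + real n + real m + 1) * G0))"
  proof -
    have "2 * \<nu> + real n + real (Suc m) + 1 = 2 * \<nu> + real n + real m + 2" by simp
    moreover have "n \<le> Suc m" using True by simp
    ultimately show ?thesis unfolding block_factor_def F0_def G0_def G [symmetric] F [symmetric] by (simp only: if_True)
  qed
  moreover have "block_factor \<nu> n m = 1 / (F0 * G0)"
    using True by (simp add: block_factor_def G0_def F0_def)
  moreover have "real (Suc m) - real n \<noteq> 0" "F0 \<noteq> 0" "G0 \<noteq> 0" using True Gp by (auto simp: F0_def G0_def)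
  moreover have e: "real (Suc m) + real n + 2 * \<nu> = 2 * \<nu> + real n + real m + 1" by simp
  ultimately show ?thesis using pos unfolding e by simp
qed (auto simp: block_factor_def not_le less_Suc_eq_le)

lemma block_scale_Suc:
  assumes "\<nu> > - 1 / 2"
  shows "(\<nu> + real (Suc m)) * block_scale \<nu> (Suc m) = 2 * (2 * \<nu> + 2 * real (Suc m) - 1) * block_scale \<nu> m"
proof -
  have n: "\<nu> + real m + 1 \<notin> \<int>\<^sub>\<le>\<^sub>0" "2 * \<nu> + 2 * real m + 1 \<notin> \<int>\<^sub>\<le>\<^sub>0" "2 * \<nu> + 2 * real m + 2 \<notin> \<int>\<^sub>\<le>\<^sub>0"
    using assms by (auto elim!: nonpos_Ints_cases)
  define G0 G1 A B where "G0 = Gamma (\<nu> + real m + 1)" and "G1 = Gamma (2 * \<nu> + 2 * real m + 1)"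
    and "A = \<nu> + real m + 1" and "B = 2 * \<nu> + 2 * real m + 1"
  have e1: "Gamma (\<nu> + real (Suc m) + 1) = A * G0"
    using Gamma_plus1[OF n(1)] by (simp add: algebra_simps G0_def A_def)
  have e2: "Gamma (2 * \<nu> + 2 * real (Suc m) + 1) = 2 * A * (B * G1)"
    using Gamma_plus1[OF n(2)] Gamma_plus1[OF n(3)] by (simp add: algebra_simps G1_def A_def B_def)
  have "A > 0" using assms by (auto simp: A_def)
  hence pos: "A > 0" "G0 > 0" unfolding G0_def A_def by (auto intro: Gamma_real_pos)
  have e3: "\<nu> + real (Suc m) = A" "2 * \<nu> + 2 * real (Suc m) - 1 = B" by (simp_all add: A_def B_def)
  have "A * (2 * A * (B * G1) / (A * G0)\<^sup>2) = 2 * B * (G1 / G0\<^sup>2)"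
    using pos by (simp add: power2_eq_square)
  thus ?thesis unfolding block_scale_def e1 e2 e3(2) unfolding e3(1) G0_def [symmetric] G1_def [symmetric] .
qed

text \<open>
  Coefficientwise, and up to the scale and a sign, this is the identity
  \<open>(\<theta> + \<nu>) (B\<^sub>k + 2 (B\<^bsub>k+1\<^esub> + B\<^bsub>k+2\<^esub> + \<dots>)) = (\<nu> + k) B\<^sub>k\<close> for the blocks \<open>B\<^sub>k\<close>,
  where \<open>\<theta> = v d/dv\<close>. So \<open>\<theta> + \<nu>\<close> has an inverse that maps blocks to non-negative combinations of blocks.
\<close>

lemma block_factor_telescope:
  assumes "\<nu> > - 1 / 2"
  shows "(\<nu> + real m) * (\<Sum>n\<le>m. (-1) ^ n * (2 * (\<Sum>k<n. q k) + q n) * block_factor \<nu> n m) =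
           (\<Sum>n\<le>m. (-1) ^ n * (\<nu> + real n) * q n * block_factor \<nu> n m)"
proof -
  let ?M = "\<nu> + real m"
  have "(\<Sum>n\<le>N. (-1) ^ n * (?M * (2 * (\<Sum>k<n. q k) + q n) - (\<nu> + real n) * q n) * block_factor \<nu> n m) =
          (-1) ^ N * (real m - real N) * block_factor \<nu> N m * (\<Sum>k\<le>N. q k)" for N
  proof (induction N)
    case (Suc N)
    define S u where "S = (\<Sum>k\<le>N. q k)" and "u = block_factor \<nu> (Suc N) m"
    have "(\<Sum>n\<le>Suc N. (-1) ^ n * (?M * (2 * (\<Sum>k<n. q k) + q n) - (\<nu> + real n) * q n) * block_factor \<nu> n m) =
          (-1) ^ N * ((real m - real N) * block_factor \<nu> N m) * S -
          (-1) ^ N * (?M * (2 * S + q (Suc N)) - (\<nu> + real (Suc N)) * q (Suc N)) * u"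
      unfolding sum.atMost_Suc Suc S_def u_def lessThan_Suc_atMost by simp
    also have "(real m - real N) * block_factor \<nu> N m = (2 * \<nu> + real N + real m + 1) * u"
      unfolding u_def using block_factor_Suc[OF assms, of N m] by simp
    also have "(-1) ^ N * ((2 * \<nu> + real N + real m + 1) * u) * S -
          (-1) ^ N * (?M * (2 * S + q (Suc N)) - (\<nu> + real (Suc N)) * q (Suc N)) * u =
          (-1) ^ Suc N * (real m - real (Suc N)) * u * (S + q (Suc N))"
      by (simp add: algebra_simps)
    finally show ?case by (simp add: S_def u_def)
  qed (simp add: algebra_simps)
  from this[of m] have "(\<Sum>n\<le>m. (-1) ^ n * (?M * (2 * (\<Sum>k<n. q k) + q n) - (\<nu> + real n) * q n) * block_factor \<nu> n m) = 0"
    by simp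
  thus ?thesis
    by (simp add: algebra_simps sum_distrib_left sum.distrib sum_subtractf)
qed

text \<open>
  The sum over the earlier indices of the same parity. It arises because, for \<open>\<alpha> > -1\<close>, the Turan expression
  \<open>J\<^bsub>\<alpha>\<^esub>\<^sup>2 - J\<^bsub>\<alpha>-1\<^esub> J\<^bsub>\<alpha>+1\<^esub>\<close> is a positive combination of the squares of
  \<open>J\<^bsub>\<alpha>+1\<^esub>, J\<^bsub>\<alpha>+3\<^esub>, J\<^bsub>\<alpha>+5\<^esub>, \<dots>\<close>.
\<close>

definition parity_sum :: "(nat \<Rightarrow> real) \<Rightarrow> nat \<Rightarrow> real" where
  "parity_sum c n = (\<Sum>k<n. if even (n + k) then c k else 0)"

lemma parity_sum_simps [simp]:
  "parity_sum c 0 = 0" "parity_sum c (Suc 0) = 0"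
  "parity_sum c (Suc (Suc n)) = parity_sum c n + c n"
  by (simp_all add: parity_sum_def)

text \<open>
  This expresses, coefficientwise, that \<open>\<theta>\<^sup>2 + (2\<nu> + 1)\<theta> + 4v\<close> maps the block \<open>B\<^sub>k\<close> to
  \<open>k (k + 2\<nu> + 1) B\<^sub>k\<close> plus a positive combination of \<open>B\<^bsub>k+2\<^esub>, B\<^bsub>k+4\<^esub>, \<dots>\<close>, the Turan expression.
\<close>

lemma block_factor_telescope_parity:
  assumes "\<nu> > - 1 / 2"
  shows "(2 * \<nu> + 2 * real m - 1) * (\<Sum>n\<le>m. (-1) ^ n * (2 * (\<nu> + real n) * parity_sum c n) * block_factor \<nu> n m) =
           (\<Sum>n\<le>m. (-1) ^ n * (real m - real n) * (real m - real n - 1) * c n * block_factor \<nu> n m)"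
proof -
  define A where "A = (\<lambda>n. (2 * \<nu> + real n + real m) * (2 * \<nu> + real n + real m - 1) * block_factor \<nu> n m)"
  have A2: "A (Suc (Suc n)) = (real m - real n) * (real m - real n - 1) * block_factor \<nu> n m" for n
  proof -
    have "A (Suc (Suc n)) = (2 * \<nu> + real (Suc n) + real m) *
            ((2 * \<nu> + real (Suc n) + real m + 1) * block_factor \<nu> (Suc (Suc n)) m)"
      by (simp add: A_def algebra_simps)
    also have "\<dots> = (real m - real (Suc n)) * ((2 * \<nu> + real n + real m + 1) * block_factor \<nu> (Suc n) m)"
      by (subst block_factor_Suc[OF assms]) (simp add: algebra_simps)
    also have "\<dots> = (real m - real n) * (real m - real n - 1) * block_factor \<nu> n m"
      unfolding block_factor_Suc[OF assms] by (simp add: algebra_simps)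
    finally show ?thesis .
  qed
  have diff: "2 * (\<nu> + real n) * (2 * \<nu> + 2 * real m - 1) * block_factor \<nu> n m = A n - A (Suc (Suc n))" for n
    unfolding A2 by (simp add: A_def algebra_simps)
  define X where "X = (\<lambda>n. (-1) ^ n * parity_sum c n * A n)"
  have tele: "(\<Sum>n\<le>N. X n - X (Suc (Suc n))) = - X (Suc N) - X (Suc (Suc N))" for N
    by (induction N) (simp_all add: X_def)
  have "X (Suc m) = 0" "X (Suc (Suc m)) = 0" by (simp_all add: X_def A_def block_factor_def)
  with tele[of m] have "(\<Sum>n\<le>m. X n - X (Suc (Suc n))) = 0" by simp
  also have "(\<Sum>n\<le>m. X n - X (Suc (Suc n))) =
      (\<Sum>n\<le>m. (-1) ^ n * parity_sum c n * (2 * (\<nu> + real n) * (2 * \<nu> + 2 * real m - 1) * block_factor \<nu> n m)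
              - (-1) ^ n * (real m - real n) * (real m - real n - 1) * c n * block_factor \<nu> n m)"
    unfolding diff by (intro sum.cong refl) (simp add: X_def A2 algebra_simps)
  finally show ?thesis
    by (simp add: sum_subtractf sum_distrib_left mult_ac)
qed

text \<open>
  The power series \<open>f\<close> in \<open>sum_of_squares_nonneg\<close> satisfies the differential equation
  \<open>D f + \<kappa> \<theta> f = \<epsilon> (\<theta>\<^sup>2 + (2\<nu> + 1)\<theta> + 4v) f\<close> with
  \<open>D = \<theta> (\<theta> + \<nu>) (\<theta> + 2\<nu>) + 4v (\<theta> + \<nu> + 1/2)\<close>. The blocks satisfy
  \<open>D B\<^sub>n = n (n + 2\<nu>) (\<theta> + \<nu>) B\<^sub>n\<close>. Inserting \<open>f = c\<^sub>0 B\<^sub>0 + c\<^sub>1 B\<^sub>1 + \<dots>\<close> and inverting \<open>\<theta> + \<nu>\<close> turns the equation into the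
  recursion stated last. Apart from the diagonal, all its terms are non-negative, and \<open>a > 0\<close> keeps the diagonal
  dominant on the left. Geometric growth of \<open>c\<close> is all that convergence requires.
\<close>

lemma square_coeffs_exist:
  fixes a \<nu> \<epsilon> \<kappa> :: real
  assumes a: "a > 0" and \<nu>: "\<nu> > - 1 / 2" and \<epsilon>: "\<epsilon> = \<nu> + 1 / 2 - a" "\<epsilon> \<ge> 0"
    and \<kappa>: "\<kappa> \<ge> 0" "\<kappa> = 0 \<or> \<nu> > 0"
  obtains c q p K where
    "c 0 = 1" "\<And>n. c n \<ge> 0" "K \<ge> 1" "\<And>n. c n \<le> K ^ n"
    "\<And>n. (\<nu> + real n) * q n = \<nu> * c n"
    "\<And>n. (\<nu> + real n) * p n = real n * (real n + 2 * \<nu> + 1) * c n + 2 * (\<nu> + real n) * parity_sum c n"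
    "\<And>n. c n * (real n * (real n + 2 * \<nu>) + \<kappa>) =
        \<kappa> * (2 * (\<Sum>k<n. q k) + q n) + \<epsilon> * (2 * (\<Sum>k<n. p k) + p n)"
proof -
  let ?\<mu> = "\<lambda>n::nat. \<nu> + real n"
  define Q where "Q = (\<lambda>c (n::nat). if n = 0 \<and> \<nu> = 0 then 0 else \<nu> * c n / ?\<mu> n :: real)"
  define P where "P = (\<lambda>c (n::nat). real n * (real n + 2 * \<nu> + 1) * c n / ?\<mu> n + 2 * parity_sum c n)"
  \<comment> \<open>the factor of \<open>c n\<close> after the diagonal terms of \<open>Q\<close> and \<open>P\<close> are moved to the left\<close>
  define D where "D = (\<lambda>n::nat. real n * (real n + 2 * \<nu>) + \<kappa> * real n / ?\<mu> n - \<epsilon> * (real n * (real n + 2 * \<nu> + 1)) / ?\<mu> n)"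
  define \<Phi> where "\<Phi> = (\<lambda>n c. if n = 0 then 1 else
      (\<kappa> * (2 * (\<Sum>k<n. Q c k)) + \<epsilon> * (2 * (\<Sum>k<n. P c k) + 2 * parity_sum c n)) / D n)"
  have "\<exists>c. \<forall>n. c n = \<Phi> n c"
  proof (rule strong_recursion_exists)
    fix n and f g :: "nat \<Rightarrow> real"
    assume eq: "\<And>k. k < n \<Longrightarrow> f k = g k"
    have ps: "parity_sum f k = parity_sum g k" if "k \<le> n" for k
      using that eq unfolding parity_sum_def by (intro sum.cong) auto
    have "(\<Sum>k<n. Q f k) = (\<Sum>k<n. Q g k)" "(\<Sum>k<n. P f k) = (\<Sum>k<n. P g k)"
      unfolding Q_def P_def using eq ps by (auto intro!: sum.cong)
    thus "\<Phi> n f = \<Phi> n g" unfolding \<Phi>_def using ps[of n] by simp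
  qed
  then obtain c where c: "\<And>n. c n = \<Phi> n c" by blast
  have \<mu>: "?\<mu> n > 0" if "n > 0" for n using that \<nu> by (cases n) auto
  define d where "d = min 1 (2 * a)"
  have d: "d > 0" "d \<le> 1" "d \<le> 2 * a" using a by (auto simp: d_def)
  have D: "D n \<ge> d * real n" "D n > 0" "D n \<ge> d * real n * real n" if "n > 0" for n
  proof -
    have "real n * (real n + 2 * \<nu> + 1) / ?\<mu> n \<le> 2 * real n"
      using \<mu>[OF that] that by (simp add: field_simps)
    from mult_left_mono[OF this \<epsilon>(2)]
    have "\<epsilon> * (real n * (real n + 2 * \<nu> + 1)) / ?\<mu> n \<le> 2 * \<epsilon> * real n" by simp
    moreover have "\<kappa> * real n / ?\<mu> n \<ge> 0" using \<kappa> \<mu>[OF that] by simp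
    ultimately have "D n \<ge> real n * (real n - 1 + 2 * a)"
      unfolding D_def \<epsilon>(1) by (simp add: algebra_simps)
    moreover have "real n - 1 + 2 * a \<ge> d * real n"
    proof -
      have "d * (real n - 1) \<le> 1 * (real n - 1)" using that d by (intro mult_right_mono) auto
      thus ?thesis using d by (simp add: algebra_simps)
    qed
    hence "real n * (d * real n) \<le> real n * (real n - 1 + 2 * a)" by (intro mult_left_mono) auto
    ultimately have "real n * (d * real n) \<le> D n" by linarith
    thus 1: "D n \<ge> d * real n * real n" by (simp only: mult_ac)
    have "d * real n * 1 \<le> d * real n * real n" using that d by (intro mult_left_mono) auto
    with 1 show 2: "D n \<ge> d * real n" by simp
    moreover have "d * real n > 0" using d that by simp
    ultimately show "D n > 0" by linarith
  qed
  have c0: "c 0 = 1" using c[of 0] by (simp add: \<Phi>_def)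
  have Qb: "0 \<le> \<kappa> * Q c k \<and> \<kappa> * Q c k \<le> \<kappa> * c k" if "c k \<ge> 0" for k
  proof (cases "\<kappa> = 0")
    case False
    hence "\<nu> > 0" "\<kappa> > 0" using \<kappa> by auto
    hence "\<nu> * c k / ?\<mu> k \<le> c k" "\<nu> * c k / ?\<mu> k \<ge> 0" using that by (auto simp: field_simps)
    hence "0 \<le> Q c k \<and> Q c k \<le> c k" using \<open>\<nu> > 0\<close> by (simp add: Q_def)
    thus ?thesis using \<open>\<kappa> > 0\<close> by (auto intro: mult_left_mono)
  qed auto
  have psb: "0 \<le> parity_sum c n \<and> parity_sum c n \<le> (\<Sum>k<n. c k)" if "\<And>k. k < n \<Longrightarrow> c k \<ge> 0" for n
    unfolding parity_sum_def using that by (auto intro!: sum_nonneg sum_mono)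
  have Pb: "0 \<le> P c k \<and> P c k \<le> 2 * real k * c k + 2 * (\<Sum>j<k. c j)" if "\<And>j. j \<le> k \<Longrightarrow> c j \<ge> 0" for k
  proof (cases "k = 0")
    case False
    define t where "t = real k * (real k + 2 * \<nu> + 1) / ?\<mu> k"
    have "real k * (real k + 2 * \<nu> + 1) \<ge> 0" using \<nu> by (intro mult_nonneg_nonneg) auto
    hence "0 \<le> t" "t \<le> 2 * real k"
      using \<mu>[of k] False by (simp_all add: t_def divide_le_eq algebra_simps)
    hence "0 \<le> t * c k" "t * c k \<le> 2 * real k * c k"
      using that[of k] by (auto intro: mult_right_mono)
    moreover have "P c k = t * c k + 2 * parity_sum c k" by (simp add: P_def t_def)
    ultimately show ?thesis using psb[of k] that by auto
  qed (simp add: P_def)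
  define r where "r = (2 * \<kappa> + 10 * \<epsilon>) / d"
  have r: "r \<ge> 0" using \<kappa> \<epsilon> d by (simp add: r_def)
  have main: "c n \<ge> 0 \<and> c n \<le> (1 + r) ^ n" for n
  proof (induction n rule: less_induct)
    case (less n)
    show ?case
    proof (cases "n = 0")
      case False
      define S where "S = (\<Sum>k<n. c k)"
      have nn: "c k \<ge> 0" if "k < n" for k using less that by blast
      have S0: "S \<ge> 0" unfolding S_def using nn by (intro sum_nonneg) auto
      define N where "N = \<kappa> * (2 * (\<Sum>k<n. Q c k)) + \<epsilon> * (2 * (\<Sum>k<n. P c k) + 2 * parity_sum c n)"
      have cn: "c n = N / D n" using c[of n] False by (simp add: \<Phi>_def N_def)
      have 1: "0 \<le> \<kappa> * (\<Sum>k<n. Q c k)" "\<kappa> * (\<Sum>k<n. Q c k) \<le> \<kappa> * S"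
        unfolding S_def sum_distrib_left using Qb nn by (auto intro!: sum_nonneg sum_mono)
      have 2: "0 \<le> (\<Sum>k<n. P c k)" using Pb nn by (intro sum_nonneg) auto
      have "P c k \<le> 2 * real n * c k + 2 * S" if "k < n" for k
      proof -
        have "P c k \<le> 2 * real k * c k + 2 * (\<Sum>j<k. c j)" using Pb[of k] nn that by auto
        also have "(\<Sum>j<k. c j) \<le> S" unfolding S_def using nn that by (intro sum_mono2) auto
        also have "2 * real k * c k \<le> 2 * real n * c k" using nn that by (intro mult_right_mono) auto
        finally show ?thesis by simp
      qed
      hence "(\<Sum>k<n. P c k) \<le> (\<Sum>k<n. 2 * real n * c k + 2 * S)" by (intro sum_mono) auto
      also have "\<dots> = 4 * real n * S" by (simp add: sum.distrib sum_distrib_left [symmetric] S_def)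
      finally have 3: "(\<Sum>k<n. P c k) \<le> 4 * real n * S" .
      have 4: "0 \<le> parity_sum c n" "parity_sum c n \<le> S" using psb[of n] nn by (auto simp: S_def)
      have n1: "real n \<ge> 1" using False by linarith
      have N0: "N \<ge> 0" unfolding N_def using 1 2 4 \<epsilon> by simp
      have "\<epsilon> * (2 * (\<Sum>k<n. P c k) + 2 * parity_sum c n) \<le> \<epsilon> * (2 * (4 * real n * S) + 2 * S)"
        using 3 4 \<epsilon>(2) by (intro mult_left_mono) auto
      hence "N \<le> 2 * (\<kappa> * S) + \<epsilon> * (2 * (4 * real n * S) + 2 * S)"
        unfolding N_def using 1 by (simp add: algebra_simps)
      also have "\<dots> \<le> 2 * (\<kappa> * S) * real n + \<epsilon> * (2 * (4 * real n * S) + 2 * S * real n)"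
        using n1 S0 \<epsilon>(2) \<kappa>(1) mult_left_mono[of 1 "real n" "\<kappa> * S"] mult_left_mono[of 1 "real n" S]
        by (intro add_mono mult_left_mono) auto
      also have "\<dots> = r * S * (d * real n)" using d by (simp add: r_def field_simps)
      finally have "N \<le> r * S * (d * real n)" .
      also have "\<dots> \<le> r * S * D n" using D(1)[of n] False r S0 by (intro mult_left_mono) auto
      finally have "c n \<le> r * S" using D(2)[of n] False by (simp add: cn field_simps)
      also have "\<dots> \<le> r * (\<Sum>k<n. (1 + r) ^ k)"
        unfolding S_def using less r by (intro mult_left_mono sum_mono) auto
      also have "\<dots> = (1 + r) ^ n - 1"
        using power_diff_1_eq[of "1 + r" n] by simp
      also have "\<dots> \<le> (1 + r) ^ n" by simp
      finally show ?thesis using N0 D(2)[of n] False by (simp add: cn)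
    qed (simp add: c0)
  qed
  show ?thesis
  proof (rule that[of c "1 + r" "Q c" "P c"])
    show q: "?\<mu> n * Q c n = \<nu> * c n" for n
      using \<mu>[of n] by (cases "n = 0") (auto simp: Q_def)
    show p: "?\<mu> n * P c n = real n * (real n + 2 * \<nu> + 1) * c n + 2 * ?\<mu> n * parity_sum c n" for n
      using \<mu>[of n] by (cases "n = 0") (auto simp: P_def distrib_left)
    show "c n * (real n * (real n + 2 * \<nu>) + \<kappa>) =
        \<kappa> * (2 * (\<Sum>k<n. Q c k) + Q c n) + \<epsilon> * (2 * (\<Sum>k<n. P c k) + P c n)" for n
    proof (cases "n = 0")
      case True
      thus ?thesis using \<kappa> by (auto simp: c0 Q_def P_def)
    next
      case False
      hence \<mu>n: "?\<mu> n > 0" using \<mu> by simp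
      have "c n * D n = \<kappa> * (2 * (\<Sum>k<n. Q c k)) + \<epsilon> * (2 * (\<Sum>k<n. P c k) + 2 * parity_sum c n)"
        using c[of n] D(2)[of n] False by (simp add: \<Phi>_def)
      moreover have "c n * (real n * (real n + 2 * \<nu>) + \<kappa>) =
          c n * D n + \<kappa> * Q c n + \<epsilon> * (P c n - 2 * parity_sum c n)"
      proof -
        define t where "t = inverse (?\<mu> n)"
        have t: "?\<mu> n * t = 1" using \<mu>n by (simp add: t_def)
        have "D n = real n * (real n + 2 * \<nu>) + \<kappa> * real n * t - \<epsilon> * (real n * (real n + 2 * \<nu> + 1)) * t"
          "Q c n = \<nu> * c n * t" "P c n = real n * (real n + 2 * \<nu> + 1) * c n * t + 2 * parity_sum c n"
          using False by (simp_all add: D_def Q_def P_def t_def divide_inverse)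
        thus ?thesis using t by algebra
      qed
      ultimately show ?thesis by (simp add: algebra_simps)
    qed
  qed (use main c0 r in auto)
qed


text \<open>
  With \<open>M = \<nu> + m\<close>, the two telescoping identities eliminate the sums \<open>q\<close> and \<open>p\<close>. What is left are the
  sums of \<open>c n\<close>, \<open>n c n\<close> and \<open>n\<^sup>2 c n\<close> against the block factors, and a polynomial identity.
\<close>

lemma square_coeff_recursion:
  fixes a \<nu> \<epsilon> \<kappa> :: real and c q p :: "nat \<Rightarrow> real"
  assumes \<nu>: "\<nu> > - 1 / 2" and \<epsilon>: "\<epsilon> = \<nu> + 1 / 2 - a"
    and q: "\<And>n. (\<nu> + real n) * q n = \<nu> * c n"
    and p: "\<And>n. (\<nu> + real n) * p n = real n * (real n + 2 * \<nu> + 1) * c n + 2 * (\<nu> + real n) * parity_sum c n"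
    and c: "\<And>n. c n * (real n * (real n + 2 * \<nu>) + \<kappa>) =
        \<kappa> * (2 * (\<Sum>k<n. q k) + q n) + \<epsilon> * (2 * (\<Sum>k<n. p k) + p n)"
  defines "g \<equiv> (\<lambda>m. \<Sum>n\<le>m. (-1) ^ n * c n * block_factor \<nu> n m)"
  assumes m: "m = Suc m'"
  shows "(real m * (real m + \<nu>) * (real m + 2 * \<nu>) + \<kappa> * real m - \<epsilon> * real m * (real m + 2 * \<nu> + 1)) *
           (2 * \<nu> + 2 * real m - 1) * g m = (\<nu> + real m) * (2 * real m - 2 + 2 * a) * g m'"
proof -
  define M where "M = \<nu> + real m"
  define s where "s = (\<lambda>w. \<Sum>n\<le>m. (-1) ^ n * w n * block_factor \<nu> n m)"
  have s_add: "s (\<lambda>n. w n + w' n) = s w + s w'" for w w'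
    by (simp add: s_def algebra_simps sum.distrib)
  have s_scale: "s (\<lambda>n. r * w n) = r * s w" for r w
    by (simp add: s_def algebra_simps sum_distrib_left)
  have 1: "M * s (\<lambda>n. 2 * (\<Sum>k<n. q k) + q n) = \<nu> * s c"
    using block_factor_telescope[OF \<nu>, of m q] unfolding M_def s_def s_scale [unfolded s_def, symmetric]
    by (simp add: mult.assoc q flip: q)
  have 2: "M * s (\<lambda>n. 2 * (\<Sum>k<n. p k) + p n) =
             s (\<lambda>n. real n * (real n + 2 * \<nu> + 1) * c n + 2 * (\<nu> + real n) * parity_sum c n)"
    using block_factor_telescope[OF \<nu>, of m p] unfolding M_def s_def p [symmetric] by (simp add: mult.assoc)
  define l where "l = s (\<lambda>n. real n * (real n + 2 * \<nu>) * c n)"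
  define l1 where "l1 = s (\<lambda>n. real n * c n)"
  define l2 where "l2 = s (\<lambda>n. real n ^ 2 * c n)"
  define y where "y = s (\<lambda>n. 2 * (\<nu> + real n) * parity_sum c n)"
  have ll: "l = l2 + 2 * \<nu> * l1"
    unfolding l_def l1_def l2_def s_scale [symmetric] s_add [symmetric]
    by (simp add: algebra_simps power2_eq_square)
  have gm: "g m = s c" by (simp add: g_def s_def)
  have "M * s (\<lambda>n. c n * (real n * (real n + 2 * \<nu>) + \<kappa>)) = M * (l + \<kappa> * s c)"
    unfolding l_def s_scale [symmetric] s_add [symmetric] by (simp add: algebra_simps)
  moreover have "M * s (\<lambda>n. c n * (real n * (real n + 2 * \<nu>) + \<kappa>)) =
      \<kappa> * (M * s (\<lambda>n. 2 * (\<Sum>k<n. q k) + q n)) + \<epsilon> * (M * s (\<lambda>n. 2 * (\<Sum>k<n. p k) + p n))"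
    unfolding c s_add s_scale by (simp add: algebra_simps)
  moreover have "s (\<lambda>n. real n * (real n + 2 * \<nu> + 1) * c n + 2 * (\<nu> + real n) * parity_sum c n) = l + l1 + y"
    unfolding l_def l1_def y_def s_add [symmetric] by (simp add: algebra_simps)
  ultimately have eq1: "M * (l + \<kappa> * s c) = \<kappa> * (\<nu> * s c) + \<epsilon> * (l + l1 + y)"
    unfolding 1 2 by simp
  have "(2 * M - 1) * y = s (\<lambda>n. (real m - real n) * (real m - real n - 1) * c n)"
    using block_factor_telescope_parity[OF \<nu>, of m c] by (simp add: M_def y_def s_def algebra_simps)
  also have "\<dots> = l2 + (1 - 2 * real m) * l1 + (real m * (real m - 1)) * s c"
    unfolding l2_def l1_def s_scale [symmetric] s_add [symmetric]
    by (simp add: algebra_simps power2_eq_square)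
  finally have eq2: "(2 * M - 1) * y = l2 + (1 - 2 * real m) * l1 + (real m * (real m - 1)) * s c" .
  have "g m' = (\<Sum>n\<le>m'. (-1) ^ n * c n * ((real m - real n) * (real m + real n + 2 * \<nu>) * block_factor \<nu> n m))"
    unfolding g_def m by (rule sum.cong, rule refl, subst block_factor_pred[OF \<nu>], rule refl)
  also have "\<dots> = s (\<lambda>n. (real m - real n) * (real m + real n + 2 * \<nu>) * c n)"
    by (simp add: s_def m mult_ac)
  also have "\<dots> = (real m * (real m + 2 * \<nu>)) * s c + (- 1) * l"
    unfolding l_def s_scale [symmetric] s_add [symmetric] by (simp add: algebra_simps)
  finally have gm': "g m' = (real m * (real m + 2 * \<nu>)) * s c - l" by simp
  have \<nu>M: "\<nu> = M - real m" by (simp add: M_def)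
  have aM: "a = \<nu> + 1 / 2 - \<epsilon>" using \<epsilon> by simp
  have e3: "(2 * M - 1) * (M * l + M * \<kappa> * s c - \<kappa> * (\<nu> * s c) - \<epsilon> * (l + l1)) =
      \<epsilon> * (l2 + (1 - 2 * real m) * l1 + (real m * (real m - 1)) * s c)"
    unfolding eq2 [symmetric] using eq1 by algebra
  show ?thesis
    using e3 ll unfolding gm gm' aM \<nu>M by algebra
qed


lemma Gamma_ge_fact:
  fixes \<alpha> :: real
  assumes "\<alpha> > - 1"
  shows "\<exists>d>0. \<forall>k::nat. Gamma (\<alpha> + real k + 2) \<ge> d * fact k"
proof (intro exI conjI allI)
  show pos: "Gamma (\<alpha> + 2) > 0" using assms by (intro Gamma_real_pos) auto
  show "Gamma (\<alpha> + real k + 2) \<ge> Gamma (\<alpha> + 2) * fact k" for k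
  proof (induction k)
    case (Suc k)
    have "\<alpha> + real k + 2 \<notin> \<int>\<^sub>\<le>\<^sub>0" using assms by (auto elim!: nonpos_Ints_cases)
    from Gamma_plus1[OF this]
    have "Gamma (\<alpha> + real (Suc k) + 2) = (\<alpha> + real k + 2) * Gamma (\<alpha> + real k + 2)"
      by (simp add: algebra_simps)
    also have "\<dots> \<ge> (real k + 1) * (Gamma (\<alpha> + 2) * fact k)"
      using Suc assms pos by (intro mult_mono) auto
    finally show ?case by (simp add: mult_ac add_ac)
  qed auto
qed

text \<open>
  A two-term recursion determines \<open>f\<close> up to its first coefficient, and the combination of blocks with the
  non-negative coefficients \<open>c\<close> satisfies the same recursion. The hypothesis on \<open>\<kappa>\<close> and \<open>\<nu>\<close> keeps the term
  \<open>\<kappa> \<nu>\<close> in the recursion of the \<open>c n\<close> non-negative.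
\<close>

theorem sum_of_squares_nonneg:
  fixes a \<nu> \<epsilon> \<kappa> v :: real and f :: "nat \<Rightarrow> real"
  assumes a: "a > 0" and \<nu>: "\<nu> > - 1 / 2" and \<epsilon>: "\<epsilon> = \<nu> + 1 / 2 - a" "\<epsilon> \<ge> 0"
    and \<kappa>: "\<kappa> \<ge> 0" "\<kappa> = 0 \<or> \<nu> > 0" and v: "v \<ge> 0" and f0: "f 0 \<ge> 0"
    and rec: "\<And>m. real (Suc m) * ((real (Suc m) + \<nu>) * (real (Suc m) + 2 * \<nu>) + \<kappa> -
                 \<epsilon> * (real (Suc m) + 2 * \<nu> + 1)) * f (Suc m) = - 4 * (real m + a) * f m"
  shows "(\<Sum>m. f m * v ^ m) \<ge> 0"
proof -
  obtain c q p K where c: "c 0 = 1" "\<And>n. c n \<ge> 0" "K \<ge> 1" "\<And>n. c n \<le> K ^ n"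
    "\<And>n. (\<nu> + real n) * q n = \<nu> * c n"
    "\<And>n. (\<nu> + real n) * p n = real n * (real n + 2 * \<nu> + 1) * c n + 2 * (\<nu> + real n) * parity_sum c n"
    "\<And>n. c n * (real n * (real n + 2 * \<nu>) + \<kappa>) =
        \<kappa> * (2 * (\<Sum>k<n. q k) + q n) + \<epsilon> * (2 * (\<Sum>k<n. p k) + p n)"
    using square_coeffs_exist[OF a \<nu> \<epsilon> \<kappa>] by metis
  define g where "g = (\<lambda>m. \<Sum>n\<le>m. (-1) ^ n * c n * block_factor \<nu> n m)"
  define h where "h = block_scale \<nu>"
  define F where "F = (\<lambda>m. (-1) ^ m * h m * g m)"
  define C where "C = (\<lambda>m. real (Suc m) * ((real (Suc m) + \<nu>) * (real (Suc m) + 2 * \<nu>) + \<kappa> -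
                 \<epsilon> * (real (Suc m) + 2 * \<nu> + 1)))"
  have Cpos: "C m > 0" for m
  proof -
    let ?t = "real (Suc m) + 2 * \<nu>"
    have "\<epsilon> * (?t + 1) < ?t / 2 * (?t + 1)"
      using \<nu> \<epsilon>(1) a by (intro mult_strict_right_mono) auto
    also have "\<dots> = ((?t + 1) / 2) * ?t" by simp
    also have "\<dots> \<le> (real (Suc m) + \<nu>) * ?t"
      using \<nu> by (intro mult_right_mono) auto
    finally show ?thesis using \<kappa>(1) unfolding C_def by (intro mult_pos_pos) auto
  qed
  have Frec: "C m * F (Suc m) = - 4 * (real m + a) * F m" for m
  proof -
    define M where "M = \<nu> + real (Suc m)"
    define T where "T = 2 * \<nu> + 2 * real (Suc m) - 1"
    have pos: "M > 0" "T > 0" using \<nu> by (auto simp: M_def T_def)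
    have 1: "M * h (Suc m) = 2 * T * h m"
      using block_scale_Suc[OF \<nu>, of m] by (simp add: M_def T_def h_def)
    have "C m * T * g (Suc m) = M * (2 * real (Suc m) - 2 + 2 * a) * g m"
      using square_coeff_recursion[OF \<nu> \<epsilon>(1) c(5-7) refl, of m] unfolding C_def T_def M_def g_def
      by (simp only: ring_distribs mult_ac)
    hence 2: "C m * T * g (Suc m) = M * (2 * (real m + a)) * g m" by simp
    have "M * T * (C m * F (Suc m)) = (-1) ^ Suc m * (M * h (Suc m)) * (C m * T * g (Suc m))"
      by (simp add: F_def)
    also have "\<dots> = M * T * (- 4 * (real m + a) * F m)"
      unfolding 1 2 by (simp add: F_def algebra_simps)
    finally show ?thesis using pos by simp
  qed
  have hpos: "h m > 0" for m
    unfolding h_def block_scale_def using \<nu> by (intro divide_pos_pos zero_less_power Gamma_real_pos) auto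
  have F0: "F 0 > 0"
    using hpos[of 0] \<nu> by (auto simp: F_def g_def c(1) block_factor_def intro!: Gamma_real_pos)
  have fF: "f m = f 0 / F 0 * F m" for m
  proof (induction m)
    case (Suc m)
    have "C m * f (Suc m) = - 4 * (real m + a) * f m" unfolding C_def by (rule rec)
    also have "\<dots> = f 0 / F 0 * (- 4 * (real m + a) * F m)" by (subst Suc) (simp only: mult_ac)
    also have "\<dots> = C m * (f 0 / F 0 * F (Suc m))" unfolding Frec [symmetric] by (simp only: mult_ac)
    finally have "C m * f (Suc m) = C m * (f 0 / F 0 * F (Suc m))" .
    thus ?case using Cpos[of m] by (metis mult_left_cancel less_irrefl)
  qed (use F0 in auto)

  \<comment> \<open>a common majorant for the coefficients of all partial sums over blocks, as needed for Tannery's theorem\<close>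
  define A where "A = (\<lambda>m. \<Sum>n\<le>m. c n * h m * block_factor \<nu> n m * v ^ m)"
  have u0: "block_factor \<nu> n m \<ge> 0" for n m using \<nu> by (auto simp: block_factor_def intro!: Gamma_real_nonneg)
  obtain d where d: "d > 0" "\<And>k::nat. Gamma (2 * \<nu> + real k + 2) \<ge> d * fact k"
    using Gamma_ge_fact[of "2 * \<nu>"] \<nu> by auto
  have hle: "h m \<le> h 0 * 4 ^ m" for m
  proof (induction m)
    case (Suc m)
    define M where "M = \<nu> + real (Suc m)"
    have M: "M > 0" using \<nu> by (simp add: M_def)
    have "M * h (Suc m) = 2 * (2 * M - 1) * h m"
      using block_scale_Suc[OF \<nu>, of m] by (simp add: M_def h_def algebra_simps)
    also have "\<dots> \<le> M * (4 * h m)" using hpos[of m] by (simp add: algebra_simps)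
    finally have "h (Suc m) \<le> 4 * h m" using M by simp
    thus ?case using Suc by simp
  qed auto
  have ule: "block_factor \<nu> n (Suc m) \<le> 1 / (d * fact m)" for n m
  proof (cases "n \<le> Suc m")
    case True
    have G: "Gamma (2 * \<nu> + real (n + m) + 2) \<ge> d * fact m"
    proof -
      have "d * fact m \<le> d * fact (n + m)" using d by (intro mult_left_mono fact_mono) auto
      thus ?thesis using d(2)[of "n + m"] by linarith
    qed
    have dm: "d * fact m > 0" using d by simp
    have "1 * (d * fact m) \<le> fact (Suc m - n) * Gamma (2 * \<nu> + real (n + m) + 2)"
      using G dm by (intro mult_mono) (auto simp: fact_ge_1)
    hence "1 / (fact (Suc m - n) * Gamma (2 * \<nu> + real (n + m) + 2)) \<le> 1 / (d * fact m)"
      using dm by (intro frac_le) auto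
    moreover have "2 * \<nu> + real n + real (Suc m) + 1 = 2 * \<nu> + real (n + m) + 2" by simp
    ultimately show ?thesis using True by (simp only: block_factor_def if_True)
  qed (use d in \<open>auto simp: block_factor_def\<close>)
  have A: "summable A"
  proof (subst summable_Suc_iff [symmetric], rule summable_comparison_test'[where N = 0])
    let ?y = "8 * K * v"
    show "summable (\<lambda>m. (8 * K * v * h 0 / d) * (inverse (fact m) * ?y ^ m))"
      by (intro summable_mult summable_exp)
    fix m
    have "0 \<le> A (Suc m)" unfolding A_def using c(2) hpos[of "Suc m"] u0 v by (intro sum_nonneg) auto
    hence "norm (A (Suc m)) = A (Suc m)" by simp
    also have "\<dots> \<le> (\<Sum>n\<le>Suc m. K ^ Suc m * (h 0 * 4 ^ Suc m) * (1 / (d * fact m)) * v ^ Suc m)"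
      unfolding A_def
    proof (intro sum_mono mult_right_mono mult_mono)
      fix n assume "n \<in> {..Suc m}"
      thus "c n \<le> K ^ Suc m" using c(4)[of n] power_increasing[of n "Suc m" K] c(3) by auto
      show "h (Suc m) \<le> h 0 * 4 ^ Suc m" by (rule hle)
      show "block_factor \<nu> n (Suc m) \<le> 1 / (d * fact m)" by (rule ule)
      show "0 \<le> block_factor \<nu> n (Suc m)" by (rule u0)
      show "0 \<le> h (Suc m)" using hpos[of "Suc m"] by simp
      show "0 \<le> K ^ Suc m" using c(3) by simp
      thus "0 \<le> K ^ Suc m * (h 0 * 4 ^ Suc m)" using hpos[of 0] by simp
      show "0 \<le> v ^ Suc m" using v by simp
    qed
    also have "\<dots> = real (m + 2) * (K ^ Suc m * (h 0 * 4 ^ Suc m) * (1 / (d * fact m)) * v ^ Suc m)"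
      by simp
    also have "\<dots> \<le> (2 * 2 ^ m) * (K ^ Suc m * (h 0 * 4 ^ Suc m) * (1 / (d * fact m)) * v ^ Suc m)"
    proof (rule mult_right_mono)
      have "m + 2 \<le> 2 * 2 ^ m" by (induction m) auto
      thus "real (m + 2) \<le> 2 * 2 ^ m" by (metis of_nat_le_iff of_nat_mult of_nat_numeral of_nat_power)
    qed (use c(3) hpos[of 0] d v in auto)
    also have "\<dots> = (8 * K * v * h 0 / d) * (inverse (fact m) * ?y ^ m)"
    proof -
      have "(8 :: real) ^ m = 2 ^ m * 4 ^ m" by (simp flip: power_mult_distrib)
      thus ?thesis using d by (simp add: power_mult_distrib field_simps)
    qed
    finally show "norm (A (Suc m)) \<le> (8 * K * v * h 0 / d) * (inverse (fact m) * ?y ^ m)" .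
  qed
  define FN where "FN = (\<lambda>m N. \<Sum>n\<le>N. c n * ((-1) ^ (m + n) * h m * block_factor \<nu> n m * v ^ m))"
  have FN_sums: "(\<lambda>m. FN m N) sums (\<Sum>n\<le>N. c n * (v ^ n * (bessel_series (\<nu> + real n) v) ^ 2))" for N
    unfolding FN_def h_def by (intro sums_sum sums_mult square_block_sums \<nu>)
  have FN_ev: "FN m N = F m * v ^ m" if "N \<ge> m" for m N
  proof -
    have "FN m N = (\<Sum>n\<le>m. c n * ((-1) ^ (m + n) * h m * block_factor \<nu> n m * v ^ m))"
      unfolding FN_def using that by (intro sum.mono_neutral_right) (auto simp: block_factor_def)
    thus ?thesis by (simp add: F_def g_def sum_distrib_left sum_distrib_right power_add mult_ac)
  qed
  have FN_bound: "norm (FN m N) \<le> A m" for m N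
  proof -
    have "norm (FN m N) \<le> (\<Sum>n\<le>N. norm (c n * ((-1) ^ (m + n) * h m * block_factor \<nu> n m * v ^ m)))"
      unfolding FN_def by (rule norm_sum)
    also have "\<dots> = (\<Sum>n\<le>N. c n * h m * block_factor \<nu> n m * v ^ m)"
      using c(2) hpos[of m] u0 v by (intro sum.cong) (auto simp: abs_mult power_abs)
    also have "\<dots> = (\<Sum>n\<in>{..N} \<inter> {..m}. c n * h m * block_factor \<nu> n m * v ^ m)"
      by (intro sum.mono_neutral_right) (auto simp: block_factor_def)
    also have "\<dots> \<le> A m"
      unfolding A_def using c(2) hpos[of m] u0 v by (intro sum_mono2) (auto intro: less_imp_le)
    finally show ?thesis .
  qed
  have "((\<lambda>N. suminf (\<lambda>m. FN m N)) \<longlongrightarrow> (\<Sum>m. F m * v ^ m)) sequentially"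
  proof (rule tannerys_theorem [THEN conjunct2, THEN conjunct2])
    show "((\<lambda>N. FN m N) \<longlongrightarrow> F m * v ^ m) sequentially" for m
      by (rule tendsto_eventually) (use FN_ev in \<open>auto simp: eventually_at_top_linorder\<close>)
    show "\<forall>\<^sub>F (m, N) in at_top \<times>\<^sub>F sequentially. norm (FN m N) \<le> A m"
      using FN_bound by (intro always_eventually) auto
  qed (use A in auto)
  moreover have "suminf (\<lambda>m. FN m N) \<ge> 0" for N
    unfolding sums_unique[OF FN_sums, symmetric] using c(2) v by (intro sum_nonneg) auto
  ultimately have nn: "(\<Sum>m. F m * v ^ m) \<ge> 0"
    by (intro tendsto_lowerbound[where F = sequentially]) auto
  have sF: "summable (\<lambda>m. F m * v ^ m)"
    by (rule summable_comparison_test'[OF A, of 0]) (use FN_bound FN_ev in \<open>metis order_refl\<close>)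
  have "(\<Sum>m. f m * v ^ m) = f 0 / F 0 * (\<Sum>m. F m * v ^ m)"
    using suminf_mult[OF sF, of "f 0 / F 0"] by (subst fF) (simp add: mult_ac)
  also have "\<dots> \<ge> 0" using nn f0 F0 by auto
  finally show ?thesis .
qed


section \<open>Necessary conditions\<close>

lemma completely_monotone_symbol_increase:
  assumes "completely_monotone (ml_symbol \<gamma> \<rho> a)" "a \<le> b"
  shows "completely_monotone (ml_symbol \<gamma> \<rho> b)"
proof (rule completely_monotone_cong)
  show "completely_monotone (\<lambda>s. s powr (- (b - a)) * ml_symbol \<gamma> \<rho> a s)"
    by (intro completely_monotone_mult completely_monotone_powr_neg assms) (use assms in simp)
  fix s :: real assume "s > 0"
  have "s powr (- (b - a)) * s powr (- a) = s powr (- b)" by (simp flip: powr_add)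
  thus "s powr (- (b - a)) * ml_symbol \<gamma> \<rho> a s = ml_symbol \<gamma> \<rho> b s"
    by (simp add: ml_symbol_def mult.assoc [symmetric])
qed

lemma completely_monotone_symbol_le_1:
  assumes "0 < \<rho>" "\<rho> \<le> 1" "\<gamma> > 0" "a \<ge> 0"
  shows "completely_monotone (ml_symbol \<gamma> \<rho> a)"
  unfolding ml_symbol_def [abs_def]
  using assms by (intro completely_monotone_mult completely_monotone_powr_neg completely_monotone_compose_powr[where f = "\<lambda>s. (1 + s) powr (- \<gamma>)"] completely_monotone_one_plus_powr_neg) auto

lemma completely_monotone_symbol_exponent_nonneg:
  assumes CM: "completely_monotone (ml_symbol \<gamma> \<rho> a)" and "\<gamma> > 0"
  shows "a \<ge> 0"
proof (rule ccontr)
  assume "\<not> a \<ge> 0"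
  hence a: "- a > 0" by simp
  define e where "e = 2 powr (- \<gamma>) / 2"
  have "2 powr (- \<gamma>) < (1::real)" using \<open>\<gamma> > 0\<close> by (simp add: powr_less_one)
  hence e: "0 < e" "e < 1" by (simp_all add: e_def)
  define s where "s = e powr (1 / (- a))"
  have "e powr (1 / (- a)) \<le> 1" using e a by (intro powr_le1) auto
  hence s: "0 < s" "s \<le> 1" using e by (auto simp: s_def)
  have "ml_symbol \<gamma> \<rho> a 1 \<le> ml_symbol \<gamma> \<rho> a s" by (rule completely_monotone_antimono[OF CM s])
  also have "\<dots> \<le> s powr (- a) * 1"
    unfolding ml_symbol_def
  proof (intro mult_left_mono)
    have "(1 + s powr \<rho>) powr (- \<gamma>) \<le> 1 powr (- \<gamma>)"
      using \<open>\<gamma> > 0\<close> by (intro powr_mono2') auto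
    thus "(1 + s powr \<rho>) powr (- \<gamma>) \<le> 1" by simp
  qed auto
  also have "s powr (- a) = e" using e a by (simp add: s_def powr_powr)
  finally show False using e by (simp add: ml_symbol_def e_def)
qed

text \<open>
  This comparison of complex values with real ones is what contradicts a complex singularity.
\<close>

lemma power_series_norm_le:
  fixes L :: "complex \<Rightarrow> complex"
  assumes h: "\<And>k. h k \<ge> 0" and s: "\<And>z. norm z < r \<Longrightarrow> (\<lambda>k. of_real (h k) * z ^ k) sums L (of_real s0 - z)"
    and w: "w < r" "norm z \<le> w"
  shows "norm (L (of_real s0 - z)) \<le> norm (L (of_real (s0 - w)))"
proof -
  have w0: "w \<ge> 0" using w norm_ge_zero[of z] by linarith
  have A: "(\<lambda>k. of_real (h k) * complex_of_real w ^ k) sums L (of_real s0 - of_real w)"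
    by (rule s) (use w w0 in auto)
  have B: "complex_of_real s0 - of_real w = of_real (s0 - w)" by simp
  have C: "(\<lambda>k. of_real (h k) * complex_of_real w ^ k) = (\<lambda>k. of_real (h k * w ^ k))" by simp
  have 1: "(\<lambda>k. complex_of_real (h k * w ^ k)) sums L (of_real (s0 - w))"
    using A unfolding B C .
  have 2: "summable (\<lambda>k. h k * w ^ k)" using sums_Re[OF 1] by (auto simp: sums_iff)
  hence "(\<lambda>k. complex_of_real (h k * w ^ k)) sums of_real (\<Sum>k. h k * w ^ k)"
    by (intro sums_of_real summable_sums)
  from sums_unique2[OF 1 this] have 3: "L (of_real (s0 - w)) = of_real (\<Sum>k. h k * w ^ k)" .
  have z: "(\<lambda>k. of_real (h k) * z ^ k) sums L (of_real s0 - z)" by (rule s) (use w in simp)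
  have le: "norm (of_real (h k) * z ^ k) \<le> h k * w ^ k" for k
    using h[of k] w by (auto simp: norm_mult norm_power intro!: mult_left_mono power_mono)
  have "norm (L (of_real s0 - z)) \<le> (\<Sum>k. h k * w ^ k)"
    unfolding sums_unique[OF z] by (rule norm_suminf_le[OF le 2])
  also have "\<dots> \<le> norm (L (of_real (s0 - w)))" unfolding 3 by simp
  finally show ?thesis .
qed

lemma norm_ml_symbol_complex:
  "norm (ml_symbol_complex \<gamma> \<rho> a s) = norm s powr (- a) * norm (1 + s powr of_real \<rho>) powr (- \<gamma>)"
  unfolding ml_symbol_complex_def norm_mult by (subst (1 2) norm_powr_real_powr') auto

lemma ml_symbol_nonneg: "ml_symbol \<gamma> \<rho> a s \<ge> 0"
  by (simp add: ml_symbol_def)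

text \<open>
  The symbol is of order \<open>\<sigma> powr - \<gamma>\<close> at \<open>\<sigma> + \<i>\<close> and of order \<open>\<sigma> powr - a\<close> at \<open>\<sigma> / 2\<close>, as \<open>\<sigma>\<close> tends to \<open>0\<close>. If the
  coefficients are non-negative, then the former is bounded by the latter, so that \<open>a \<ge> \<gamma>\<close>, that is \<open>\<mu> \<ge> 3\<gamma>\<close>.
\<close>

theorem negative_if_rho_eq_2:
  assumes g: "\<gamma> > 0" "\<mu> > 0" and \<mu>: "\<mu> < 3 * \<gamma>"
  shows "\<exists>t>0. mittag_leffler3 \<gamma> 2 \<mu> (- t :: real) < 0"
proof (rule ccontr)
  assume "\<not> ?thesis"
  hence nonneg: "\<And>t::real. t > 0 \<Longrightarrow> mittag_leffler3 \<gamma> 2 \<mu> (- t) \<ge> 0" by (meson not_le)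
  define a where "a = \<mu> - 2 * \<gamma>"
  have main: "norm (of_real \<sigma> + \<i>) powr (- a) \<le> 2 powr a * \<sigma> powr (\<gamma> - a) * norm (of_real \<sigma> + 2 * \<i>) powr \<gamma>"
    if \<sigma>: "0 < \<sigma>" "\<sigma> < 1" for \<sigma>
  proof -
    \<comment> \<open>a centre so far to the right that the disc around it through \<open>\<sigma> + \<i>\<close> stays to the right of \<open>\<sigma> / 2\<close>\<close>
    define s0 where "s0 = \<sigma> + 1 / \<sigma>"
    have "1 / \<sigma> > 1" using \<sigma> by simp
    hence s0: "s0 > 1" using \<sigma> unfolding s0_def by linarith
    obtain h where h: "\<And>k. h k \<ge> 0"
     "\<And>z. norm z < s0 \<Longrightarrow> (\<lambda>k. of_real (h k) * z ^ k) sums ml_symbol_complex \<gamma> 2 (\<mu> - 2 * \<gamma>) (of_real s0 - z)"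
      by (rule landau_half_plane[OF g(1) _ g(2) _ nonneg s0]) auto
    define z where "z = of_real (1 / \<sigma>) - \<i>"
    define w where "w = \<sigma> / 2 + 1 / \<sigma>"
    have "norm z = sqrt ((1 / \<sigma>) ^ 2 + 1)" by (simp add: z_def cmod_def)
    also have "\<dots> \<le> w"
      using \<sigma> by (intro real_le_lsqrt) (auto simp: w_def power2_eq_square field_simps)
    finally have zw: "norm z \<le> w" .
    have w: "w < s0" using \<sigma> by (simp add: w_def s0_def)
    have sz: "of_real s0 - z = of_real \<sigma> + \<i>" by (simp add: s0_def z_def)
    have sw: "s0 - w = \<sigma> / 2" by (simp add: s0_def w_def)
    have "norm (ml_symbol_complex \<gamma> 2 a (of_real \<sigma> + \<i>)) \<le> norm (ml_symbol_complex \<gamma> 2 a (of_real (\<sigma> / 2)))"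
      using power_series_norm_le[of h s0 "ml_symbol_complex \<gamma> 2 (\<mu> - 2 * \<gamma>)" s0 w z] h w zw
      unfolding sz sw a_def by blast
    also have "ml_symbol_complex \<gamma> 2 a (of_real (\<sigma> / 2)) = of_real (ml_symbol \<gamma> 2 a (\<sigma> / 2))"
      by (rule ml_symbol_complex_of_real) (use \<sigma> in simp)
    also have "norm (complex_of_real (ml_symbol \<gamma> 2 a (\<sigma> / 2))) \<le> (\<sigma> / 2) powr (- a) * 1"
      unfolding norm_of_real abs_of_nonneg[OF ml_symbol_nonneg] unfolding ml_symbol_def
    proof (intro mult_left_mono)
      have "(1 + (\<sigma> / 2) powr 2) powr (- \<gamma>) \<le> 1 powr (- \<gamma>)" using g by (intro powr_mono2') auto
      thus "(1 + (\<sigma> / 2) powr 2) powr (- \<gamma>) \<le> 1" by simp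
    qed auto
    finally have le: "norm (of_real \<sigma> + \<i>) powr (- a) * norm (1 + (of_real \<sigma> + \<i>) powr of_real 2) powr (- \<gamma>) \<le> (\<sigma> / 2) powr (- a)"
      unfolding norm_ml_symbol_complex by simp
    have "of_real \<sigma> + \<i> \<noteq> 0" by (simp add: complex_eq_iff)
    hence "(of_real \<sigma> + \<i>) powr of_real 2 = (of_real \<sigma> + \<i>) ^ 2"
      using powr_complexpow[of "of_real \<sigma> + \<i>" 2] by simp
    hence "1 + (of_real \<sigma> + \<i>) powr of_real 2 = of_real \<sigma> * (of_real \<sigma> + 2 * \<i>)"
      by (simp add: power2_eq_square algebra_simps)
    hence n: "norm (1 + (of_real \<sigma> + \<i>) powr of_real 2) = \<sigma> * norm (of_real \<sigma> + 2 * \<i>)"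
      using \<sigma> by (simp add: norm_mult)
    have pos: "norm (of_real \<sigma> + 2 * \<i>) > 0" by (simp add: complex_eq_iff)
    define N where "N = norm (of_real \<sigma> + 2 * \<i>)"
    have "norm (of_real \<sigma> + \<i>) powr (- a) = norm (of_real \<sigma> + \<i>) powr (- a) * (\<sigma> * N) powr (- \<gamma>) * (\<sigma> * N) powr \<gamma>"
      using \<sigma> pos by (simp add: N_def mult.assoc flip: powr_add)
    also have "\<dots> \<le> (\<sigma> / 2) powr (- a) * (\<sigma> * N) powr \<gamma>"
      using le unfolding n N_def by (intro mult_right_mono) auto
    also have "\<dots> = 2 powr a * \<sigma> powr (\<gamma> - a) * N powr \<gamma>"
    proof -
      have "(\<sigma> / 2) powr (- a) = \<sigma> powr (- a) * 2 powr a" using \<sigma> by (simp add: powr_divide powr_minus_divide)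
      moreover have "(\<sigma> * N) powr \<gamma> = \<sigma> powr \<gamma> * N powr \<gamma>" using \<sigma> pos by (simp add: N_def powr_mult)
      moreover have "\<sigma> powr (\<gamma> - a) = \<sigma> powr \<gamma> * \<sigma> powr (- a)" by (simp flip: powr_add)
      ultimately show ?thesis by (simp only: mult_ac)
    qed
    finally show ?thesis by (simp add: N_def)
  qed
  have "((\<lambda>\<sigma>. norm (of_real \<sigma> + \<i>) powr (- a)) \<longlongrightarrow> norm (of_real 0 + \<i>) powr (- a)) (at_right 0)"
    by (intro tendsto_intros) auto
  moreover have "((\<lambda>\<sigma>. 2 powr a * \<sigma> powr (\<gamma> - a) * norm (of_real \<sigma> + 2 * \<i>) powr \<gamma>) \<longlongrightarrow>
      2 powr a * 0 powr (\<gamma> - a) * norm (of_real 0 + 2 * \<i>) powr \<gamma>) (at_right 0)"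
  proof (intro tendsto_mult tendsto_const)
    have "eventually (\<lambda>\<sigma>. 0 \<le> \<sigma>) (at_right (0 :: real))"
      by (rule eventually_mono[OF eventually_at_right_less]) simp
    thus "((\<lambda>\<sigma>. \<sigma> powr (\<gamma> - a)) \<longlongrightarrow> 0 powr (\<gamma> - a)) (at_right 0)"
      by (rule tendsto_powr2[OF tendsto_ident_at tendsto_const]) (use \<mu> in \<open>simp add: a_def\<close>)
    show "((\<lambda>\<sigma>. norm (of_real \<sigma> + 2 * \<i>) powr \<gamma>) \<longlongrightarrow> norm (of_real 0 + 2 * \<i>) powr \<gamma>) (at_right 0)"
      by (intro tendsto_powr tendsto_norm tendsto_add tendsto_of_real tendsto_ident_at tendsto_const) simp
  qed
  moreover have "eventually (\<lambda>\<sigma>. norm (of_real \<sigma> + \<i>) powr (- a) \<le> 2 powr a * \<sigma> powr (\<gamma> - a) * norm (of_real \<sigma> + 2 * \<i>) powr \<gamma>) (at_right 0)"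
    by (rule eventually_mono[OF eventually_at_right_real[of 0 1]]) (use main in auto)
  ultimately have "norm (of_real 0 + \<i>) powr (- a) \<le> 2 powr a * 0 powr (\<gamma> - a) * norm (of_real 0 + 2 * \<i>) powr \<gamma>"
    by (intro tendsto_le[OF trivial_limit_at_right_real])
  thus False by simp
qed

text \<open>
  The symbol blows up at \<open>cis (\<pi> / \<rho>)\<close>, a point of the open right half plane. The disc with centre
  \<open>1 / cos \<theta>\<close> and radius \<open>tan \<theta>\<close>, where \<open>\<theta> = \<pi> / \<rho>\<close>, touches the boundary of the sector \<open>\<bar>arg s\<bar> < \<theta>\<close> exactly
  at this point and at its conjugate, and it stays away from \<open>0\<close>. With non-negative coefficients, the
  symbol would be bounded along the radius to that point by its values on the real radius, which are bounded.
\<close>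

theorem negative_if_rho_gt_2:
  assumes g: "\<gamma> > 0" "\<rho> > 2" "\<mu> > 0"
  shows "\<exists>t>0. mittag_leffler3 \<gamma> \<rho> \<mu> (- t :: real) < 0"
proof (rule ccontr)
  assume "\<not> ?thesis"
  hence nonneg: "\<And>t::real. t > 0 \<Longrightarrow> mittag_leffler3 \<gamma> \<rho> \<mu> (- t) \<ge> 0" by (meson not_le)
  define \<theta> where "\<theta> = pi / \<rho>"
  have \<theta>: "0 < \<theta>" "\<theta> < pi / 2"
    unfolding \<theta>_def using g divide_strict_left_mono[of 2 \<rho> pi] by simp_all
  have c: "cos \<theta> > 0" "cos \<theta> < 1" "sin \<theta> > 0" "sin \<theta> < 1"
    using \<theta> cos_gt_zero_pi[of \<theta>] cos_monotone_0_pi[of 0 \<theta>] sin_gt_zero[of \<theta>] sin_monotone_2pi[of \<theta> "pi/2"] by auto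
  define s0 where "s0 = 1 / cos \<theta>"
  define r where "r = tan \<theta>"
  have s0: "s0 > 1" using c by (simp add: s0_def)
  have r: "0 < r" "r < s0" using c by (auto simp: r_def s0_def tan_def divide_strict_right_mono)
  have rs: "r = s0 * sin \<theta>" by (simp add: r_def s0_def tan_def)
  define e where "e = cis \<theta>"
  define a where "a = \<mu> - \<rho> * \<gamma>"
  let ?B = "ball (complex_of_real s0) r"
  have Re: "Re s > 0" if "s \<in> ?B" for s
    using that abs_Re_le_cmod[of "of_real s0 - s"] r by (simp add: dist_norm)
  have Arg: "\<bar>Im (Ln s)\<bar> < \<theta>" if s: "s \<in> ?B" for s
  proof -
    define \<alpha> where "\<alpha> = Im (Ln s)"
    have nz: "s \<noteq> 0" using Re[OF s] by auto
    have \<alpha>: "\<bar>\<alpha>\<bar> < pi / 2" unfolding \<alpha>_def by (rule Re_Ln_pos_lt_imp[OF Re[OF s]])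
    have s_polar: "s = of_real (norm s) * cis \<alpha>"
      using nz exp_Ln[OF nz] unfolding \<alpha>_def by (metis Re_Ln cis_conv_exp exp_eq_polar exp_ln norm_exp_eq_Re of_real_exp zero_less_norm_iff)
    have imbound: "\<bar>Im ((s - of_real s0) * cis \<phi>)\<bar> < r" for \<phi>
    proof -
      have "\<bar>Im ((s - of_real s0) * cis \<phi>)\<bar> \<le> norm ((s - of_real s0) * cis \<phi>)" by (rule abs_Im_le_cmod)
      also have "\<dots> < r" using s by (simp add: norm_mult dist_norm norm_minus_commute)
      finally show ?thesis .
    qed
    have "Im (s * cis (- \<theta>)) = Im ((s - of_real s0) * cis (- \<theta>)) - r"
      by (simp add: rs algebra_simps)
    hence 1: "Im (s * cis (- \<theta>)) < 0" using imbound[of "- \<theta>"] by linarith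
    have "Im (s * cis \<theta>) = Im ((s - of_real s0) * cis \<theta>) + r"
      by (simp add: rs algebra_simps)
    hence 2: "Im (s * cis \<theta>) > 0" using imbound[of "\<theta>"] by linarith
    have "s * cis \<phi> = of_real (norm s) * cis (\<alpha> + \<phi>)" for \<phi>
      by (subst s_polar) (simp add: mult.assoc cis_mult)
    hence Im: "Im (s * cis \<phi>) = norm s * sin (\<alpha> + \<phi>)" for \<phi> by simp
    have 3: "sin (\<alpha> - \<theta>) < 0" "sin (\<alpha> + \<theta>) > 0"
      using 1 2 nz unfolding Im by (simp_all add: mult_less_0_iff zero_less_mult_iff)
    have "\<alpha> < \<theta>"
    proof (rule ccontr)
      assume "\<not> \<alpha> < \<theta>"
      hence "sin (\<alpha> - \<theta>) \<ge> 0" using \<alpha> \<theta> by (intro sin_ge_zero) auto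
      with 3 show False by simp
    qed
    moreover have "- \<theta> < \<alpha>"
    proof (rule ccontr)
      assume "\<not> - \<theta> < \<alpha>"
      hence "sin (- (\<alpha> + \<theta>)) \<ge> 0" using \<alpha> \<theta> by (intro sin_ge_zero) auto
      hence "- sin (\<alpha> + \<theta>) \<ge> 0" by (simp only: sin_minus)
      with 3 show False by simp
    qed
    ultimately show ?thesis by (auto simp: \<alpha>_def)
  qed
  have sector: "\<bar>\<rho> * Im (Ln s)\<bar> < pi" if "s \<in> ?B" for s
    using mult_strict_left_mono[OF Arg[OF that], of \<rho>] g by (simp add: abs_mult \<theta>_def)
  have cut: "s \<notin> \<real>\<^sub>\<le>\<^sub>0" if "s \<in> ?B" for s
    using Re[OF that] by (auto simp: complex_nonpos_Reals_iff)
  have hol: "ml_symbol_complex \<gamma> \<rho> a holomorphic_on ?B"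
    by (intro ml_symbol_complex_holomorphic cut sector)
  have "\<exists>h. (\<forall>k. h k \<ge> 0) \<and>
     (\<forall>z. norm z < r \<longrightarrow> (\<lambda>k. of_real (h k) * z ^ k) sums ml_symbol_complex \<gamma> \<rho> a (of_real s0 - z)) \<and>
     (\<forall>z\<ge>0. laplace (\<lambda>x. ennreal (ml_density \<gamma> \<rho> \<mu> x)) (s0 - z) = (\<Sum>k. ennreal (h k * z ^ k)))"
    using g s0 r hol by (intro landau_expansion nonneg) (auto simp: a_def ml_symbol_complex_of_real)
  then obtain h where h: "(\<forall>k. h k \<ge> 0) \<and>
     (\<forall>z. norm z < r \<longrightarrow> (\<lambda>k. of_real (h k) * z ^ k) sums ml_symbol_complex \<gamma> \<rho> a (of_real s0 - z)) \<and>
     (\<forall>z\<ge>0. laplace (\<lambda>x. ennreal (ml_density \<gamma> \<rho> \<mu> x)) (s0 - z) = (\<Sum>k. ennreal (h k * z ^ k)))" ..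
  have ne: "norm (of_real s0 - e) = r"
  proof -
    have "(norm (of_real s0 - e))\<^sup>2 = (s0 - cos \<theta>)\<^sup>2 + (sin \<theta>)\<^sup>2"
      by (simp add: cmod_power2 e_def)
    also have "\<dots> = s0\<^sup>2 - 2 * (s0 * cos \<theta>) + ((cos \<theta>)\<^sup>2 + (sin \<theta>)\<^sup>2)"
      by (simp add: power2_eq_square algebra_simps)
    also have "\<dots> = s0\<^sup>2 - 1" using c by (simp add: s0_def)
    also have "\<dots> = r\<^sup>2"
    proof -
      have "(s0 * sin \<theta>)\<^sup>2 = s0\<^sup>2 * (1 - (cos \<theta>)\<^sup>2)" by (simp add: power_mult_distrib sin_squared_eq)
      also have "\<dots> = s0\<^sup>2 - (s0 * cos \<theta>)\<^sup>2" by (simp add: power_mult_distrib algebra_simps)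
      finally show ?thesis using c by (simp add: rs s0_def)
    qed
    finally show ?thesis using r by (simp add: power2_eq_iff_nonneg)
  qed
  \<comment> \<open>the radius from the centre to the singularity; the modulus there is compared at the real point \<open>s0 - \<tau> * r\<close>\<close>
  define s where "s = (\<lambda>\<tau>::real. of_real s0 - of_real \<tau> * (of_real s0 - e))"
  have main: "norm (s \<tau>) powr (- a) \<le> ml_symbol \<gamma> \<rho> a (s0 - \<tau> * r) * norm (1 + s \<tau> powr of_real \<rho>) powr \<gamma>"
    if \<tau>: "0 < \<tau>" "\<tau> < 1" for \<tau>
  proof -
    define z where "z = of_real \<tau> * (of_real s0 - e)"
    have z: "norm z \<le> \<tau> * r" using \<tau> by (simp add: z_def norm_mult ne)
    have w: "\<tau> * r < r" using \<tau> r by simp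
    have sB: "s \<tau> \<in> ?B" using z w by (simp add: s_def z_def [symmetric] dist_norm)
    have "norm (ml_symbol_complex \<gamma> \<rho> a (of_real s0 - z)) \<le> norm (ml_symbol_complex \<gamma> \<rho> a (of_real (s0 - \<tau> * r)))"
      using power_series_norm_le[of h r "ml_symbol_complex \<gamma> \<rho> a" s0 "\<tau> * r" z] h w z by blast
    also have "ml_symbol_complex \<gamma> \<rho> a (of_real (s0 - \<tau> * r)) = of_real (ml_symbol \<gamma> \<rho> a (s0 - \<tau> * r))"
      by (rule ml_symbol_complex_of_real) (use w r in linarith)
    also have "norm \<dots> = ml_symbol \<gamma> \<rho> a (s0 - \<tau> * r)"
      unfolding norm_of_real by (rule abs_of_nonneg[OF ml_symbol_nonneg])
    finally have le: "norm (s \<tau>) powr (- a) * norm (1 + s \<tau> powr of_real \<rho>) powr (- \<gamma>) \<le> ml_symbol \<gamma> \<rho> a (s0 - \<tau> * r)"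
      unfolding norm_ml_symbol_complex by (simp add: s_def z_def)
    have "1 + s \<tau> powr of_real \<rho> \<noteq> 0"
      using one_plus_powr_not_nonpos[OF cut[OF sB] sector[OF sB]] by auto
    hence "norm (s \<tau>) powr (- a) = norm (s \<tau>) powr (- a) * norm (1 + s \<tau> powr of_real \<rho>) powr (- \<gamma>) * norm (1 + s \<tau> powr of_real \<rho>) powr \<gamma>"
      by (simp add: mult.assoc flip: powr_add)
    also have "\<dots> \<le> ml_symbol \<gamma> \<rho> a (s0 - \<tau> * r) * norm (1 + s \<tau> powr of_real \<rho>) powr \<gamma>"
      by (intro mult_right_mono le) auto
    finally show ?thesis .
  qed
  have s1: "s 1 = e" by (simp add: s_def)
  have s_lim: "(s \<longlongrightarrow> e) (at_left 1)"
    unfolding s1 [symmetric] unfolding s_def by (intro tendsto_intros)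
  have e: "e \<notin> \<real>\<^sub>\<le>\<^sub>0" using c by (auto simp: e_def complex_nonpos_Reals_iff)
  have Ln_e: "Ln e = \<i> * of_real \<theta>"
    unfolding e_def cis_conv_exp using \<theta> by (subst Ln_exp) auto
  have "e powr of_real \<rho> = exp (of_real \<rho> * Ln e)" using e by (auto simp: powr_def)
  also have "of_real \<rho> * Ln e = \<i> * of_real pi" unfolding Ln_e using g by (simp add: \<theta>_def)
  also have "exp (\<i> * of_real pi) = - 1" by (rule exp_pi_i')
  finally have e\<rho>: "e powr of_real \<rho> = - 1" .
  have "((\<lambda>\<tau>. norm (1 + s \<tau> powr of_real \<rho>) powr \<gamma>) \<longlongrightarrow> norm (1 + e powr of_real \<rho>) powr \<gamma>) (at_left 1)"
    using e g by (intro tendsto_powr2 tendsto_intros tendsto_powr_complex s_lim) auto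
  moreover have "((\<lambda>\<tau>. ml_symbol \<gamma> \<rho> a (s0 - \<tau> * r)) \<longlongrightarrow> ml_symbol \<gamma> \<rho> a (s0 - 1 * r)) (at_left 1)"
  proof -
    have base: "((\<lambda>\<tau>. s0 - \<tau> * r) \<longlongrightarrow> s0 - 1 * r) (at_left 1)" by (intro tendsto_intros)
    have n1: "s0 - 1 * r \<noteq> 0" using r by simp
    have n2: "1 + (s0 - 1 * r) powr \<rho> \<noteq> 0" using powr_ge_zero[of "s0 - 1 * r" \<rho>] by linarith
    show ?thesis unfolding ml_symbol_def
      by (intro tendsto_mult tendsto_powr tendsto_add tendsto_const base n1 n2)
  qed
  ultimately have "((\<lambda>\<tau>. ml_symbol \<gamma> \<rho> a (s0 - \<tau> * r) * norm (1 + s \<tau> powr of_real \<rho>) powr \<gamma>) \<longlongrightarrow>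
      ml_symbol \<gamma> \<rho> a (s0 - 1 * r) * norm (1 + e powr of_real \<rho>) powr \<gamma>) (at_left 1)"
    by (intro tendsto_mult)
  moreover have "((\<lambda>\<tau>. norm (s \<tau>) powr (- a)) \<longlongrightarrow> norm e powr (- a)) (at_left 1)"
    by (intro tendsto_powr tendsto_intros s_lim) (simp add: e_def)
  moreover have "eventually (\<lambda>\<tau>. norm (s \<tau>) powr (- a) \<le> ml_symbol \<gamma> \<rho> a (s0 - \<tau> * r) * norm (1 + s \<tau> powr of_real \<rho>) powr \<gamma>) (at_left 1)"
    by (rule eventually_mono[OF eventually_at_left_real[of 0 1]]) (use main in auto)
  ultimately have "norm e powr (- a) \<le> ml_symbol \<gamma> \<rho> a (s0 - 1 * r) * norm (1 + e powr of_real \<rho>) powr \<gamma>"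
    by (intro tendsto_le[OF trivial_limit_at_left_real])
  thus False by (simp add: e\<rho>) (simp add: e_def)
qed


section \<open>Lowering the upper parameter\<close>

lemma nn_integral_Gamma_real:
  assumes p: "p > 0" and s: "s > 0"
  shows "(\<integral>\<^sup>+x. ennreal (indicator {0<..} x * (x powr (p - 1) * exp (- (s * x)))) \<partial>lborel) = ennreal (Gamma p * s powr (- p))"
proof -
  note H = has_bochner_integral_Gamma[OF p s, unfolded has_bochner_integral_iff]
  show ?thesis unfolding H[THEN conjunct2, symmetric]
    by (intro nn_integral_eq_integral H[THEN conjunct1]) (auto simp: indicator_def)
qed

text \<open>
  Write \<open>Gamma \<gamma> * (B + u) powr - \<gamma>\<close> as a Gamma integral and exchange the integrations.
\<close>

lemma nn_integral_beta_mixture: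
  fixes \<delta> \<gamma> B :: real
  assumes \<delta>: "0 < \<delta>" "\<delta> < \<gamma>" and B: "B > 0"
  shows "(\<integral>\<^sup>+u. ennreal (indicator {0<..} u * (u powr (\<delta> - 1) * (B + u) powr (- \<gamma>))) \<partial>lborel) =
           ennreal (Gamma \<delta> * Gamma (\<gamma> - \<delta>) / Gamma \<gamma> * B powr (- (\<gamma> - \<delta>)))"
proof -
  have G: "Gamma \<gamma> > 0" "Gamma \<delta> > 0" using \<delta> by auto
  define K where "K = (\<lambda>u t. indicator {0<..} u * u powr (\<delta> - 1) * (indicator {0<..} t * (t powr (\<gamma> - 1) * exp (- ((B + u) * t)))) :: real)"
  have 1: "(\<integral>\<^sup>+t. ennreal (K u t) \<partial>lborel) =
      ennreal (Gamma \<gamma>) * ennreal (indicator {0<..} u * (u powr (\<delta> - 1) * (B + u) powr (- \<gamma>)))" for u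
  proof (cases "u > 0")
    case True
    have "(\<integral>\<^sup>+t. ennreal (K u t) \<partial>lborel) =
        (\<integral>\<^sup>+t. ennreal (u powr (\<delta> - 1)) * ennreal (indicator {0<..} t * (t powr (\<gamma> - 1) * exp (- ((B + u) * t)))) \<partial>lborel)"
      using True by (intro nn_integral_cong) (simp add: K_def ennreal_mult')
    also have "\<dots> = ennreal (u powr (\<delta> - 1)) * ennreal (Gamma \<gamma> * (B + u) powr (- \<gamma>))"
      using True B \<delta> by (subst nn_integral_cmult) (simp_all add: nn_integral_Gamma_real)
    also have "\<dots> = ennreal (Gamma \<gamma>) * ennreal (indicator {0<..} u * (u powr (\<delta> - 1) * (B + u) powr (- \<gamma>)))"
      using True G by (simp add: mult_ac flip: ennreal_mult)
    finally show ?thesis .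
  qed (simp add: K_def)
  have 2: "(\<integral>\<^sup>+u. ennreal (K u t) \<partial>lborel) =
      ennreal (Gamma \<delta>) * ennreal (indicator {0<..} t * (t powr ((\<gamma> - \<delta>) - 1) * exp (- (B * t))))" for t
  proof (cases "t > 0")
    case True
    have "(\<integral>\<^sup>+u. ennreal (K u t) \<partial>lborel) =
        (\<integral>\<^sup>+u. ennreal (t powr (\<gamma> - 1) * exp (- (B * t))) * ennreal (indicator {0<..} u * (u powr (\<delta> - 1) * exp (- (t * u)))) \<partial>lborel)"
    proof (intro nn_integral_cong)
      fix u
      have "exp (- ((B + u) * t)) = exp (- (B * t)) * exp (- (t * u))" by (simp add: algebra_simps flip: exp_add)
      thus "ennreal (K u t) = ennreal (t powr (\<gamma> - 1) * exp (- (B * t))) * ennreal (indicator {0<..} u * (u powr (\<delta> - 1) * exp (- (t * u))))"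
        using True unfolding K_def by (subst ennreal_mult' [symmetric]) (auto simp: mult_ac)
    qed
    also have "\<dots> = ennreal (t powr (\<gamma> - 1) * exp (- (B * t))) * ennreal (Gamma \<delta> * t powr (- \<delta>))"
      using True \<delta> by (subst nn_integral_cmult) (simp_all add: nn_integral_Gamma_real)
    also have "\<dots> = ennreal ((t powr (\<gamma> - 1) * exp (- (B * t))) * (Gamma \<delta> * t powr (- \<delta>)))"
      using G by (intro ennreal_mult [symmetric]) auto
    also have "(t powr (\<gamma> - 1) * exp (- (B * t))) * (Gamma \<delta> * t powr (- \<delta>)) =
        Gamma \<delta> * (indicator {0<..} t * (t powr ((\<gamma> - \<delta>) - 1) * exp (- (B * t))))"
    proof -
      have "t powr ((\<gamma> - \<delta>) - 1) = t powr (\<gamma> - 1) * t powr (- \<delta>)"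
        unfolding powr_add [symmetric] by (simp add: algebra_simps)
      thus ?thesis using True by simp
    qed
    finally show ?thesis using G by (simp add: ennreal_mult')
  qed (simp add: K_def)
  have [measurable]: "(\<lambda>(u, t). ennreal (K u t)) \<in> borel_measurable (lborel \<Otimes>\<^sub>M lborel)"
    unfolding K_def by measurable
  have "ennreal (Gamma \<gamma>) * (\<integral>\<^sup>+u. ennreal (indicator {0<..} u * (u powr (\<delta> - 1) * (B + u) powr (- \<gamma>))) \<partial>lborel) =
      (\<integral>\<^sup>+u. (\<integral>\<^sup>+t. ennreal (K u t) \<partial>lborel) \<partial>lborel)"
    unfolding 1 by (rule nn_integral_cmult [symmetric]) measurable
  also have "\<dots> = (\<integral>\<^sup>+t. (\<integral>\<^sup>+u. ennreal (K u t) \<partial>lborel) \<partial>lborel)"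
    by (rule lborel_pair.Fubini' [symmetric]) measurable
  also have "\<dots> = ennreal (Gamma \<delta>) * ennreal (Gamma (\<gamma> - \<delta>) * B powr (- (\<gamma> - \<delta>)))"
    unfolding 2 using \<delta> B by (subst nn_integral_cmult) (simp_all add: nn_integral_Gamma_real)
  finally have eq: "ennreal (Gamma \<gamma>) * (\<integral>\<^sup>+u. ennreal (indicator {0<..} u * (u powr (\<delta> - 1) * (B + u) powr (- \<gamma>))) \<partial>lborel) =
      ennreal (Gamma \<delta>) * ennreal (Gamma (\<gamma> - \<delta>) * B powr (- (\<gamma> - \<delta>)))" .
  define I where "I = (\<integral>\<^sup>+u. ennreal (indicator {0<..} u * (u powr (\<delta> - 1) * (B + u) powr (- \<gamma>))) \<partial>lborel)"
  have "I = ennreal (1 / Gamma \<gamma>) * (ennreal (Gamma \<gamma>) * I)"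
    using G by (simp add: mult.assoc [symmetric] flip: ennreal_mult)
  also have "\<dots> = ennreal (1 / Gamma \<gamma>) * (ennreal (Gamma \<delta>) * ennreal (Gamma (\<gamma> - \<delta>) * B powr (- (\<gamma> - \<delta>))))"
    using eq by (simp only: I_def)
  also have "\<dots> = ennreal (Gamma \<delta> * Gamma (\<gamma> - \<delta>) / Gamma \<gamma> * B powr (- (\<gamma> - \<delta>)))"
    using G \<delta> by (simp add: field_simps flip: ennreal_mult)
  finally show ?thesis by (simp only: I_def)
qed

text \<open>
  Up to a constant, the integral of \<open>u powr (\<delta> - 1) * (s powr \<rho> + 1 + u) powr - \<gamma>\<close> over \<open>u > 0\<close> is
  \<open>(s powr \<rho> + 1) powr (\<delta> - \<gamma>)\<close>. Each integrand is the Laplace transform of a rescaled copy of the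
  density for \<open>\<gamma>\<close>. The new symbol is therefore the Laplace transform of a mixture of non-negative densities. Mixing the
  densities, rather than the power series of the symbols, leaves measurability in \<open>u\<close> to Tonelli's theorem.
\<close>

theorem completely_monotone_symbol_decrease_gamma:
  assumes \<rho>: "0 < \<rho>" "\<rho> \<le> 2" and \<gamma>: "0 < \<gamma>'" "\<gamma>' < \<gamma>" and a: "a \<ge> 0" and CM: "completely_monotone (ml_symbol \<gamma> \<rho> a)"
  shows "completely_monotone (ml_symbol \<gamma>' \<rho> a)"
proof -
  define \<mu> where "\<mu> = a + \<rho> * \<gamma>"
  define \<delta> where "\<delta> = \<gamma> - \<gamma>'"
  have \<delta>: "0 < \<delta>" "\<delta> < \<gamma>" using \<gamma> by (auto simp: \<delta>_def)
  have g: "\<gamma> > 0" "\<rho> > 0" "\<mu> > 0" using \<rho> \<gamma> a by (auto simp: \<mu>_def intro!: add_nonneg_pos)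
  have a': "\<mu> - \<rho> * \<gamma> = a" by (simp add: \<mu>_def)
  have nonneg: "mittag_leffler3 \<gamma> \<rho> \<mu> (- t :: real) \<ge> 0" if "t > 0" for t
    using nonneg_if_completely_monotone_symbol[OF g _ that] CM by (simp add: a')
  note lap = completely_monotone_symbol_if_nonneg(2)[OF g \<rho>(2) nonneg, unfolded a']
  note [measurable] = measurable_ml_density[OF g]
  let ?F = "ml_density \<gamma> \<rho> \<mu>"
  define C where "C = Gamma \<delta> * Gamma (\<gamma> - \<delta>) / Gamma \<gamma>"
  have C: "C > 0" using \<delta> \<gamma> by (auto simp: C_def intro!: divide_pos_pos mult_pos_pos)
  \<comment> \<open>dilating by \<open>c u\<close> replaces \<open>1 + s powr \<rho>\<close> by \<open>1 + u + s powr \<rho>\<close>; the weight \<open>W\<close> compensates the powers of \<open>1 + u\<close> that this produces\<close>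
  define c where "c = (\<lambda>u::real. (1 + u) powr (1 / \<rho>))"
  define W where "W = (\<lambda>u::real. indicator {0<..} u * (u powr (\<delta> - 1) * (1 + u) powr (- (\<mu> - 1) / \<rho>)))"
  have W0: "W u \<ge> 0" for u by (auto simp: W_def)
  have [measurable]: "W \<in> borel_measurable borel" "c \<in> borel_measurable borel"
    unfolding W_def c_def by measurable
  define H where "H = (\<lambda>x. \<integral>\<^sup>+u. ennreal (W u) * ennreal (?F (c u * x)) \<partial>lborel)"
  have [measurable]: "H \<in> borel_measurable borel"
    unfolding H_def by measurable
  have supp: "H x = 0" if "x \<le> 0" for x
  proof -
    have "c u * x \<le> 0" for u using that by (simp add: c_def mult_nonneg_nonpos)
    thus ?thesis by (simp add: H_def ml_density_supp)
  qed
  have lapH: "laplace H s = ennreal (C * ml_symbol \<gamma>' \<rho> a s)" if s: "s > 0" for s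
  proof -
    define B where "B = 1 + s powr \<rho>"
    have B: "B > 0" by (simp add: B_def add_pos_nonneg)
    have inner: "(\<integral>\<^sup>+x. ennreal (exp (- (s * x))) * (ennreal (W u) * ennreal (?F (c u * x))) \<partial>lborel) =
        ennreal (s powr (- a)) * ennreal (indicator {0<..} u * (u powr (\<delta> - 1) * (B + u) powr (- \<gamma>)))" for u
    proof (cases "u > 0")
      case True
      have cu: "c u > 0" using True by (simp add: c_def)
      have "laplace (\<lambda>x. ennreal (?F x)) (s / c u) =
          ennreal \<bar>c u\<bar> * (\<integral>\<^sup>+x. ennreal (exp (- (s / c u * (0 + c u * x)))) * ennreal (?F (0 + c u * x)) \<partial>lborel)"
        unfolding laplace_def by (rule nn_integral_real_affine) (use cu in auto)
      also have "\<dots> = ennreal (c u) * (\<integral>\<^sup>+x. ennreal (exp (- (s * x))) * ennreal (?F (c u * x)) \<partial>lborel)"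
        using cu by simp
      finally have "ennreal (c u) * (\<integral>\<^sup>+x. ennreal (exp (- (s * x))) * ennreal (?F (c u * x)) \<partial>lborel) =
          ennreal (ml_symbol \<gamma> \<rho> a (s / c u))"
        using lap[of "s / c u"] s cu by simp
      hence "ennreal (1 / c u) * (ennreal (c u) * (\<integral>\<^sup>+x. ennreal (exp (- (s * x))) * ennreal (?F (c u * x)) \<partial>lborel)) =
          ennreal (1 / c u) * ennreal (ml_symbol \<gamma> \<rho> a (s / c u))" by simp
      hence I: "(\<integral>\<^sup>+x. ennreal (exp (- (s * x))) * ennreal (?F (c u * x)) \<partial>lborel) =
          ennreal (1 / c u * ml_symbol \<gamma> \<rho> a (s / c u))"
        using cu by (simp add: mult.assoc [symmetric] ml_symbol_nonneg flip: ennreal_mult)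
      have "(\<integral>\<^sup>+x. ennreal (exp (- (s * x))) * (ennreal (W u) * ennreal (?F (c u * x))) \<partial>lborel) =
          (\<integral>\<^sup>+x. ennreal (W u) * (ennreal (exp (- (s * x))) * ennreal (?F (c u * x))) \<partial>lborel)"
        by (simp only: mult_ac)
      also have "\<dots> = ennreal (W u) * ennreal (1 / c u * ml_symbol \<gamma> \<rho> a (s / c u))"
        unfolding I [symmetric] by (rule nn_integral_cmult) measurable
      also have "\<dots> = ennreal (W u * (1 / c u * ml_symbol \<gamma> \<rho> a (s / c u)))"
        using W0 cu by (intro ennreal_mult [symmetric]) (auto simp: ml_symbol_nonneg)
      also have "W u * (1 / c u * ml_symbol \<gamma> \<rho> a (s / c u)) =
          s powr (- a) * (indicator {0<..} u * (u powr (\<delta> - 1) * (B + u) powr (- \<gamma>)))"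
      proof -
        define Y where "Y = 1 + u"
        have Y: "Y > 0" using True by (simp add: Y_def)
        have e1: "1 / c u = Y powr (- (1 / \<rho>))" by (simp add: c_def Y_def powr_minus_divide)
        have e2: "(s / c u) powr (- a) = s powr (- a) * Y powr (a / \<rho>)"
          using s Y by (simp add: c_def Y_def [symmetric] powr_divide powr_powr powr_minus_divide)
        have "(s / c u) powr \<rho> = s powr \<rho> / Y"
          using s Y \<rho> by (simp add: c_def Y_def [symmetric] powr_divide powr_powr)
        hence "1 + (s / c u) powr \<rho> = (B + u) / Y" using Y by (simp add: B_def Y_def field_simps)
        moreover have "B + u > 0" using B True by simp
        ultimately have e3: "(1 + (s / c u) powr \<rho>) powr (- \<gamma>) = (B + u) powr (- \<gamma>) * Y powr \<gamma>"
          using Y by (simp add: powr_divide powr_minus_divide)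
        have "Y powr (- (\<mu> - 1) / \<rho>) * Y powr (- (1 / \<rho>)) * Y powr (a / \<rho>) * Y powr \<gamma> =
                Y powr (- (\<mu> - 1) / \<rho> + - (1 / \<rho>) + a / \<rho> + \<gamma>)" by (simp only: powr_add)
        also have "- (\<mu> - 1) / \<rho> + - (1 / \<rho>) + a / \<rho> + \<gamma> = 0" using \<rho> by (simp add: \<mu>_def field_simps)
        finally have e4: "Y powr (- (\<mu> - 1) / \<rho>) * Y powr (- (1 / \<rho>)) * Y powr (a / \<rho>) * Y powr \<gamma> = 1" using Y by simp
        have "W u * (1 / c u * ml_symbol \<gamma> \<rho> a (s / c u)) =
          s powr (- a) * (indicator {0<..} u * (u powr (\<delta> - 1) * (B + u) powr (- \<gamma>))) *
          (Y powr (- (\<mu> - 1) / \<rho>) * Y powr (- (1 / \<rho>)) * Y powr (a / \<rho>) * Y powr \<gamma>)"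
          unfolding W_def ml_symbol_def e1 e2 e3 Y_def [symmetric] by (simp only: mult_ac)
        thus ?thesis unfolding e4 by simp
      qed
      finally show ?thesis by (simp add: ennreal_mult')
    qed (simp add: W_def)
    have "laplace H s = (\<integral>\<^sup>+x. \<integral>\<^sup>+u. ennreal (exp (- (s * x))) * (ennreal (W u) * ennreal (?F (c u * x))) \<partial>lborel \<partial>lborel)"
      unfolding laplace_def H_def by (intro nn_integral_cong nn_integral_cmult [symmetric]) measurable
    also have "\<dots> = (\<integral>\<^sup>+u. \<integral>\<^sup>+x. ennreal (exp (- (s * x))) * (ennreal (W u) * ennreal (?F (c u * x))) \<partial>lborel \<partial>lborel)"
      by (rule lborel_pair.Fubini') measurable
    also have "\<dots> = ennreal (s powr (- a)) * ennreal (C * B powr (- \<gamma>'))"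
      unfolding inner using \<delta> B
      by (subst nn_integral_cmult) (simp_all add: nn_integral_beta_mixture C_def, simp_all add: \<delta>_def)
    also have "\<dots> = ennreal (C * ml_symbol \<gamma>' \<rho> a s)"
      using C by (simp add: ml_symbol_def B_def mult_ac flip: ennreal_mult)
    finally show ?thesis .
  qed
  have "completely_monotone (\<lambda>s. C * ml_symbol \<gamma>' \<rho> a s)"
    by (rule completely_monotone_laplace[of H]) (use C in \<open>simp_all add: supp lapH ml_symbol_nonneg\<close>)
  hence "completely_monotone (\<lambda>s. 1 / C * (C * ml_symbol \<gamma>' \<rho> a s))"
    by (rule completely_monotone_scale[rotated]) (use C in simp)
  thus ?thesis
    by (rule completely_monotone_cong[rotated]) (use C in simp)
qed

section \<open>The hyperbolic region\<close>

text \<open>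
  For \<open>\<rho> = 2\<close> the duplication of the Gamma argument makes the coefficient ratio in \<open>v = t / 16\<close> a rational
  function with the cubic denominator that \<open>sum_of_squares_nonneg\<close> expects; \<open>poly\<close> matches the two.
\<close>

lemma mittag_leffler3_two_nonneg:
  fixes \<gamma> b \<nu> \<epsilon> \<kappa> t :: real
  assumes g: "\<gamma> > 0" "b > 0" and \<nu>: "\<nu> > - 1 / 2" and \<epsilon>: "\<epsilon> = \<nu> + 1 / 2 - \<gamma>" "\<epsilon> \<ge> 0"
    and \<kappa>: "\<kappa> \<ge> 0" "\<kappa> = 0 \<or> \<nu> > 0" and t: "t > 0"
    and poly: "\<And>M. (M + \<nu>) * (M + 2 * \<nu>) + \<kappa> - \<epsilon> * (M + 2 * \<nu> + 1) = (M + b + \<gamma> - 1) * (M + b + \<gamma> - 1 / 2)"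
  shows "mittag_leffler3 \<gamma> 2 (2 * (b + \<gamma>)) (- t) \<ge> 0"
proof -
  define \<mu> where "\<mu> = 2 * (b + \<gamma>)"
  define f where "f = (\<lambda>m. pochhammer \<gamma> m / fact m / Gamma (\<mu> + 2 * real m) * (- 16) ^ m)"
  have "(\<Sum>m. f m * (t / 16) ^ m) \<ge> 0"
  proof (rule sum_of_squares_nonneg[OF g(1) \<nu> \<epsilon> \<kappa>])
    show "f 0 \<ge> 0" using g by (auto simp: f_def \<mu>_def intro!: Gamma_real_nonneg)
    fix m
    have n: "\<mu> + 2 * real m \<notin> \<int>\<^sub>\<le>\<^sub>0" "\<mu> + 2 * real m + 1 \<notin> \<int>\<^sub>\<le>\<^sub>0"
      using g by (auto simp: \<mu>_def elim!: nonpos_Ints_cases)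
    have pos: "\<mu> + 2 * real m > 0" using g by (simp add: \<mu>_def)
    define G0 P where "G0 = Gamma (\<mu> + 2 * real m)" and "P = pochhammer \<gamma> m / fact m * (- 16 :: real) ^ m"
    have "G0 > 0" using pos by (simp add: G0_def)
    have G: "Gamma (\<mu> + 2 * real (Suc m)) = (\<mu> + 2 * real m + 1) * ((\<mu> + 2 * real m) * G0)"
      using Gamma_plus1[OF n(1)] Gamma_plus1[OF n(2)] by (simp add: G0_def algebra_simps)
    have P: "pochhammer \<gamma> (Suc m) / fact (Suc m) * (- 16 :: real) ^ Suc m = P * ((\<gamma> + real m) * (- 16) / (1 + real m))"
      by (simp add: P_def pochhammer_Suc field_simps)
    have fS: "f (Suc m) = (pochhammer \<gamma> (Suc m) / fact (Suc m) * (- 16 :: real) ^ Suc m) / Gamma (\<mu> + 2 * real (Suc m))"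
      by (simp add: f_def)
    have "real (Suc m) * ((\<mu> + 2 * real m) * (\<mu> + 2 * real m + 1)) * f (Suc m) = - 16 * (real m + \<gamma>) * (P / G0)"
      unfolding fS P G using pos \<open>G0 > 0\<close> by (simp add: divide_simps)
    also have "P / G0 = f m" by (simp add: P_def G0_def f_def)
    finally have *: "real (Suc m) * ((\<mu> + 2 * real m) * (\<mu> + 2 * real m + 1)) * f (Suc m) = - 16 * (real m + \<gamma>) * f m" .
    have e: "(real (Suc m) + \<nu>) * (real (Suc m) + 2 * \<nu>) + \<kappa> - \<epsilon> * (real (Suc m) + 2 * \<nu> + 1) =
        (\<mu> + 2 * real m) * (\<mu> + 2 * real m + 1) / 4"
      unfolding poly by (simp add: \<mu>_def field_simps)
    have "real (Suc m) * ((\<mu> + 2 * real m) * (\<mu> + 2 * real m + 1) / 4) * f (Suc m) =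
        (real (Suc m) * ((\<mu> + 2 * real m) * (\<mu> + 2 * real m + 1)) * f (Suc m)) / 4"
      by (simp only: times_divide_eq_left times_divide_eq_right)
    also have "\<dots> = - 4 * (real m + \<gamma>) * f m" unfolding * by simp
    finally show "real (Suc m) * ((real (Suc m) + \<nu>) * (real (Suc m) + 2 * \<nu>) + \<kappa> - \<epsilon> * (real (Suc m) + 2 * \<nu> + 1)) * f (Suc m) =
        - 4 * (real m + \<gamma>) * f m" unfolding e .
  qed (use t in simp)
  also have "(\<Sum>m. f m * (t / 16) ^ m) = mittag_leffler3 \<gamma> 2 \<mu> (- t)"
    unfolding mittag_leffler3_real_def[OF g(1)]
  proof (rule suminf_cong)
    fix m
    have "(- t) ^ m = (- 16) ^ m * (t / 16) ^ m" by (simp flip: power_mult_distrib)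
    thus "f m * (t / 16) ^ m = pochhammer \<gamma> m / fact m / Gamma (\<mu> + 2 * real m) * (- t) ^ m"
      by (simp add: f_def)
  qed
  finally show ?thesis by (simp add: \<mu>_def)
qed

text \<open>
  On the boundary of the region, \<open>b = \<gamma> / 2\<close> if \<open>\<gamma> \<ge> 1\<close> and \<open>b (2b + 1) = \<gamma>\<close> if \<open>\<gamma> < 1\<close>. In both cases
  \<open>2\<nu> + 1 = \<gamma> + 2b\<close>. In the first case \<open>\<epsilon> = 0\<close> and \<open>\<kappa> = \<gamma> (\<gamma> - 1) / 4\<close>, in the second \<open>\<kappa> = 0\<close> and \<open>\<epsilon> = b - \<gamma> / 2\<close>. Larger
  values of \<open>b\<close> follow by multiplication with a power of \<open>s\<close>.
\<close>

theorem completely_monotone_symbol_two: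
  assumes \<gamma>: "\<gamma> > 0" and b: "2 * b \<ge> \<gamma>" "b * (2 * b + 1) \<ge> \<gamma>"
  shows "completely_monotone (ml_symbol \<gamma> 2 (2 * b))"
proof (cases "\<gamma> \<ge> 1")
  case True
  have "completely_monotone (ml_symbol \<gamma> 2 (2 * (\<gamma> / 2 + \<gamma>) - 2 * \<gamma>))"
  proof (rule completely_monotone_symbol_if_nonneg(1))
    show "mittag_leffler3 \<gamma> 2 (2 * (\<gamma> / 2 + \<gamma>)) (- t) \<ge> 0" if "t > 0" for t :: real
      by (rule mittag_leffler3_two_nonneg[where \<nu> = "\<gamma> - 1 / 2" and \<epsilon> = 0 and \<kappa> = "\<gamma> * (\<gamma> - 1) / 4"])
        (use True that in \<open>auto simp: field_simps\<close>)
  qed (use \<gamma> in auto)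
  thus ?thesis by (rule completely_monotone_symbol_increase) (use b in simp)
next
  case False
  define c where "c = (sqrt (1 + 8 * \<gamma>) - 1) / 4"
  have "sqrt (1 + 8 * \<gamma>) > sqrt 1" using \<gamma> by (intro real_sqrt_less_mono) auto
  hence c0: "c > 0" by (simp add: c_def)
  have c: "c * (2 * c + 1) = \<gamma>"
  proof -
    define q where "q = sqrt (1 + 8 * \<gamma>)"
    have "q * q = 1 + 8 * \<gamma>" using \<gamma> by (simp add: q_def)
    thus ?thesis unfolding c_def q_def [symmetric] by (simp add: field_simps)
  qed
  have c12: "c \<le> 1 / 2"
  proof (rule ccontr)
    assume "\<not> c \<le> 1 / 2"
    hence "(1 / 2) * (2 * (1 / 2) + 1) \<le> c * (2 * c + 1)" by (intro mult_mono) auto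
    thus False using c False by simp
  qed
  have cb: "c \<le> b"
  proof (rule ccontr)
    assume "\<not> c \<le> b"
    hence "b * (2 * b + 1) < c * (2 * c + 1)" using b \<gamma> by (intro mult_strict_mono) auto
    thus False using b c by simp
  qed
  have "completely_monotone (ml_symbol \<gamma> 2 (2 * (c + \<gamma>) - 2 * \<gamma>))"
  proof (rule completely_monotone_symbol_if_nonneg(1))
    show "mittag_leffler3 \<gamma> 2 (2 * (c + \<gamma>)) (- t) \<ge> 0" if "t > 0" for t :: real
    proof (rule mittag_leffler3_two_nonneg[where \<nu> = "(\<gamma> + 2 * c - 1) / 2" and \<epsilon> = "c - \<gamma> / 2" and \<kappa> = 0])
      have "c * (2 * c + 1) \<le> c * 2" using c0 c12 by (intro mult_left_mono) auto
      thus "0 \<le> c - \<gamma> / 2" using c by simp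
      show "(M + (\<gamma> + 2 * c - 1) / 2) * (M + 2 * ((\<gamma> + 2 * c - 1) / 2)) + 0 - (c - \<gamma> / 2) * (M + 2 * ((\<gamma> + 2 * c - 1) / 2) + 1) =
          (M + c + \<gamma> - 1) * (M + c + \<gamma> - 1 / 2)" for M
        unfolding c [symmetric] by (simp add: field_simps)
    qed (use \<gamma> c0 that in \<open>auto simp: field_simps\<close>)
  qed (use \<gamma> c0 in auto)
  thus ?thesis by (rule completely_monotone_symbol_increase) (use cb in simp)
qed

theorem completely_monotone_symbol_hyperbola:
  assumes \<rho>: "0 < \<rho>" "\<rho> \<le> 2" and \<gamma>: "\<gamma> > 0" and b: "2 * b \<ge> \<gamma>" "b * (2 * b + 1) \<ge> \<gamma>"
  shows "completely_monotone (ml_symbol \<gamma> \<rho> (\<rho> * b))"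
proof (rule completely_monotone_cong)
  show "completely_monotone (\<lambda>s. ml_symbol \<gamma> 2 (2 * b) (s powr (\<rho> / 2)))"
    by (intro completely_monotone_compose_powr completely_monotone_symbol_two \<gamma> b) (use \<rho> in auto)
qed (simp add: ml_symbol_def powr_powr)

section \<open>The threshold\<close>

text \<open>
  From the second term on, the arguments of the Gamma function lie where it increases, so the series at \<open>c\<close> dominates
  the series for parameters to the right of \<open>c\<close>.
\<close>

lemma mittag_leffler3_right_continuous:
  fixes t c \<gamma> \<rho> :: real and X :: "nat \<Rightarrow> real"
  assumes g: "\<gamma> > 0" "\<rho> > 1" "c > 1" and X: "\<And>n. X n \<ge> c" "X \<longlonglongrightarrow> c"
  shows "(\<lambda>n. mittag_leffler3 \<gamma> \<rho> (X n) t) \<longlonglongrightarrow> mittag_leffler3 \<gamma> \<rho> c t"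
  unfolding mittag_leffler3_real_def[OF g(1)]
proof (rule tannerys_theorem [THEN conjunct2, THEN conjunct2])
  show "(\<lambda>n. pochhammer \<gamma> k / fact k / Gamma (X n + \<rho> * real k) * t ^ k) \<longlonglongrightarrow>
          pochhammer \<gamma> k / fact k / Gamma (c + \<rho> * real k) * t ^ k" for k
  proof -
    have pos: "c + \<rho> * real k > 0" using g by (intro add_pos_nonneg) auto
    hence "c + \<rho> * real k \<notin> \<int>\<^sub>\<le>\<^sub>0" by (auto elim!: nonpos_Ints_cases)
    thus ?thesis using Gamma_real_pos[OF pos] by (intro tendsto_intros X) auto
  qed
  show "summable (\<lambda>k. norm (pochhammer \<gamma> k / fact k / Gamma (c + \<rho> * real k) * t ^ k))"
  proof -
    have "norm (pochhammer \<gamma> k / fact k / Gamma (c + \<rho> * real k) * t ^ k) = pochhammer \<gamma> k / fact k / Gamma (c + \<rho> * real k) * \<bar>t\<bar> ^ k" for k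
      using g pochhammer_nonneg[OF g(1), of k] Gamma_real_pos[of "c + \<rho> * real k"]
      by (simp add: abs_mult power_abs add_pos_nonneg)
    thus ?thesis using mittag_leffler3_real_summable[of \<gamma> \<rho> c "\<bar>t\<bar>"] g by simp
  qed
  have "norm (pochhammer \<gamma> k / fact k / Gamma (X n + \<rho> * real k) * t ^ k) \<le>
          norm (pochhammer \<gamma> k / fact k / Gamma (c + \<rho> * real k) * t ^ k)" if "k \<ge> 1" for k n
  proof -
    have "\<rho> * 1 \<le> \<rho> * real k" using that g by (intro mult_left_mono) auto
    hence ge: "c + \<rho> * real k \<ge> 3 / 2" using g by linarith
    hence pos: "Gamma (c + \<rho> * real k) > 0" by (intro Gamma_real_pos) auto
    have "Gamma (c + \<rho> * real k) \<le> Gamma (X n + \<rho> * real k)"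
      using Gamma_real_strict_mono[OF ge, of "X n + \<rho> * real k"] X(1)[of n] by (cases "X n = c") auto
    hence "pochhammer \<gamma> k / fact k / Gamma (X n + \<rho> * real k) \<le> pochhammer \<gamma> k / fact k / Gamma (c + \<rho> * real k)"
      using pochhammer_nonneg[OF g(1), of k] pos by (intro divide_left_mono) auto
    moreover have "0 \<le> pochhammer \<gamma> k / fact k / Gamma (X n + \<rho> * real k)"
      using pochhammer_nonneg[OF g(1), of k] pos \<open>Gamma (c + \<rho> * real k) \<le> Gamma (X n + \<rho> * real k)\<close> by auto
    ultimately have "norm (pochhammer \<gamma> k / fact k / Gamma (X n + \<rho> * real k)) \<le> norm (pochhammer \<gamma> k / fact k / Gamma (c + \<rho> * real k))"
      unfolding real_norm_def abs_le_iff by linarith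
    thus ?thesis unfolding norm_mult by (intro mult_right_mono) auto
  qed
  note le = this
  have "\<forall>\<^sub>F p in at_top \<times>\<^sub>F sequentially. fst p \<ge> (1::nat) \<and> True"
    by (rule eventually_prodI[OF eventually_ge_at_top eventually_True])
  thus "\<forall>\<^sub>F (k, n) in at_top \<times>\<^sub>F sequentially. norm (pochhammer \<gamma> k / fact k / Gamma (X n + \<rho> * real k) * t ^ k) \<le>
        norm (pochhammer \<gamma> k / fact k / Gamma (c + \<rho> * real k) * t ^ k)"
    by (rule eventually_mono) (simp only: case_prod_unfold le)
qed auto

text \<open>
  The admissible \<open>\<mu>\<close> form an up-set that is bounded below by \<open>\<rho>\<close>, contains \<open>3\<rho> / 2\<close>, and is closed on the left by
  right continuity. Since its infimum is positive, it is the only real number that describes the set,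
  as the definite description requires.
\<close>

theorem ml_threshold_characterization:
  assumes \<rho>: "1 < \<rho>" "\<rho> \<le> 2"
  shows "\<mu> > 0 \<Longrightarrow> (\<forall>t::real. t > 0 \<longrightarrow> mittag_leffler3 1 \<rho> \<mu> (- t) \<ge> 0) \<longleftrightarrow> \<mu> \<ge> ml_threshold \<rho>"
    and "ml_threshold \<rho> \<ge> \<rho>"
proof -
  define P where "P = (\<lambda>\<mu>. \<forall>t::real. t > 0 \<longrightarrow> mittag_leffler3 1 \<rho> \<mu> (- t) \<ge> 0)"
  have PCM: "P \<mu> \<longleftrightarrow> completely_monotone (ml_symbol 1 \<rho> (\<mu> - \<rho>))" if "\<mu> > 0" for \<mu>
    using nonneg_if_completely_monotone_symbol[of 1 \<rho> \<mu>] completely_monotone_symbol_if_nonneg(1)[of 1 \<rho> \<mu>] \<rho> that unfolding P_def by auto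
  define S where "S = {\<mu>. \<mu> > 0 \<and> P \<mu>}"
  have lower: "\<mu> \<ge> \<rho>" if "\<mu> \<in> S" for \<mu>
    using that completely_monotone_symbol_exponent_nonneg[of 1 \<rho> "\<mu> - \<rho>"] by (auto simp: S_def PCM)
  have up: "\<mu>' \<in> S" if "\<mu> \<in> S" "\<mu> \<le> \<mu>'" for \<mu> \<mu>'
    using that completely_monotone_symbol_increase[of 1 \<rho> "\<mu> - \<rho>" "\<mu>' - \<rho>"] by (auto simp: S_def PCM)
  have ne: "3 * \<rho> / 2 \<in> S"
  proof -
    have "completely_monotone (ml_symbol 1 \<rho> (\<rho> * (1 / 2)))" by (rule completely_monotone_symbol_hyperbola) (use \<rho> in auto)
    thus ?thesis using \<rho> by (simp add: S_def PCM)
  qed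
  define c where "c = Inf S"
  have bdd: "bdd_below S" using lower by (auto simp: bdd_below_def)
  have c\<rho>: "c \<ge> \<rho>" unfolding c_def using ne lower by (intro cInf_greatest) auto
  have gt: "\<mu> \<in> S" if \<mu>: "\<mu> > c" for \<mu>
  proof -
    have "\<exists>\<mu>'\<in>S. \<mu>' < \<mu>"
      using \<mu> cInf_less_iff[OF _ bdd, of \<mu>] ne unfolding c_def by blast
    thus ?thesis using up by (meson less_imp_le)
  qed
  have "P c" unfolding P_def
  proof (intro allI impI)
    fix t :: real assume t: "t > 0"
    define X where "X = (\<lambda>n. c + 1 / real (Suc n))"
    have "X \<longlonglongrightarrow> c + 0" unfolding X_def by (intro tendsto_add tendsto_const LIMSEQ_Suc lim_1_over_n)
    hence "(\<lambda>n. mittag_leffler3 1 \<rho> (X n) (- t)) \<longlonglongrightarrow> mittag_leffler3 1 \<rho> c (- t)"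
      using \<rho> c\<rho> by (intro mittag_leffler3_right_continuous) (auto simp: X_def)
    moreover have "mittag_leffler3 1 \<rho> (X n) (- t) \<ge> 0" for n
      using gt[of "X n"] t by (auto simp: S_def P_def X_def)
    ultimately show "mittag_leffler3 1 \<rho> c (- t) \<ge> 0"
      by (intro tendsto_lowerbound[where F = sequentially]) auto
  qed
  hence "c \<in> S" using c\<rho> \<rho> by (simp add: S_def)
  have iff: "P \<mu> \<longleftrightarrow> \<mu> \<ge> c" if "\<mu> > 0" for \<mu>
  proof
    assume "P \<mu>"
    thus "\<mu> \<ge> c" unfolding c_def using that by (intro cInf_lower bdd) (simp add: S_def)
  next
    assume "\<mu> \<ge> c"
    thus "P \<mu>" using up[OF \<open>c \<in> S\<close>] by (simp add: S_def)
  qed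
  have "ml_threshold \<rho> = (THE c. \<forall>\<mu>>0. P \<mu> \<longleftrightarrow> \<mu> \<ge> c)"
    unfolding ml_threshold_def P_def mittag_leffler3_1 ..
  also have "\<dots> = c"
  proof (rule the_equality)
    show "\<forall>\<mu>>0. P \<mu> \<longleftrightarrow> \<mu> \<ge> c" using iff by blast
    fix c' assume c': "\<forall>\<mu>>0. P \<mu> \<longleftrightarrow> \<mu> \<ge> c'"
    show "c' = c"
    proof (rule antisym)
      show "c' \<le> c" using c' \<open>c \<in> S\<close> by (auto simp: S_def)
      show "c \<le> c'"
      proof (rule ccontr)
        assume "\<not> c \<le> c'"
        define \<mu> where "\<mu> = max c' (c / 2)"
        have "\<mu> > 0" "\<mu> < c" "\<mu> \<ge> c'" using \<open>\<not> c \<le> c'\<close> c\<rho> \<rho> by (auto simp: \<mu>_def)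
        thus False using c' iff[of \<mu>] by auto
      qed
    qed
  qed
  finally have "ml_threshold \<rho> = c" .
  thus "\<mu> > 0 \<Longrightarrow> (\<forall>t::real. t > 0 \<longrightarrow> mittag_leffler3 1 \<rho> \<mu> (- t) \<ge> 0) \<longleftrightarrow> \<mu> \<ge> ml_threshold \<rho>"
    and "ml_threshold \<rho> \<ge> \<rho>"
    using iff[of \<mu>] c\<rho> by (auto simp: P_def)
qed

section \<open>Signs of three-parametric Mittag-Leffler functions\<close>

lemma mittag_leffler3_nonneg_arg:
  assumes "\<gamma> > 0" "\<rho> > 0" "\<mu> > 0" "x \<ge> 0"
  shows "mittag_leffler3 \<gamma> \<rho> \<mu> (x::real) \<ge> 0"
  unfolding mittag_leffler3_real_def[OF assms(1)]
proof (rule suminf_nonneg)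
  show "summable (\<lambda>n. pochhammer \<gamma> n / fact n / Gamma (\<mu> + \<rho> * real n) * x ^ n)"
    by (rule mittag_leffler3_real_summable) fact+
  fix n
  have "Gamma (\<mu> + \<rho> * real n) > 0" using assms by (intro Gamma_real_pos add_pos_nonneg) auto
  thus "0 \<le> pochhammer \<gamma> n / fact n / Gamma (\<mu> + \<rho> * real n) * x ^ n"
    using assms pochhammer_nonneg[of \<gamma> n] by (intro mult_nonneg_nonneg divide_nonneg_nonneg) auto
qed

theorem corollary1p4:
  fixes \<rho> \<mu> \<gamma> :: real
  assumes "\<rho> > 0" and "\<mu> > 0" and "\<gamma> > 0"
  shows "(\<rho> > 2
            \<or> \<mu> < \<gamma> * \<rho>
            \<or> (\<rho> = 2 \<and> \<mu> < 3 * \<gamma>)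
            \<or> (1 < \<rho> \<and> \<rho> \<le> 2 \<and> \<gamma> \<ge> 1 \<and> \<mu> < \<gamma> * \<rho> + ml_threshold \<rho> - \<rho>)
          \<longrightarrow> (\<exists>x::real. x < 0 \<and> mittag_leffler3 \<gamma> \<rho> \<mu> x < 0))
       \<and> ((\<rho> \<le> 1 \<and> \<mu> \<ge> \<rho> * \<gamma>)
            \<or> (1 < \<rho> \<and> \<rho> \<le> 2 \<and> \<gamma> \<le> 1 \<and> \<mu> \<ge> \<gamma> * \<rho> + ml_threshold \<rho> - \<rho>)
            \<or> (1 < \<rho> \<and> \<rho> \<le> 2 \<and> 2 * \<mu> \<ge> 3 * \<gamma> * \<rho>
                 \<and> 2 * (\<mu> / \<rho> - \<gamma>) * (\<mu> / \<rho> - \<gamma> + 1 / 2) \<ge> \<gamma>)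
          \<longrightarrow> (\<forall>x::real. mittag_leffler3 \<gamma> \<rho> \<mu> x \<ge> 0))"
proof (intro conjI impI)
  note g = assms(3,1,2)
  define a where "a = \<mu> - \<rho> * \<gamma>"
  let ?N = "\<forall>t::real. t > 0 \<longrightarrow> mittag_leffler3 \<gamma> \<rho> \<mu> (- t) \<ge> 0"
  have a_eq: "\<mu> - \<rho> * \<gamma> = a" by (simp add: a_def)
  {
    assume cond: "\<rho> > 2
            \<or> \<mu> < \<gamma> * \<rho>
            \<or> (\<rho> = 2 \<and> \<mu> < 3 * \<gamma>)
            \<or> (1 < \<rho> \<and> \<rho> \<le> 2 \<and> \<gamma> \<ge> 1 \<and> \<mu> < \<gamma> * \<rho> + ml_threshold \<rho> - \<rho>)"
    have "\<not> ?N"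
    proof
      assume N: ?N
      have \<rho>2: "\<rho> \<le> 2"
        using negative_if_rho_gt_2[of \<gamma> \<rho> \<mu>] g N by (meson not_le)
      have CM: "completely_monotone (ml_symbol \<gamma> \<rho> a)"
        using completely_monotone_symbol_if_nonneg(1)[OF g \<rho>2] N by (simp add: a_def)
      hence a0: "a \<ge> 0" by (rule completely_monotone_symbol_exponent_nonneg) fact
      have not3: "\<not> (\<rho> = 2 \<and> \<mu> < 3 * \<gamma>)"
        using negative_if_rho_eq_2[of \<gamma> \<mu>] g N by (meson not_le)
      from cond a0 \<rho>2 not3 have c4: "1 < \<rho>" "\<gamma> \<ge> 1" "\<mu> < \<gamma> * \<rho> + ml_threshold \<rho> - \<rho>"
        by (auto simp: a_def mult.commute)
      have CM1: "completely_monotone (ml_symbol 1 \<rho> a)"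
      proof (cases "\<gamma> = 1")
        case False
        thus ?thesis using c4 g \<rho>2 a0 CM by (intro completely_monotone_symbol_decrease_gamma[of \<rho> 1 \<gamma>]) auto
      qed (use CM in simp)
      have pos: "a + \<rho> > 0" using a0 g by simp
      have "mittag_leffler3 1 \<rho> (a + \<rho>) (- t) \<ge> 0" if "t > 0" for t :: real
        by (rule nonneg_if_completely_monotone_symbol) (use CM1 pos g that in auto)
      hence "a + \<rho> \<ge> ml_threshold \<rho>"
        using ml_threshold_characterization(1)[OF c4(1) \<rho>2 pos] by blast
      thus False using c4(3) by (simp add: a_def mult.commute)
    qed
    then obtain t :: real where "t > 0" "mittag_leffler3 \<gamma> \<rho> \<mu> (- t) < 0" by (meson not_le)
    thus "\<exists>x::real. x < 0 \<and> mittag_leffler3 \<gamma> \<rho> \<mu> x < 0" by (intro exI[of _ "- t"]) simp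
  }
  {
    assume cond: "(\<rho> \<le> 1 \<and> \<mu> \<ge> \<rho> * \<gamma>)
            \<or> (1 < \<rho> \<and> \<rho> \<le> 2 \<and> \<gamma> \<le> 1 \<and> \<mu> \<ge> \<gamma> * \<rho> + ml_threshold \<rho> - \<rho>)
            \<or> (1 < \<rho> \<and> \<rho> \<le> 2 \<and> 2 * \<mu> \<ge> 3 * \<gamma> * \<rho>
                 \<and> 2 * (\<mu> / \<rho> - \<gamma>) * (\<mu> / \<rho> - \<gamma> + 1 / 2) \<ge> \<gamma>)"
    have CM: "completely_monotone (ml_symbol \<gamma> \<rho> a)"
      using cond
    proof (elim disjE conjE)
      assume "\<rho> \<le> 1" "\<mu> \<ge> \<rho> * \<gamma>"
      thus ?thesis using g by (intro completely_monotone_symbol_le_1) (auto simp: a_def)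
    next
      assume *: "1 < \<rho>" "\<rho> \<le> 2" "\<gamma> \<le> 1" "\<mu> \<ge> \<gamma> * \<rho> + ml_threshold \<rho> - \<rho>"
      define c where "c = ml_threshold \<rho>"
      have c: "c \<ge> \<rho>" unfolding c_def by (rule ml_threshold_characterization(2)[OF *(1,2)])
      have c_pos: "c > 0" using c * by simp
      have N: "\<forall>t::real. t > 0 \<longrightarrow> mittag_leffler3 1 \<rho> c (- t) \<ge> 0"
        using ml_threshold_characterization(1)[OF *(1,2) c_pos] by (simp add: c_def)
      have CM1: "completely_monotone (ml_symbol 1 \<rho> (c - \<rho>))"
        using completely_monotone_symbol_if_nonneg(1)[of 1 \<rho> c] N * c_pos by simp
      have "completely_monotone (ml_symbol \<gamma> \<rho> (c - \<rho>))"
      proof (cases "\<gamma> = 1")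
        case False
        thus ?thesis using * g c CM1 by (intro completely_monotone_symbol_decrease_gamma[of \<rho> \<gamma> 1]) auto
      qed (use CM1 in simp)
      thus ?thesis by (rule completely_monotone_symbol_increase) (use * in \<open>simp add: c_def a_def mult.commute\<close>)
    next
      assume *: "1 < \<rho>" "\<rho> \<le> 2" "2 * \<mu> \<ge> 3 * \<gamma> * \<rho>"
        "2 * (\<mu> / \<rho> - \<gamma>) * (\<mu> / \<rho> - \<gamma> + 1 / 2) \<ge> \<gamma>"
      have "completely_monotone (ml_symbol \<gamma> \<rho> (\<rho> * (\<mu> / \<rho> - \<gamma>)))"
        using * g by (intro completely_monotone_symbol_hyperbola) (auto simp: field_simps)
      moreover have "\<rho> * (\<mu> / \<rho> - \<gamma>) = a" using g by (simp add: a_def field_simps)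
      ultimately show ?thesis by simp
    qed
    show "\<forall>x::real. mittag_leffler3 \<gamma> \<rho> \<mu> x \<ge> 0"
    proof
      fix x :: real
      show "mittag_leffler3 \<gamma> \<rho> \<mu> x \<ge> 0"
      proof (cases "x \<ge> 0")
        case False
        have "mittag_leffler3 \<gamma> \<rho> \<mu> (- (- x)) \<ge> 0"
          by (rule nonneg_if_completely_monotone_symbol[OF g]) (use CM False in \<open>simp_all add: a_def\<close>)
        thus ?thesis by simp
      qed (use mittag_leffler3_nonneg_arg g in auto)
    qed
  }
qed

end
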